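(* Let $M$ be a connected matroid (on a finite ground set) of rank at least $4$. Then $M$ is skew-representable if and only if it is fully modular extendable.
   Context: "Matroid" means a matroid on a finite ground set, written $M=(S,r)$ with rank function $r$. A matroid is connected if any two distinct elements lie in a common circuit. For a matroid $M=(S,r)$ and $A,B\subseteq S$, a one-step extension of $M$ with respect to $A$ and $B$ is a matroid $M'=(S',r')$ with $S\subseteq S'$, $r'(X)=r(X)$ for all $X\subseteq S$, for which there is $Z\subseteq S'$ with $r'(A\cup Z)=r(A)$, $r'(B\cup Z)=r(B)$ and $r'(Z)=r(A)+r(B)-r(A\cup B)$. Every matroid is $0$-modular extendable. For $k\ge 1$, $M$ is $k$-modular extendable if for all $A,B\subseteq S$ there is a one-step extension of $M$ with respect to $A$ and $B$ that is $(k-1)$-modular extendable. $M$ is fully modular extendable if it is $k$-modular extendable for every positive integer $k$. A matroid is representable over a skew field (division ring) $\mathbb{F}$ if there is a family of vectors in a right vector space over $\mathbb{F}$, indexed by the ground set, whose linear independence relation is the independence relation of the matroid. It is skew-representable if it is representable over some skew field. *)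

theory Defs
  imports "HOL-Library.Infinite_Typeclass" "HOL-Algebra.Module"
begin

text \<open>
  A matroid is a pair of a finite set \<open>S\<close> and a function \<open>r\<close> of which only the values on
  subsets of \<open>S\<close> matter.
\<close>

locale rank_matroid =
  fixes S :: "'a set" and r :: "'a set \<Rightarrow> nat"
  assumes finite_ground: "finite S"
    and rank_le_card: "X \<subseteq> S \<Longrightarrow> r X \<le> card X"
    and rank_mono: "X \<subseteq> Y \<Longrightarrow> Y \<subseteq> S \<Longrightarrow> r X \<le> r Y"
    and rank_submodular:
      "X \<subseteq> S \<Longrightarrow> Y \<subseteq> S \<Longrightarrow> r (X \<union> Y) + r (X \<inter> Y) \<le> r X + r Y"

definition matroid_indep :: "'a set \<Rightarrow> ('a set \<Rightarrow> nat) \<Rightarrow> 'a set \<Rightarrow> bool" where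
  "matroid_indep S r X \<longleftrightarrow> X \<subseteq> S \<and> r X = card X"

definition matroid_circuit :: "'a set \<Rightarrow> ('a set \<Rightarrow> nat) \<Rightarrow> 'a set \<Rightarrow> bool" where
  "matroid_circuit S r C \<longleftrightarrow>
     C \<subseteq> S \<and> \<not> matroid_indep S r C \<and> (\<forall>D. D \<subset> C \<longrightarrow> matroid_indep S r D)"

definition matroid_connected :: "'a set \<Rightarrow> ('a set \<Rightarrow> nat) \<Rightarrow> bool" where
  "matroid_connected S r \<longleftrightarrow>
     (\<forall>x\<in>S. \<forall>y\<in>S. x \<noteq> y \<longrightarrow> (\<exists>C. matroid_circuit S r C \<and> x \<in> C \<and> y \<in> C))"


text \<open>
  The subtraction below is on natural numbers, but it never truncates for a matroid \<open>(S, r)\<close>,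
  by submodularity.
\<close>

definition one_step_extension ::
  "'a set \<Rightarrow> ('a set \<Rightarrow> nat) \<Rightarrow> 'a set \<Rightarrow> 'a set \<Rightarrow> 'a set \<Rightarrow> ('a set \<Rightarrow> nat) \<Rightarrow> bool" where
  "one_step_extension S r A B S' r' \<longleftrightarrow>
     rank_matroid S' r' \<and> S \<subseteq> S' \<and> (\<forall>X. X \<subseteq> S \<longrightarrow> r' X = r X) \<and>
     (\<exists>Z. Z \<subseteq> S' \<and> r' (A \<union> Z) = r A \<and> r' (B \<union> Z) = r B \<and>
          r' Z = r A + r B - r (A \<union> B))"

text \<open>
  Ground sets of extensions live in the same type as \<open>S\<close>; this type is required to be infinite
  so that new elements are always available.
\<close>

primrec modular_extendable :: "nat \<Rightarrow> 'a::infinite set \<Rightarrow> ('a set \<Rightarrow> nat) \<Rightarrow> bool" where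
  "modular_extendable 0 S r \<longleftrightarrow> rank_matroid S r"
| "modular_extendable (Suc k) S r \<longleftrightarrow> rank_matroid S r \<and>
     (\<forall>A B. A \<subseteq> S \<longrightarrow> B \<subseteq> S \<longrightarrow>
        (\<exists>S' r'. one_step_extension S r A B S' r' \<and> modular_extendable k S' r'))"

definition fully_modular_extendable :: "'a::infinite set \<Rightarrow> ('a set \<Rightarrow> nat) \<Rightarrow> bool" where
  "fully_modular_extendable S r \<longleftrightarrow> (\<forall>k\<ge>1. modular_extendable k S r)"


locale skew_field = ring F for F (structure) +
  assumes one_neq_zero: "\<one> \<noteq> \<zero>"
    and skew_field_Units: "Units F = carrier F - {\<zero>}"

text \<open>
  The scalar multiplication \<open>smult V\<close> takes the scalar as its first argument, so
  \<open>a \<odot>\<^bsub>V\<^esub> x\<close> denotes the product \<open>x a\<close> in a right vector space; this is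
  visible in the order of factors in \<open>rsmult_assoc\<close>. The multiplication and the unit
  of the record \<open>V\<close> are not used, as in the locale \<^locale>\<open>module\<close>.
\<close>

locale right_vector_space = skew_field F + V?: abelian_group V
  for F :: "('f, 'm) ring_scheme" (structure) and V :: "('f, 'v, 'n) module_scheme" (structure) +
  assumes rsmult_closed:
      "a \<in> carrier F \<Longrightarrow> x \<in> carrier V \<Longrightarrow> a \<odot>\<^bsub>V\<^esub> x \<in> carrier V"
    and rsmult_distr_scalar:
      "a \<in> carrier F \<Longrightarrow> b \<in> carrier F \<Longrightarrow> x \<in> carrier V \<Longrightarrow>
       (a \<oplus>\<^bsub>F\<^esub> b) \<odot>\<^bsub>V\<^esub> x = a \<odot>\<^bsub>V\<^esub> x \<oplus>\<^bsub>V\<^esub> b \<odot>\<^bsub>V\<^esub> x"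
    and rsmult_distr_vector:
      "a \<in> carrier F \<Longrightarrow> x \<in> carrier V \<Longrightarrow> y \<in> carrier V \<Longrightarrow>
       a \<odot>\<^bsub>V\<^esub> (x \<oplus>\<^bsub>V\<^esub> y) = a \<odot>\<^bsub>V\<^esub> x \<oplus>\<^bsub>V\<^esub> a \<odot>\<^bsub>V\<^esub> y"
    and rsmult_assoc:
      "a \<in> carrier F \<Longrightarrow> b \<in> carrier F \<Longrightarrow> x \<in> carrier V \<Longrightarrow>
       (a \<otimes>\<^bsub>F\<^esub> b) \<odot>\<^bsub>V\<^esub> x = b \<odot>\<^bsub>V\<^esub> (a \<odot>\<^bsub>V\<^esub> x)"
    and rsmult_one: "x \<in> carrier V \<Longrightarrow> \<one>\<^bsub>F\<^esub> \<odot>\<^bsub>V\<^esub> x = x"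

definition lin_indep_family ::
  "'f ring \<Rightarrow> ('f, 'v) module \<Rightarrow> ('a \<Rightarrow> 'v) \<Rightarrow> 'a set \<Rightarrow> bool" where
  "lin_indep_family F V v X \<longleftrightarrow>
     (\<forall>c \<in> X \<rightarrow> carrier F.
        (\<Oplus>\<^bsub>V\<^esub>x\<in>X. c x \<odot>\<^bsub>V\<^esub> v x) = \<zero>\<^bsub>V\<^esub> \<longrightarrow> (\<forall>x\<in>X. c x = \<zero>\<^bsub>F\<^esub>))"

definition matroid_representation ::
  "'f ring \<Rightarrow> ('f, 'v) module \<Rightarrow> 'a set \<Rightarrow> ('a set \<Rightarrow> nat) \<Rightarrow> ('a \<Rightarrow> 'v) \<Rightarrow> bool" where
  "matroid_representation F V S r v \<longleftrightarrow>
     right_vector_space F V \<and> v \<in> S \<rightarrow> carrier V \<and>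
     (\<forall>X. X \<subseteq> S \<longrightarrow> (lin_indep_family F V v X \<longleftrightarrow> matroid_indep S r X))"

text \<open>
  HOL cannot quantify over types inside a formula, so the types \<open>'f\<close> and \<open>'v\<close> in which the
  skew field and the vector space have their carriers are parameters. Any infinite types will
  do: a finite family of vectors with coordinates in a skew field already has its coordinates in
  a countable skew subfield, so the truth value does not depend on \<open>'f\<close> and \<open>'v\<close>.
\<close>

definition skew_representable ::
  "'f::infinite itself \<Rightarrow> 'v::infinite itself \<Rightarrow> 'a set \<Rightarrow> ('a set \<Rightarrow> nat) \<Rightarrow> bool" where
  "skew_representable _ _ S r \<longleftrightarrow>
     (\<exists>(F :: 'f ring) (V :: ('f, 'v) module) v. matroid_representation F V S r v)"

end

theory Submission
  imports Defs "HOL-Library.Nat_Bijection" "HOL-Library.Infinite_Set"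
begin

text \<open>
  If the matroid is represented by vectors, then a basis of the intersection of the spans of two sets
  of vectors provides a one-step extension, which is again represented, so the process never stops.

  Conversely, iterating one-step extensions that meet a fixed enumeration of tasks \<open>(A, B)\<close> and passing
  to a limit (all ranks are bounded by \<open>r S\<close>) yields a rank function on the finite sets of natural
  numbers that extends \<open>r\<close> and in which every pair of flats is modular. Its points form a projective
  space; connectedness of the matroid gives every line a third point. As the rank is at least 4, there
  is a hyperplane \<open>H\<close> that contains a plane, and the complement \<open>E\<close> of \<open>H\<close> is an affine space in which
  Desargues' theorem holds. Following Artin, the translations of \<open>E\<close> form an abelian group, whose
  direction-preserving endomorphisms form a skew field over which the projective space has homogeneous
  coordinates. All of this is countable and hence fits into any infinite types.
\<close>

section \<open>Rank functions and closures\<close>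

text \<open>Extendability for each finite \<open>k\<close> gives towers of extensions with no
  relation between towers of different heights, so no infinite tower can be read off directly. What
  the towers share is a labelling: each stage spends exactly \<open>r S\<close> labels, whatever
  extension was chosen, so all pulled back rank functions live on the same sets of natural numbers.
  That many labels suffice because only a basis of the set \<open>Z\<close> is labelled, and it lies
  in the span of \<open>A\<close>. For the same reason the labelled elements never exceed rank
  \<open>r S\<close>, which leaves finitely many values per set and makes a limit possible. Rank at
  least 4 means that every plane of the affine space misses a point, so that a planar Desargues
  configuration can be lifted out of its plane. Translations and homotheties come from one
  construction, carried out for a pencil of lines whose centre is at infinity or in the affine
  space. A scalar is stored as its value at one fixed vector \<open>e\<close>, which keeps the skew
  field inside the type of the points.\<close>

locale rank_fun =
  fixes U :: "'a set" and r :: "'a set \<Rightarrow> nat"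
  assumes le_card: "finite X \<Longrightarrow> X \<subseteq> U \<Longrightarrow> r X \<le> card X"
    and mono: "finite Y \<Longrightarrow> X \<subseteq> Y \<Longrightarrow> Y \<subseteq> U \<Longrightarrow> r X \<le> r Y"
    and submodular: "finite X \<Longrightarrow> finite Y \<Longrightarrow> X \<subseteq> U \<Longrightarrow> Y \<subseteq> U \<Longrightarrow> r (X \<union> Y) + r (X \<inter> Y) \<le> r X + r Y"

text \<open>Relativizing the axioms to finite sets lets \<open>U\<close> be infinite: the carrier of
  a vector space and the set of all labels both serve as ground sets below. On a finite ground set
  nothing changes.\<close>

lemma rank_matroid_iff_rank_fun: "finite S \<Longrightarrow> rank_matroid S r \<longleftrightarrow> rank_fun S r"
  unfolding rank_matroid_def rank_fun_def by (meson finite_subset)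

context rank_fun
begin

lemma rank_empty: "r {} = 0"
  using le_card[of "{}"] by auto

lemma rank_insert_le: "finite X \<Longrightarrow> X \<subseteq> U \<Longrightarrow> x \<in> U \<Longrightarrow> r (insert x X) \<le> r X + 1"
  using submodular[of X "{x}"] le_card[of "{x}"] by auto

definition spanned :: "'a set \<Rightarrow> 'a \<Rightarrow> bool" where
  "spanned X x \<longleftrightarrow> r (insert x X) = r X"

lemma not_spanned: "finite X \<Longrightarrow> X \<subseteq> U \<Longrightarrow> x \<in> U \<Longrightarrow> \<not> spanned X x \<longleftrightarrow> r (insert x X) = r X + 1"
  using rank_insert_le[of X x] mono[of "insert x X" X, OF _ subset_insertI] unfolding spanned_def by auto

lemma spanned_mono:
  assumes "finite Y" "X \<subseteq> Y" "Y \<subseteq> U" "x \<in> U" "spanned X x"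
  shows "spanned Y x"
proof (cases "x \<in> Y")
  case True
  then show ?thesis by (simp add: spanned_def insert_absorb)
next
  case False
  have f: "finite X" using assms finite_subset by auto
  have "insert x X \<union> Y = insert x Y" "insert x X \<inter> Y = X" using assms False by auto
  then show ?thesis
    using submodular[of "insert x X" Y] mono[of "insert x Y" Y, OF _ subset_insertI] assms f by (auto simp: spanned_def)
qed

lemma rank_union_spanned:
  assumes "finite X" "X \<subseteq> U" "finite Y" "Y \<subseteq> U" "\<And>y. y \<in> Y \<Longrightarrow> spanned X y"
  shows "r (X \<union> Y) = r X"
  using assms(3,4,5)
proof (induction Y rule: finite_induct)
  case (insert y Y)
  have "spanned (X \<union> Y) y" by (rule spanned_mono[of _ X]) (use insert assms in auto)
  then show ?case using insert by (simp add: spanned_def)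
qed simp

lemma spanned_trans:
  assumes "finite X" "X \<subseteq> U" "finite Y" "Y \<subseteq> U" "\<And>y. y \<in> Y \<Longrightarrow> spanned X y" "x \<in> U" "spanned Y x"
  shows "spanned X x"
proof -
  have 1: "r (X \<union> Y) = r X" using rank_union_spanned assms by auto
  have "spanned (X \<union> Y) x" by (rule spanned_mono[of _ Y]) (use assms in auto)
  then have "r (insert x (X \<union> Y)) = r X" using 1 by (simp add: spanned_def)
  moreover have "r (insert x X) \<le> r (insert x (X \<union> Y))" by (rule mono) (use assms in auto)
  moreover have "r X \<le> r (insert x X)" by (rule mono) (use assms in auto)
  ultimately show ?thesis by (simp add: spanned_def)
qed

text \<open>Greedy growth: an element that is not spanned by the part of \<open>X\<close> already
  seen is not spanned by the smaller \<open>J\<close> either, so adding it keeps \<open>J\<close>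
  independent.\<close>

lemma basis_extend:
  assumes "finite X" "X \<subseteq> U" "I \<subseteq> X" "r I = card I"
  shows "\<exists>J. I \<subseteq> J \<and> J \<subseteq> X \<and> r J = card J \<and> r J = r X"
proof -
  have "\<exists>J. I \<subseteq> J \<and> J \<subseteq> I \<union> Y \<and> r J = card J \<and> r J = r (I \<union> Y)" if "finite Y" "Y \<subseteq> X" for Y
    using that
  proof (induction Y rule: finite_induct)
    case empty then show ?case using assms by auto
  next
    case (insert y Y)
    have fI: "finite I" using assms finite_subset by auto
    from insert obtain J where J: "I \<subseteq> J" "J \<subseteq> I \<union> Y" "r J = card J" "r J = r (I \<union> Y)" by auto
    have f: "finite (I \<union> Y)" "I \<union> Y \<subseteq> U" "y \<in> U" using fI insert assms by auto
    have f': "finite J" "J \<subseteq> U" using J f finite_subset[of J "I \<union> Y"] by auto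
    show ?case
    proof (cases "spanned (I \<union> Y) y")
      case True
      then show ?thesis using J by (intro exI[of _ J]) (auto simp: spanned_def)
    next
      case False
      then have ny: "\<not> spanned J y" using spanned_mono[of "I \<union> Y" J y] f f' J by auto
      then have "y \<notin> J" by (auto simp: spanned_def insert_absorb)
      then have "r (insert y J) = card (insert y J)" "r (insert y J) = r (insert y (I \<union> Y))"
        using not_spanned[of J y] not_spanned[of "I \<union> Y" y] f f' J False ny by auto
      then show ?thesis using J by (intro exI[of _ "insert y J"]) auto
    qed
  qed
  from this[of X] show ?thesis using assms by (simp add: sup.absorb2)
qed

lemma basis_ex: "finite X \<Longrightarrow> X \<subseteq> U \<Longrightarrow> \<exists>J \<subseteq> X. r J = card J \<and> r J = r X"
  using basis_extend[of X "{}"] rank_empty by auto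

lemma indep_subset:
  assumes "finite X" "X \<subseteq> U" "r X = card X" "Y \<subseteq> X"
  shows "r Y = card Y"
proof -
  have "r (Y \<union> (X - Y)) + r (Y \<inter> (X - Y)) \<le> r Y + r (X - Y)"
    by (rule submodular) (use assms finite_subset in auto)
  moreover have "Y \<union> (X - Y) = X" "Y \<inter> (X - Y) = {}" using assms by auto
  moreover have "r (X - Y) \<le> card (X - Y)" "r Y \<le> card Y" using le_card assms finite_subset[of Y X] by auto
  moreover have "card X = card Y + card (X - Y)"
    using assms by (metis card_Diff_subset card_mono finite_subset le_add_diff_inverse)
  ultimately show ?thesis using assms rank_empty by auto
qed

lemma indep_insert:
  assumes "finite X" "X \<subseteq> U" "x \<in> U" "x \<notin> X"
  shows "r (insert x X) = card (insert x X) \<longleftrightarrow> r X = card X \<and> \<not> spanned X x"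
  using indep_subset[of "insert x X" X, OF _ _ _ subset_insertI] not_spanned[of X x] assms by (auto simp: spanned_def)

text \<open>The image of an intersection may be smaller than the intersection of the images, which
  is the harmless direction for submodularity. So \<open>f\<close> may identify elements; repeated
  labels and repeated vectors are handled this way.\<close>

lemma pullback:
  assumes "f ` S \<subseteq> U"
  shows "rank_fun S (\<lambda>X. r (f ` X))"
proof
  fix X assume "finite X" "X \<subseteq> S"
  then show "r (f ` X) \<le> card X"
    using le_card[of "f ` X"] assms card_image_le[of X f] by fastforce
next
  fix X Y assume "finite Y" "X \<subseteq> Y" "Y \<subseteq> S"
  then show "r (f ` X) \<le> r (f ` Y)" by (intro mono) (use assms in auto)
next
  fix X Y assume a: "finite X" "finite Y" "X \<subseteq> S" "Y \<subseteq> S"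
  have "r (f ` X \<union> f ` Y) + r (f ` X \<inter> f ` Y) \<le> r (f ` X) + r (f ` Y)"
    by (rule submodular) (use a assms in auto)
  moreover have "r (f ` (X \<inter> Y)) \<le> r (f ` X \<inter> f ` Y)" by (rule mono) (use a assms in auto)
  ultimately show "r (f ` (X \<union> Y)) + r (f ` (X \<inter> Y)) \<le> r (f ` X) + r (f ` Y)" by (simp add: image_Un)
qed

end

text \<open>Each of the two ranks of \<open>X\<close> is attained on an independent subset of
  \<open>X\<close>, and that subset is independent for the other function too.\<close>

lemma rank_fun_eqI:
  assumes "rank_fun S r" "rank_fun S r'" "\<And>X. finite X \<Longrightarrow> X \<subseteq> S \<Longrightarrow> r X = card X \<longleftrightarrow> r' X = card X"
    and X: "finite X" "X \<subseteq> S"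
  shows "r X = r' X"
proof -
  have "r X \<le> r' X" if "rank_fun S r" "rank_fun S r'" "\<And>X. finite X \<Longrightarrow> X \<subseteq> S \<Longrightarrow> r X = card X \<Longrightarrow> r' X = card X" for r r'
  proof -
    interpret a: rank_fun S r by fact
    interpret b: rank_fun S r' by fact
    obtain J where J: "J \<subseteq> X" "r J = card J" "r J = r X" using a.basis_ex X by blast
    then have "r' J = card J" using that(3)[of J] X finite_subset[of J X] by auto
    moreover have "r' J \<le> r' X" using b.mono J X by auto
    ultimately show ?thesis using J by simp
  qed
  from this[OF assms(1,2)] this[OF assms(2,1)] assms(3) show ?thesis by (meson le_antisym)
qed

section \<open>Rank functions from closure operators with exchange\<close>

locale exchange_closure =
  fixes U :: "'a set" and cl :: "'a set \<Rightarrow> 'a set"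
  assumes cl_sub: "X \<subseteq> U \<Longrightarrow> cl X \<subseteq> U"
    and cl_ext: "X \<subseteq> U \<Longrightarrow> X \<subseteq> cl X"
    and cl_mono: "X \<subseteq> Y \<Longrightarrow> cl X \<subseteq> cl Y"
    and cl_idem: "X \<subseteq> U \<Longrightarrow> cl (cl X) = cl X"
    and cl_exchange: "X \<subseteq> U \<Longrightarrow> x \<in> U \<Longrightarrow> y \<in> U \<Longrightarrow> x \<notin> cl X \<Longrightarrow> x \<in> cl (insert y X) \<Longrightarrow> y \<in> cl (insert x X)"
begin

lemma cl_insert: "X \<subseteq> U \<Longrightarrow> x \<in> cl X \<Longrightarrow> cl (insert x X) = cl X"
  using cl_mono[of "insert x X" "cl X"] cl_mono[of X "insert x X"] cl_ext[of X] cl_idem[of X] by auto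

text \<open>
  The rank of a finite set counts the elements that enlarge the closure when they are added one by
  one; the exchange property makes the order irrelevant, so this is a fold over the set.
\<close>

definition step :: "'a \<Rightarrow> 'a set \<times> nat \<Rightarrow> 'a set \<times> nat" where
  "step x p = (insert x (fst p), snd p + (if x \<in> cl (fst p \<inter> U) then 0 else 1))"

text \<open>The accumulator \<open>p\<close> is arbitrary, so its set may leave \<open>U\<close>;
  this is why \<open>step\<close> intersects with \<open>U\<close> before taking the
  closure.\<close>

lemma step_commute:
  assumes "x \<in> U" "y \<in> U" shows "step x (step y p) = step y (step x p)"
proof -
  let ?X = "fst p \<inter> U"
  have i: "insert z (fst p) \<inter> U = insert z ?X" if "z \<in> U" for z using that by auto
  have X: "?X \<subseteq> U" by auto
  have eq: "(if y \<in> cl ?X then 0 else 1::nat) + (if x \<in> cl (insert y ?X) then 0 else 1)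
    = (if x \<in> cl ?X then 0 else 1) + (if y \<in> cl (insert x ?X) then 0 else 1)"
  proof (cases "x \<in> cl ?X")
    case True
    then show ?thesis using cl_insert[OF X] cl_mono[of ?X "insert y ?X"] by auto
  next
    case x: False
    show ?thesis
    proof (cases "y \<in> cl ?X")
      case True
      then show ?thesis using x cl_insert[OF X] cl_mono[of ?X "insert x ?X"] by auto
    next
      case False
      have "x \<in> cl (insert y ?X) \<longleftrightarrow> y \<in> cl (insert x ?X)"
        using cl_exchange[OF X assms x] cl_exchange[OF X assms(2,1) False] by blast
      then show ?thesis using x False by simp
    qed
  qed
  show ?thesis unfolding step_def fst_conv snd_conv i[OF assms(1)] i[OF assms(2)]
    using eq by (simp add: insert_commute)
qed

lemma step_idem: "x \<in> U \<Longrightarrow> step x (step x p) = step x p"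
  using cl_ext[of "insert x (fst p) \<inter> U"] by (auto simp: step_def)

sublocale fold: comp_fun_idem_on U step
  by unfold_locales (use step_commute step_idem in \<open>auto simp: fun_eq_iff\<close>)

definition rk :: "'a set \<Rightarrow> nat" where
  "rk X = snd (Finite_Set.fold step ({}, 0) X)"

lemma rk_empty: "rk {} = 0" by (simp add: rk_def)

lemma rk_insert:
  assumes "finite X" "X \<subseteq> U" "x \<in> U"
  shows "rk (insert x X) = rk X + (if x \<in> cl X then 0 else 1)"
proof -
  have 1: "fst (Finite_Set.fold step ({}, 0) Y) = Y" if "finite Y" "Y \<subseteq> U" for Y
    using that by (induction Y rule: finite_induct) (auto simp: step_def fold.fold_insert_idem)
  then show ?thesis using assms fold.fold_insert_idem[of x X "({}, 0)"] 1[OF assms(1,2)]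
    by (simp add: rk_def step_def Int_absorb2)
qed

lemma rk_mono:
  assumes "finite Y" "X \<subseteq> Y" "Y \<subseteq> U" shows "rk X \<le> rk Y"
proof -
  have "rk X \<le> rk (X \<union> Z)" if "finite Z" "Z \<subseteq> U" for Z
    using that
  proof (induction Z rule: finite_induct)
    case (insert z Z)
    then have "rk (insert z (X \<union> Z)) \<ge> rk (X \<union> Z)" using rk_insert[of "X \<union> Z" z] assms finite_subset[of X Y] by auto
    then show ?case using insert by simp
  qed simp
  from this[of Y] show ?thesis using assms by (simp add: sup.absorb2)
qed

sublocale rank_fun U rk
proof
  fix X assume "finite X" "X \<subseteq> U"
  then show "rk X \<le> card X"
    by (induction X rule: finite_induct) (auto simp: rk_empty rk_insert)
next
  fix X Y assume a: "finite X" "finite Y" "X \<subseteq> U" "Y \<subseteq> U"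
  \<comment> \<open>\<open>Z\<close> grows from the empty set to \<open>Y\<close>. An element
    outside the closure of \<open>X \<union> Z\<close> is also outside the smaller closure of
    \<open>X \<inter> Y \<union> Z\<close>, so the right side grows at least as fast as the
    left.\<close>
  have "rk (X \<union> Z) + rk (X \<inter> Y) \<le> rk X + rk ((X \<inter> Y) \<union> Z)" if "finite Z" "Z \<subseteq> Y" for Z
    using that
  proof (induction Z rule: finite_induct)
    case (insert z Z)
    have "cl (X \<inter> Y \<union> Z) \<subseteq> cl (X \<union> Z)" by (rule cl_mono) auto
    moreover have "Z \<subseteq> U" "z \<in> U" "X \<inter> Y \<subseteq> U" using insert a by auto
    ultimately show ?case
      using insert a rk_insert[of "X \<union> Z" z] rk_insert[of "X \<inter> Y \<union> Z" z] finite_subset[of "X \<inter> Y" X] by auto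
  qed simp
  from this[of Y] show "rk (X \<union> Y) + rk (X \<inter> Y) \<le> rk X + rk Y" using a by (simp add: Un_absorb1)
qed (rule rk_mono)

lemma spanned_iff: "finite X \<Longrightarrow> X \<subseteq> U \<Longrightarrow> x \<in> U \<Longrightarrow> spanned X x \<longleftrightarrow> x \<in> cl X"
  by (simp add: spanned_def rk_insert)

end

section \<open>Affine spaces and dilations with a centre\<close>

text \<open>\<open>E\<close> is the set of affine points and \<open>H\<close> the hyperplane at
  infinity; \<open>d x y\<close> is the point at infinity of the line joining \<open>x\<close> and
  \<open>y\<close>, and \<open>ln p q\<close> is a line inside \<open>H\<close>. Affine lines are
  not primitive: three points are collinear when two of their directions agree. In
  \<open>meet\<close>, the condition on \<open>d x y\<close> says that the two lines to be
  intersected are coplanar. \<open>not_line\<close> makes the dimension at least three.\<close>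

locale aff_space =
  fixes E :: "'e set" and H :: "'h set" and d :: "'e \<Rightarrow> 'e \<Rightarrow> 'h" and ln :: "'h \<Rightarrow> 'h \<Rightarrow> 'h set"
  assumes d_in: "x \<in> E \<Longrightarrow> y \<in> E \<Longrightarrow> x \<noteq> y \<Longrightarrow> d x y \<in> H"
    and d_sym: "d x y = d y x"
    and ln_sub: "p \<in> H \<Longrightarrow> q \<in> H \<Longrightarrow> p \<noteq> q \<Longrightarrow> ln p q \<subseteq> H"
    and ln_fst: "p \<in> H \<Longrightarrow> q \<in> H \<Longrightarrow> p \<noteq> q \<Longrightarrow> p \<in> ln p q"
    and ln_snd: "p \<in> H \<Longrightarrow> q \<in> H \<Longrightarrow> p \<noteq> q \<Longrightarrow> q \<in> ln p q"
    and ln_eq: "p \<in> H \<Longrightarrow> q \<in> H \<Longrightarrow> p \<noteq> q \<Longrightarrow> s \<in> ln p q \<Longrightarrow> t \<in> ln p q \<Longrightarrow> s \<noteq> t \<Longrightarrow> ln s t = ln p q"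
    and par: "x \<in> E \<Longrightarrow> y \<in> E \<Longrightarrow> z \<in> E \<Longrightarrow> x \<noteq> y \<Longrightarrow> x \<noteq> z \<Longrightarrow> y \<noteq> z \<Longrightarrow> d x y = d x z \<Longrightarrow> d y z = d x y"
    and triangle: "x \<in> E \<Longrightarrow> y \<in> E \<Longrightarrow> z \<in> E \<Longrightarrow> x \<noteq> y \<Longrightarrow> x \<noteq> z \<Longrightarrow> y \<noteq> z \<Longrightarrow> d x y \<noteq> d x z \<Longrightarrow>
       d y z \<in> ln (d x y) (d x z)"
    and ex_pt: "x \<in> E \<Longrightarrow> p \<in> H \<Longrightarrow> \<exists>y\<in>E. y \<noteq> x \<and> d x y = p"
    and meet: "x \<in> E \<Longrightarrow> y \<in> E \<Longrightarrow> x \<noteq> y \<Longrightarrow> p \<in> H \<Longrightarrow> q \<in> H \<Longrightarrow> p \<noteq> q \<Longrightarrow> d x y \<noteq> p \<Longrightarrow> d x y \<noteq> q \<Longrightarrow>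
       d x y \<in> ln p q \<Longrightarrow> \<exists>z\<in>E. z \<noteq> x \<and> z \<noteq> y \<and> d x z = p \<and> d y z = q"
    and not_line: "p \<in> H \<Longrightarrow> q \<in> H \<Longrightarrow> p \<noteq> q \<Longrightarrow> \<exists>s\<in>H. s \<notin> ln p q"
    and two_dirs: "\<exists>p\<in>H. \<exists>q\<in>H. p \<noteq> q"
    and nonempty: "E \<noteq> {}"
begin

text \<open>Subspaces at infinity. They are applied to single points and to lines, that is, to the
  directions of a line or of a plane of \<open>E\<close>, and let both be treated alike.\<close>

definition flat :: "'h set \<Rightarrow> bool" where
  "flat l \<longleftrightarrow> l \<subseteq> H \<and> (\<forall>p\<in>l. \<forall>q\<in>l. p \<noteq> q \<longrightarrow> ln p q \<subseteq> l)"

lemma flat_point: "p \<in> H \<Longrightarrow> flat {p}"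
  by (auto simp: flat_def)

lemma flat_line: "p \<in> H \<Longrightarrow> q \<in> H \<Longrightarrow> p \<noteq> q \<Longrightarrow> flat (ln p q)"
  unfolding flat_def using ln_sub ln_eq by blast

lemma ex_other_dir: "\<exists>q\<in>H. q \<noteq> p"
  using two_dirs by metis

lemma flat_trans:
  assumes "flat l" "x \<in> E" "y \<in> E" "z \<in> E" "x \<noteq> y" "y \<noteq> z" "x \<noteq> z" "d x y \<in> l" "d y z \<in> l"
  shows "d x z \<in> l"
proof (cases "d x y = d y z")
  case True
  then show ?thesis using par[of y x z] assms d_sym by metis
next
  case False
  then have "d x z \<in> ln (d y x) (d y z)" using triangle[of y x z] assms d_sym by metis
  then show ?thesis using assms False unfolding flat_def by (metis d_sym subsetD)
qed

text \<open>If \<open>z\<close> and \<open>w\<close> were different, \<open>par\<close> would make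
  their direction equal to both \<open>d x z\<close> and \<open>d y z\<close>.\<close>

lemma unique_meet:
  assumes "x \<in> E" "y \<in> E" "z \<in> E" "w \<in> E" "z \<noteq> x" "z \<noteq> y" "w \<noteq> x" "w \<noteq> y"
    "d x z = d x w" "d y z = d y w" "d x z \<noteq> d y z"
  shows "z = w"
  using assms par by metis

definition dil :: "('e \<Rightarrow> 'e) \<Rightarrow> bool" where
  "dil f \<longleftrightarrow> (\<forall>x\<in>E. f x \<in> E) \<and>
     (\<forall>x\<in>E. \<forall>y\<in>E. x \<noteq> y \<longrightarrow> f x \<noteq> f y \<and> d (f x) (f y) = d x y)"

lemma dilD: "dil f \<Longrightarrow> x \<in> E \<Longrightarrow> f x \<in> E"
  "dil f \<Longrightarrow> x \<in> E \<Longrightarrow> y \<in> E \<Longrightarrow> x \<noteq> y \<Longrightarrow> f x \<noteq> f y"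
  "dil f \<Longrightarrow> x \<in> E \<Longrightarrow> y \<in> E \<Longrightarrow> x \<noteq> y \<Longrightarrow> d (f x) (f y) = d x y"
  by (auto simp: dil_def)

lemma dil_comp: "dil f \<Longrightarrow> dil g \<Longrightarrow> dil (\<lambda>x. f (g x))"
  by (simp add: dil_def)

end

text \<open>
  The lines through a fixed centre, either a point of \<open>E\<close> (then \<open>E0\<close> omits it) or a point of
  \<open>H\<close>; \<open>pd x\<close> is the point at infinity of the line joining the centre to \<open>x\<close>.
\<close>

locale pencil = aff_space E H d ln
  for E :: "'e set" and H :: "'h set" and d and ln +
  fixes E0 :: "'e set" and pd :: "'e \<Rightarrow> 'h"
  assumes E0_sub: "E0 \<subseteq> E"
    and pd_in: "x \<in> E0 \<Longrightarrow> pd x \<in> H"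
    and pd_flat: "flat l \<Longrightarrow> x \<in> E0 \<Longrightarrow> y \<in> E0 \<Longrightarrow> x \<noteq> y \<Longrightarrow> d x y \<in> l \<Longrightarrow> pd x \<in> l \<Longrightarrow> pd y \<in> l"
    and pd_pt: "x \<in> E0 \<Longrightarrow> p \<in> H \<Longrightarrow> p \<noteq> pd x \<Longrightarrow> \<exists>s\<in>E0. s \<noteq> x \<and> d x s = p"
    and pd_ex: "x \<in> E0 \<Longrightarrow> y \<in> E0 \<Longrightarrow> x' \<in> E0 \<Longrightarrow> x \<noteq> y \<Longrightarrow> d x y \<noteq> pd x \<Longrightarrow> x' = x \<or> d x x' = pd x \<Longrightarrow>
       \<exists>y'\<in>E0. (y' = y \<or> d y y' = pd y) \<and> y' \<noteq> x' \<and> d x' y' = d x y"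
begin

text \<open>Lying on the same line through the centre.\<close>

definition eqv :: "'e \<Rightarrow> 'e \<Rightarrow> bool" where
  "eqv x y \<longleftrightarrow> x = y \<or> d x y = pd x"

lemma E0E: "x \<in> E0 \<Longrightarrow> x \<in> E" using E0_sub by blast

lemma eqv_pd: "x \<in> E0 \<Longrightarrow> y \<in> E0 \<Longrightarrow> eqv x y \<Longrightarrow> pd y = pd x"
  using pd_flat[OF flat_point[OF pd_in[of x]], of x y] by (auto simp: eqv_def)

lemma eqv_refl: "eqv x x" by (simp add: eqv_def)

lemma eqv_sym: "x \<in> E0 \<Longrightarrow> y \<in> E0 \<Longrightarrow> eqv x y \<Longrightarrow> eqv y x"
  using eqv_pd d_sym unfolding eqv_def by metis

lemma eqv_trans: "x \<in> E0 \<Longrightarrow> y \<in> E0 \<Longrightarrow> z \<in> E0 \<Longrightarrow> eqv x y \<Longrightarrow> eqv y z \<Longrightarrow> eqv x z"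
  using eqv_pd[of x y] flat_trans[OF flat_point[OF pd_in[of x]], of x y z] E0E unfolding eqv_def by fastforce

text \<open>The only place where a dilation of the pencil with \<open>x\<close> going to
  \<open>x'\<close> can send \<open>y\<close>: the intersection of the line from the centre through
  \<open>y\<close> with the parallel to \<open>x y\<close> through \<open>x'\<close>.\<close>

definition img :: "'e \<Rightarrow> 'e \<Rightarrow> 'e \<Rightarrow> 'e \<Rightarrow> bool" where
  "img x x' y y' \<longleftrightarrow> y' \<in> E0 \<and> eqv y y' \<and> y' \<noteq> x' \<and> d x' y' = d x y"

lemma img_ex:
  "x \<in> E0 \<Longrightarrow> y \<in> E0 \<Longrightarrow> x' \<in> E0 \<Longrightarrow> eqv x x' \<Longrightarrow> \<not> eqv x y \<Longrightarrow> \<exists>y'. img x x' y y'"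
  using pd_ex[of x y x'] unfolding img_def eqv_def by metis

lemma img_unique:
  assumes "x \<in> E0" "y \<in> E0" "x' \<in> E0" "eqv x x'" "\<not> eqv x y" "img x x' y u" "img x x' y v"
  shows "u = v"
proof (rule ccontr)
  assume "u \<noteq> v"
  have uv: "u \<in> E0" "v \<in> E0" "eqv y u" "eqv y v" "u \<noteq> x'" "v \<noteq> x'" "d x' u = d x' v"
    using assms unfolding img_def by auto
  then have "d u v = d x' u" using par[of x' u v] \<open>u \<noteq> v\<close> E0E assms by auto
  moreover have "eqv u v" using uv eqv_trans eqv_sym assms by blast
  ultimately have "eqv u x'" using \<open>u \<noteq> v\<close> d_sym unfolding eqv_def by metis
  then show False using assms uv eqv_trans eqv_sym by metis
qed

lemma img_sym: "x \<in> E0 \<Longrightarrow> y \<in> E0 \<Longrightarrow> x' \<in> E0 \<Longrightarrow> eqv x x' \<Longrightarrow> img x x' y y' \<Longrightarrow> img y y' x x'"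
  unfolding img_def using d_sym by metis

text \<open>The directions of \<open>y z\<close> and of \<open>y' z'\<close> both belong to two
  lines at infinity: that of the plane \<open>x y z\<close>, and that of the plane through the
  centre, \<open>y\<close> and \<open>z\<close>. As \<open>z\<close> is outside the plane of the
  centre, \<open>x\<close> and \<open>y\<close>, these two lines differ and share only one
  point.\<close>

lemma desargues_nonplanar:
  assumes E: "x \<in> E0" "y \<in> E0" "z \<in> E0" "x' \<in> E0" and e: "eqv x x'" "\<not> eqv x y" "\<not> eqv x z"
    and np: "d x z \<notin> ln (pd x) (d x y)"
    and i: "img x x' y y'" "img x x' z z'"
  shows "img y y' z z' \<and> \<not> eqv y z"
proof -
  have n: "x \<noteq> y" "x \<noteq> z" "pd x \<noteq> d x y" "pd x \<noteq> d x z" using e by (auto simp: eqv_def)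
  have H: "pd x \<in> H" "d x y \<in> H" "d x z \<in> H" using E n pd_in d_in E0E by auto
  have lx: "flat (ln (pd x) (d x y))" using flat_line H n by auto
  have yz: "\<not> eqv y z"
  proof
    assume a: "eqv y z"
    have yl: "pd y \<in> ln (pd x) (d x y)"
      by (rule pd_flat[OF lx E(1,2) n(1)]) (use ln_fst ln_snd H n in auto)
    have "d x z \<in> ln (pd x) (d x y)"
    proof (cases "y = z")
      case True then show ?thesis using ln_snd H n by auto
    next
      case False
      then have "d y z \<in> ln (pd x) (d x y)" using a yl by (auto simp: eqv_def)
      then show ?thesis using flat_trans[OF lx, of x y z] E E0E n False ln_snd H by auto
    qed
    then show False using np by simp
  qed
  have E': "y' \<in> E0" "z' \<in> E0" "eqv y y'" "eqv z z'" "y' \<noteq> x'" "z' \<noteq> x'" "d x' y' = d x y" "d x' z' = d x z"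
    using i unfolding img_def by auto
  have y'z': "y' \<noteq> z'" using yz E' E eqv_trans eqv_sym by metis
  have yzn: "y \<noteq> z" using yz eqv_refl by auto
  define a b where "a = d y z" and "b = d y' z'"
  have aH: "a \<in> H" "b \<in> H" using d_in E E' E0E y'z' yzn by (auto simp: a_def b_def)
  have "a = b"
  proof (rule ccontr)
    assume ab: "a \<noteq> b"
    have dd: "d x y \<noteq> d x z" using np ln_snd H n by metis
    let ?l = "ln (d x y) (d x z)"
    have fl: "flat ?l" using flat_line H dd by auto
    have al: "a \<in> ?l" using triangle[of x y z] E E0E n yzn dd by (auto simp: a_def)
    have bl: "b \<in> ?l" using triangle[of x' y' z'] E E0E E' y'z' dd unfolding b_def by metis
    have la: "ln a b = ?l" using ln_eq[OF H(2,3) dd al bl ab] .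
    have pya: "pd y \<noteq> a" using yz by (auto simp: eqv_def a_def)
    have pyH: "pd y \<in> H" using pd_in E by auto
    let ?m = "ln (pd y) a"
    have fm: "flat ?m" using flat_line pyH aH pya by auto
    have m1: "pd y \<in> ?m" "a \<in> ?m" using ln_fst ln_snd pyH aH pya by auto
    have pz: "pd z \<in> ?m" using pd_flat[OF fm E(2,3) yzn] m1 by (auto simp: a_def)
    \<comment> \<open>The path from \<open>y'\<close> over \<open>y\<close> and \<open>z\<close> to
      \<open>z'\<close> stays in the plane with directions \<open>?m\<close>. The case
      \<open>y' = z\<close> is split off because \<open>d\<close> carries no information at equal
      points.\<close>
    have "d y' z \<in> ?m \<or> y' = z"
      using flat_trans[OF fm, of y' y z] E E' E0E yzn m1 d_sym unfolding a_def eqv_def by metis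
    then have bm: "b \<in> ?m"
      using flat_trans[OF fm, of y' z z'] E E' E0E y'z' pz unfolding b_def eqv_def by metis
    have "ln a b = ?m" using ln_eq[OF pyH aH(1) pya m1(2) bm ab] .
    then have pyl: "pd y \<in> ?l" using la m1 by auto
    have "pd x \<in> ?l" using pd_flat[OF fl E(2,1)] n ln_fst[OF H(2,3) dd] d_sym pyl by metis
    then have "?l = ln (pd x) (d x y)" using ln_eq[OF H(2,3) dd, of "pd x" "d x y"] ln_fst[OF H(2,3) dd] n by auto
    then show False using np ln_snd[OF H(2,3) dd] by auto
  qed
  then show ?thesis using yz E' y'z' unfolding img_def a_def b_def by auto
qed

text \<open>In the planar case, an auxiliary point \<open>s\<close> outside the plane reduces to the previous one.\<close>

lemma desargues:
  assumes E: "x \<in> E0" "y \<in> E0" "z \<in> E0" "x' \<in> E0" and e: "eqv x x'" "\<not> eqv x y" "\<not> eqv x z" "\<not> eqv y z"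
    and i: "img x x' y y'" "img x x' z z'"
  shows "img y y' z z'"
proof (cases "d x z \<in> ln (pd x) (d x y)")
  case False
  then show ?thesis using desargues_nonplanar[OF E e(1-3) _ i] by auto
next
  case True
  have n: "x \<noteq> y" "x \<noteq> z" "y \<noteq> z" "pd x \<noteq> d x y" "pd x \<noteq> d x z" "pd y \<noteq> d y z" using e by (auto simp: eqv_def)
  have H: "pd x \<in> H" "d x y \<in> H" "d x z \<in> H" "pd y \<in> H" "d y z \<in> H" using E n pd_in d_in E0E by auto
  let ?l = "ln (pd x) (d x y)"
  have fl: "flat ?l" using flat_line H n by auto
  have ml: "pd x \<in> ?l" "d x y \<in> ?l" using ln_fst ln_snd H n by auto
  have l2: "ln (pd x) (d x z) = ?l" using ln_eq[OF H(1,2) n(4) ml(1) True n(5)] .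
  obtain r where r: "r \<in> H" "r \<notin> ?l" using not_line H n by blast
  have "r \<noteq> pd x" using r ml by auto
  then obtain s where s: "s \<in> E0" "s \<noteq> x" "d x s = r" using pd_pt[OF E(1) r(1)] by blast
  have xs: "\<not> eqv x s" using s r ml by (auto simp: eqv_def)
  obtain s' where s': "img x x' s s'" using img_ex[OF E(1) s(1) E(4) e(1) xs] by blast
  have ys: "img y y' s s' \<and> \<not> eqv y s" using desargues_nonplanar[OF E(1,2) s(1) E(4) e(1,2) xs _ i(1) s'] s r by auto
  have zs: "img z z' s s' \<and> \<not> eqv z s" using desargues_nonplanar[OF E(1,3) s(1) E(4) e(1,3) xs _ i(2) s'] s r l2 by auto
  have E': "y' \<in> E0" "z' \<in> E0" "s' \<in> E0" "eqv y y'" "eqv z z'" "eqv s s'" using i s' unfolding img_def by auto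
  have sy: "img s s' y y'" "img s s' z z'" using img_sym ys zs E s E' by auto
  have ns: "\<not> eqv s y" "\<not> eqv s z" using ys zs eqv_sym E s by metis+
  \<comment> \<open>The second use of the spatial case starts from \<open>s\<close>. If
    \<open>z\<close> were in the plane of the centre, \<open>s\<close> and \<open>y\<close>, that
    plane would contain \<open>y z\<close> and hence be the original plane, which misses
    \<open>s\<close>.\<close>
  have "d s z \<notin> ln (pd s) (d s y)"
  proof
    let ?m = "ln (pd s) (d s y)"
    assume a: "d s z \<in> ?m"
    have q: "s \<noteq> y" "s \<noteq> z" "pd s \<noteq> d s y" using ns by (auto simp: eqv_def)
    have qH: "pd s \<in> H" "d s y \<in> H" using pd_in d_in s E E0E q by auto
    have fm: "flat ?m" using flat_line qH q by auto
    have mm: "pd s \<in> ?m" "d s y \<in> ?m" using ln_fst ln_snd qH q by auto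
    have "d y z \<in> ?m" using flat_trans[OF fm, of y s z] E s E0E q n mm a d_sym by metis
    moreover have "pd y \<in> ?m" using pd_flat[OF fm s(1) E(2) q(1)] mm by auto
    ultimately have 1: "ln (pd y) (d y z) = ?m" using ln_eq[OF qH q(3)] n by auto
    have "d y z \<in> ?l" using flat_trans[OF fl, of y x z] E E0E n ml True d_sym by metis
    moreover have "pd y \<in> ?l" using pd_flat[OF fl E(1,2) n(1)] ml by auto
    ultimately have 2: "ln (pd y) (d y z) = ?l" using ln_eq[OF H(1,2) n(4)] n by auto
    have "d x s \<in> ?l" using flat_trans[OF fl, of x y s] E s E0E n q ml mm 1 2 d_sym by metis
    then show False using s r by auto
  qed
  then show ?thesis using desargues_nonplanar[OF s(1) E(2,3) E'(3,6) ns _ sy] by auto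
qed

lemma ex_not_eqv: "x \<in> E0 \<Longrightarrow> \<exists>w\<in>E0. \<not> eqv x w"
  using ex_other_dir[of "pd x"] pd_pt[of x] unfolding eqv_def by metis

lemma ex_not_eqv2:
  assumes "x \<in> E0" "w \<in> E0" "\<not> eqv x w"
  shows "\<exists>u\<in>E0. \<not> eqv x u \<and> \<not> eqv w u"
proof -
  have n: "x \<noteq> w" "pd x \<noteq> d x w" using assms by (auto simp: eqv_def)
  have H: "pd x \<in> H" "d x w \<in> H" using assms n pd_in d_in E0E by auto
  let ?l = "ln (pd x) (d x w)"
  have fl: "flat ?l" using flat_line H n by auto
  have ml: "pd x \<in> ?l" "d x w \<in> ?l" using ln_fst ln_snd H n by auto
  obtain r where r: "r \<in> H" "r \<notin> ?l" using not_line H n by blast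
  then obtain s where s: "s \<in> E0" "s \<noteq> x" "d x s = r" using pd_pt[OF assms(1) r(1)] ml by metis
  have "pd w \<in> ?l" using pd_flat[OF fl assms(1,2) n(1)] ml by auto
  then have "\<not> eqv w s" using flat_trans[OF fl, of x w s] assms E0E s ml n r unfolding eqv_def by metis
  moreover have "\<not> eqv x s" using s r ml by (auto simp: eqv_def)
  ultimately show ?thesis using s by auto
qed

definition pdil :: "('e \<Rightarrow> 'e) \<Rightarrow> bool" where
  "pdil f \<longleftrightarrow> (\<forall>x\<in>E0. f x \<in> E0 \<and> eqv x (f x)) \<and>
     (\<forall>x\<in>E0. \<forall>y\<in>E0. x \<noteq> y \<longrightarrow> f x \<noteq> f y \<and> d (f x) (f y) = d x y)"

text \<open>Pairs on a common line through the centre come for free: from a point \<open>u\<close>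
  off that line they are seen in different directions, so their images differ, and the images stay
  on the same line, which fixes their direction.\<close>

lemma pdilI:
  assumes f: "\<And>x. x \<in> E0 \<Longrightarrow> f x \<in> E0 \<and> eqv x (f x)"
    and i: "\<And>x y. x \<in> E0 \<Longrightarrow> y \<in> E0 \<Longrightarrow> \<not> eqv x y \<Longrightarrow> img x (f x) y (f y)"
  shows "pdil f"
  unfolding pdil_def
proof (intro conjI ballI impI)
  fix y z assume yz: "y \<in> E0" "z \<in> E0" "y \<noteq> z"
  have "f y \<noteq> f z \<and> d (f y) (f z) = d y z"
  proof (cases "eqv y z")
    case False
    then show ?thesis using i[OF yz(1,2)] unfolding img_def by auto
  next
    case True
    obtain u where u: "u \<in> E0" "\<not> eqv y u" using ex_not_eqv yz by blast
    then have nu: "\<not> eqv u y" "\<not> eqv u z" using True yz eqv_sym eqv_trans by meson+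
    have 1: "d (f u) (f y) = d u y" "d (f u) (f z) = d u z"
      using i[OF u(1) yz(1) nu(1)] i[OF u(1) yz(2) nu(2)] unfolding img_def by auto
    have "d u y \<noteq> d u z"
      using par[of u y z] True nu u yz E0E eqv_sym[of y z] d_sym unfolding eqv_def by metis
    then have ne: "f y \<noteq> f z" using 1 by auto
    have "eqv (f y) (f z)" using f yz True eqv_sym eqv_trans by meson
    then have "d (f y) (f z) = pd (f y)" using ne by (auto simp: eqv_def)
    also have "\<dots> = pd y" using f yz eqv_pd by auto
    also have "\<dots> = d y z" using True yz by (auto simp: eqv_def)
    finally show ?thesis using ne by auto
  qed
  then show "f y \<noteq> f z" "d (f y) (f z) = d y z" by auto
qed (use f in auto)

lemma pdil_img: "pdil f \<Longrightarrow> x \<in> E0 \<Longrightarrow> y \<in> E0 \<Longrightarrow> \<not> eqv x y \<Longrightarrow> img x (f x) y (f y)"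
  unfolding pdil_def img_def by (metis eqv_refl)

text \<open>
  Off the line of \<open>x\<close> the dilation is determined by \<open>x\<close>, off the line of \<open>w\<close> by \<open>w\<close>, and
  Desargues' theorem makes the two descriptions agree.
\<close>

lemma pdil_ex:
  assumes x: "x \<in> E0" "x' \<in> E0" "eqv x x'"
  shows "\<exists>f. pdil f \<and> f x = x'"
proof -
  obtain w where w: "w \<in> E0" "\<not> eqv x w" using ex_not_eqv x by blast
  obtain w' where w': "img x x' w w'" using img_ex x w by blast
  have w'E: "w' \<in> E0" "eqv w w'" using w' by (auto simp: img_def)
  have wx: "\<not> eqv w x" using w x eqv_sym by blast
  have iwx: "img w w' x x'" using img_sym x w w' by auto
  define f where "f = (\<lambda>y. if eqv x y then SOME y'. img w w' y y' else SOME y'. img x x' y y')"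
  have fx: "img x x' y (f y)" if "y \<in> E0" "\<not> eqv x y" for y
    using someI_ex[OF img_ex[OF x(1) that(1) x(2,3) that(2)]] that by (simp add: f_def)
  have xw: "\<not> eqv w y" if "y \<in> E0" "eqv x y" for y
    using that x w eqv_trans eqv_sym by meson
  have fw1: "img w w' y (f y)" if "y \<in> E0" "eqv x y" for y
    using someI_ex[OF img_ex[OF w(1) that(1) w'E(1,2) xw[OF that]]] that by (simp add: f_def)
  have ffx: "f x = x'" using img_unique[OF w(1) x(1) w'E wx fw1[OF x(1) eqv_refl] iwx] .
  have fw: "img w w' y (f y)" if y: "y \<in> E0" "\<not> eqv w y" for y
  proof (cases "eqv x y")
    case True then show ?thesis using fw1 y by auto
  next
    case False
    show ?thesis using desargues[OF x(1) w(1) y(1) x(2,3) w(2) False y(2) w' fx[OF y(1) False]] .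
  qed
  have fE: "f y \<in> E0 \<and> eqv y (f y)" if "y \<in> E0" for y
    using fx[OF that] fw1[OF that] by (auto simp: img_def)
  have ww: "f w = w'" using img_unique[OF x(1) w(1) x(2,3) w(2) fx[OF w] w'] .
  have mixed: "img y (f y) z (f z)" if yz: "y \<in> E0" "z \<in> E0" "eqv x y" "\<not> eqv x z" for y z
  proof -
    have wy: "\<not> eqv w y" using xw yz by auto
    have nyz: "\<not> eqv y z" using yz x eqv_trans by meson
    show ?thesis
    proof (cases "eqv w z")
      case False
      then show ?thesis using desargues[OF w(1) yz(1,2) w'E wy False nyz fw fw] yz wy by auto
    next
      case True
      \<comment> \<open>Here \<open>y\<close> shares its line with \<open>x\<close>, and
        \<open>z\<close> with \<open>w\<close>, so neither \<open>x\<close> nor \<open>w\<close>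
        controls both. A third point \<open>u\<close> off both lines is compared with
        \<open>z\<close> by way of \<open>x\<close> and with \<open>y\<close> by way of
        \<open>w\<close>.\<close>
      obtain u where u: "u \<in> E0" "\<not> eqv x u" "\<not> eqv w u" using ex_not_eqv2 x w by blast
      have fu: "f u \<in> E0" "eqv u (f u)" using fE u by auto
      have nn: "\<not> eqv u z" "\<not> eqv u y" using u yz True x w eqv_trans eqv_sym by meson+
      have "img u (f u) z (f z)"
        using desargues[OF x(1) u(1) yz(2) x(2,3) u(2) yz(4) nn(1) fx fx] u yz by auto
      moreover have "img u (f u) y (f y)"
        using desargues[OF w(1) u(1) yz(1) w'E u(3) wy nn(2) fw fw] u yz wy by auto
      ultimately show ?thesis using desargues[OF u(1) yz(1,2) fu nn(2,1) nyz] by auto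
    qed
  qed
  have "pdil f"
  proof (rule pdilI[OF fE])
    fix y z assume yz: "y \<in> E0" "z \<in> E0" "\<not> eqv y z"
    show "img y (f y) z (f z)"
    proof (cases "eqv x y")
      case y: True
      then have "\<not> eqv x z" using yz x eqv_trans eqv_sym by meson
      then show ?thesis using mixed yz y by auto
    next
      case y: False
      show ?thesis
      proof (cases "eqv x z")
        case True
        then have "img z (f z) y (f y)" using mixed yz y by auto
        then show ?thesis using img_sym fE yz by auto
      next
        case False
        show ?thesis using desargues[OF x(1) yz(1,2) x(2,3) y False yz(3) fx fx] yz y False by auto
      qed
    qed
  qed auto
  then show ?thesis using ffx by auto
qed

lemma pdil_unique:
  assumes "pdil f" "pdil g" "x \<in> E0" "f x = g x" "y \<in> E0"
  shows "f y = g y"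
proof -
  have off: "f z = g z" if "u \<in> E0" "z \<in> E0" "\<not> eqv u z" "f u = g u" for u z
    by (rule img_unique[OF that(1,2), of "f u"])
      (use that assms pdil_img[of f u z] pdil_img[of g u z] in \<open>auto simp: pdil_def\<close>)
  obtain w where w: "w \<in> E0" "\<not> eqv x w" using ex_not_eqv assms by blast
  show ?thesis
  proof (cases "eqv x y")
    case True
    then have "\<not> eqv w y" using w assms eqv_trans eqv_sym by meson
    then show ?thesis using off[of w y] off[of x w] w assms by auto
  qed (use off[of x y] assms in auto)
qed

end

section \<open>Pencils with centre at infinity and with centre in the space\<close>

context aff_space
begin

text \<open>All lines of the pencil are parallel, and the point asked for by \<open>pd_ex\<close> is
  the fourth vertex of a parallelogram with sides \<open>x x'\<close> and \<open>x y\<close>. The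
  axiom \<open>meet\<close> provides it because \<open>triangle\<close> puts \<open>d x' y\<close>
  on the line joining \<open>c\<close> and \<open>d x y\<close>.\<close>

lemma pencil_translation:
  assumes c: "c \<in> H"
  shows "pencil E H d ln E (\<lambda>_. c)"
proof unfold_locales
  fix x y x' assume a: "x \<in> E" "y \<in> E" "x' \<in> E" "x \<noteq> y" "d x y \<noteq> c" "x' = x \<or> d x x' = c"
  show "\<exists>y'\<in>E. (y' = y \<or> d y y' = c) \<and> y' \<noteq> x' \<and> d x' y' = d x y"
  proof (cases "x' = x")
    case True then show ?thesis using a by auto
  next
    case False
    then have x': "d x x' = c" using a by auto
    have xy: "d x y \<in> H" using d_in a by auto
    have ne: "x' \<noteq> y" using x' a by auto
    have t: "d x' y \<in> ln c (d x y)" using triangle[of x x' y] a x' False ne by auto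
    have 1: "d x' y \<noteq> c" using par[of x' x y] a x' False ne d_sym by metis
    have 2: "d x' y \<noteq> d x y" using par[of y x x'] a x' False ne d_sym by metis
    have l: "ln (d x y) c = ln c (d x y)" using ln_eq[OF c xy] ln_fst ln_snd c xy a by metis
    obtain z where "z \<in> E" "z \<noteq> x'" "z \<noteq> y" "d x' z = d x y" "d y z = c"
      using meet[of x' y "d x y" c] a ne xy c 1 2 t l by auto
    then show ?thesis using a by blast
  qed
next
  fix x p assume "x \<in> E" "p \<in> H"
  then show "\<exists>s\<in>E. s \<noteq> x \<and> d x s = p" using ex_pt by blast
qed (use c in auto)

text \<open>The point asked for by \<open>pd_ex\<close> is now the intersection of the line through
  \<open>c\<close> and \<open>y\<close> with the parallel to \<open>x y\<close> through
  \<open>x'\<close>. Both lie in the plane of \<open>c\<close>, \<open>x\<close> and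
  \<open>y\<close>, so \<open>meet\<close> applies to the pair \<open>x'\<close>,
  \<open>c\<close>.\<close>

lemma pencil_homothety:
  assumes c: "c \<in> E"
  shows "pencil E H d ln (E - {c}) (d c)"
proof unfold_locales
  fix x y x' assume a: "x \<in> E - {c}" "y \<in> E - {c}" "x' \<in> E - {c}" "x \<noteq> y" "d x y \<noteq> d c x" "x' = x \<or> d x x' = d c x"
  have n: "c \<noteq> x" "c \<noteq> y" "c \<noteq> x'" using a by auto
  have H: "d x y \<in> H" "d c y \<in> H" "d c x \<in> H" using d_in a c n by blast+
  have cx': "d c x' = d c x"
  proof (cases "x' = x")
    case False
    then have "d x c = d x x'" using a d_sym[of x c] by auto
    then show ?thesis using par[of x c x'] a c n False d_sym[of x c] by auto
  qed simp
  have 1: "d c x \<noteq> d c y" using par[of c x y] a n c by blast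
  have 2: "d x y \<noteq> d c y" using par[of y x c] a n c d_sym[of x y] d_sym[of c y] d_sym[of x c] by auto
  have "d x y \<in> ln (d c x) (d c y)" using triangle[of c x y] a n c 1 by blast
  from ln_eq[OF H(3,2) 1 this ln_snd[OF H(3,2) 1] 2]
  have 3: "d c x \<in> ln (d x y) (d c y)" using ln_fst[OF H(3,2) 1] by simp
  have 4: "d x' c = d c x" using d_sym cx' by metis
  have "x' \<in> E" "x' \<noteq> c" using a by auto
  from meet[OF this(1) c this(2) H(1,2) 2, unfolded 4, OF _ 1 3]
  obtain z where z: "z \<in> E" "z \<noteq> x'" "z \<noteq> c" "d x' z = d x y" "d c z = d c y"
    using a by metis
  have "z = y \<or> d y z = d c y" using z par[of c y z] a n c by auto
  then show "\<exists>y'\<in>E - {c}. (y' = y \<or> d y y' = d c y) \<and> y' \<noteq> x' \<and> d x' y' = d x y" using z by blast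
next
  fix l x y assume "flat l" "x \<in> E - {c}" "y \<in> E - {c}" "x \<noteq> y" "d x y \<in> l" "d c x \<in> l"
  then show "d c y \<in> l" using flat_trans[of l c x y] c by auto
next
  fix x p assume a: "x \<in> E - {c}" "p \<in> H" "p \<noteq> d c x"
  then obtain s where "s \<in> E" "s \<noteq> x" "d x s = p" using ex_pt by blast
  then show "\<exists>s\<in>E - {c}. s \<noteq> x \<and> d x s = p" using a d_sym[of x c] by (intro bexI[of _ s]) auto
qed (use c d_in in \<open>blast+\<close>)

end

section \<open>Translations\<close>

context aff_space
begin

definition transl_in :: "'h \<Rightarrow> ('e \<Rightarrow> 'e) \<Rightarrow> bool" where
  "transl_in c f \<longleftrightarrow> dil f \<and> (\<forall>x\<in>E. f x \<noteq> x \<and> d x (f x) = c)"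

definition transl :: "('e \<Rightarrow> 'e) \<Rightarrow> bool" where
  "transl f \<longleftrightarrow> (\<forall>x\<in>E. f x = x) \<or> (\<exists>c\<in>H. transl_in c f)"

lemma transl_dil: "transl f \<Longrightarrow> dil f"
  unfolding transl_def transl_in_def dil_def by auto

lemma transl_in_agree:
  assumes "c \<in> H" "transl_in c f" "dil g" "\<forall>x\<in>E. g x = x \<or> d x (g x) = c" "x \<in> E" "f x = g x" "y \<in> E"
  shows "f y = g y"
proof -
  interpret p: pencil E H d ln E "\<lambda>_. c" by (rule pencil_translation[OF assms(1)])
  have "p.pdil f" "p.pdil g" using assms by (auto simp: p.pdil_def p.eqv_def transl_in_def dil_def)
  then show ?thesis using p.pdil_unique assms by blast
qed

text \<open>One fixed point forces the identity, because the identity is itself a dilation of the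
  pencil with centre \<open>c\<close> and such dilations are determined by one value.\<close>

lemma translI:
  assumes "c \<in> H" "dil g" "\<forall>x\<in>E. g x = x \<or> d x (g x) = c"
  shows "transl g"
proof -
  interpret p: pencil E H d ln E "\<lambda>_. c" by (rule pencil_translation[OF assms(1)])
  have g: "p.pdil g" "p.pdil (\<lambda>x. x)" using assms by (auto simp: p.pdil_def p.eqv_def dil_def)
  show ?thesis
  proof (cases "\<exists>x\<in>E. g x = x")
    case True
    then have "\<forall>y\<in>E. g y = y" using p.pdil_unique[OF g] by auto
    then show ?thesis by (auto simp: transl_def)
  next
    case False
    then show ?thesis using assms by (auto simp: transl_def transl_in_def)
  qed
qed

lemma translD:
  assumes "transl f" "x \<in> E"
  shows "f x = x \<Longrightarrow> y \<in> E \<Longrightarrow> f y = y" "f x \<noteq> x \<Longrightarrow> transl_in (d x (f x)) f"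
  using assms by (auto simp: transl_def transl_in_def)

lemma transl_ex:
  assumes "x \<in> E" "y \<in> E"
  shows "\<exists>f. transl f \<and> f x = y"
proof (cases "x = y")
  case True then show ?thesis by (auto simp: transl_def)
next
  case False
  then have c: "d x y \<in> H" using d_in assms by auto
  interpret p: pencil E H d ln E "\<lambda>_. d x y" by (rule pencil_translation[OF c])
  obtain f where f: "p.pdil f" "f x = y" using p.pdil_ex[OF assms] by (auto simp: p.eqv_def)
  have "\<forall>z\<in>E. f z = z \<or> d z (f z) = d x y" using f(1) unfolding p.pdil_def p.eqv_def by metis
  moreover have "dil f" using f(1) by (auto simp: p.pdil_def dil_def)
  ultimately have "transl f" using translI[OF c, of f] by auto
  then show ?thesis using f by auto
qed

lemma transl_unique:
  assumes f: "transl f" and g: "transl g" and x: "x \<in> E" "f x = g x" and y: "y \<in> E"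
  shows "f y = g y"
proof (cases "f x = x")
  case True
  then show ?thesis using translD(1)[OF f x(1) _ y] translD(1)[OF g x(1) _ y] x by simp
next
  case False
  then have t: "transl_in (d x (f x)) f" "transl_in (d x (f x)) g" using translD(2)[OF f x(1)] translD(2)[OF g x(1)] x by auto
  have "d x (f x) \<in> H" using d_in[of x "f x"] False x dilD(1)[OF transl_dil[OF f] x(1)] by auto
  then show ?thesis using transl_in_agree[OF _ t(1), of g x y] t(2) x y unfolding transl_in_def by blast
qed

lemma homothety_ex:
  assumes "c \<in> E" "x \<in> E" "y \<in> E" "x \<noteq> c" "y \<noteq> c" "d c x = d c y"
  shows "\<exists>f. dil f \<and> f c = c \<and> f x = y"
proof -
  interpret p: pencil E H d ln "E - {c}" "d c" by (rule pencil_homothety[OF assms(1)])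
  have e: "p.eqv x y" using par[of c x y] assms by (auto simp: p.eqv_def)
  obtain f where f: "p.pdil f" "f x = y" using p.pdil_ex[OF _ _ e] assms by auto
  define g where "g = f(c := c)"
  have f0: "f z \<in> E" "f z \<noteq> c" "d c (f z) = d c z" if "z \<in> E" "z \<noteq> c" for z
    using f(1) that p.eqv_pd[of z "f z"] unfolding p.pdil_def by auto
  have ff: "f u \<noteq> f v \<and> d (f u) (f v) = d u v" if "u \<in> E" "u \<noteq> c" "v \<in> E" "v \<noteq> c" "u \<noteq> v" for u v
    using f(1) that unfolding p.pdil_def by auto
  have "g u \<noteq> g v \<and> d (g u) (g v) = d u v" if uv: "u \<in> E" "v \<in> E" "u \<noteq> v" for u v
  proof -
    consider "u = c" | "v = c" | "u \<noteq> c" "v \<noteq> c" by blast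
    then show ?thesis
    proof cases
      case 1
      then show ?thesis using f0(2,3)[of v] uv by (auto simp: g_def)
    next
      case 2
      then show ?thesis using f0(2,3)[of u] uv d_sym[of "f u" c] d_sym[of u c] by (auto simp: g_def)
    next
      case 3
      then show ?thesis using ff uv by (auto simp: g_def)
    qed
  qed
  then have "dil g" using f0(1) assms(1) by (auto simp: dil_def g_def)
  then show ?thesis using f assms by (intro exI[of _ g]) (auto simp: g_def)
qed

text \<open>Parallelogram: both points lie on the line through \<open>g x\<close> in direction
  \<open>p\<close> and on the line through \<open>f x\<close> in direction \<open>q\<close>.\<close>

lemma transl_in_commute:
  assumes "transl_in p f" "transl_in q g" "p \<noteq> q" "x \<in> E"
  shows "f (g x) = g (f x)"
proof (rule unique_meet[of "g x" "f x"])
  have D: "dil f" "dil g" using assms by (auto simp: transl_in_def)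
  show E: "g x \<in> E" "f x \<in> E" "f (g x) \<in> E" "g (f x) \<in> E" using D assms by (auto intro: dilD(1))
  have n: "g x \<noteq> x" "f x \<noteq> x" "d x (g x) = q" "d x (f x) = p" using assms by (auto simp: transl_in_def)
  show "f (g x) \<noteq> g x" "g (f x) \<noteq> f x" "f (g x) \<noteq> f x" "g (f x) \<noteq> g x"
    using assms E D n dilD(2) unfolding transl_in_def by metis+
  have 1: "d (g x) (f (g x)) = p" "d (f x) (g (f x)) = q" using assms E by (auto simp: transl_in_def)
  moreover have 2: "d (g x) (g (f x)) = p" "d (f x) (f (g x)) = q" using dilD(3) D n E assms by metis+
  ultimately show "d (g x) (f (g x)) = d (g x) (g (f x))" "d (f x) (f (g x)) = d (f x) (g (f x))"
    "d (g x) (f (g x)) \<noteq> d (f x) (f (g x))" using assms by auto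
qed

text \<open>The point to prove is that all traces of the composition \<open>h\<close> are parallel.
  A translation \<open>m\<close> from \<open>x\<close> to \<open>y\<close> whose direction is
  neither \<open>p\<close> nor \<open>q\<close> commutes with \<open>f\<close> and \<open>g\<close>,
  so it carries the trace of \<open>x\<close> to that of \<open>y\<close>. For the two excluded
  directions, the comparison passes through a point outside the plane with directions
  \<open>ln p q\<close>.\<close>

lemma transl_in_comp:
  assumes pq: "p \<in> H" "q \<in> H" "p \<noteq> q" and f: "transl_in p f" and g: "transl_in q g"
  shows "\<exists>s\<in>H. s \<noteq> p \<and> s \<noteq> q \<and> transl_in s (\<lambda>x. f (g x))"
proof -
  define h where "h = (\<lambda>x. f (g x))"
  have D: "dil f" "dil g" using f g by (auto simp: transl_in_def)
  have Dh: "dil h" using dil_comp D by (simp add: h_def)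
  have h: "h x \<in> E" "h x \<noteq> x" "d x (h x) \<noteq> p" "d x (h x) \<noteq> q" if x: "x \<in> E" for x
  proof -
    have gx: "g x \<in> E" "g x \<noteq> x" "d x (g x) = q" using x g dilD(1) D by (auto simp: transl_in_def)
    have hx: "h x \<in> E" "h x \<noteq> g x" "d (g x) (h x) = p" using gx f dilD(1) D by (auto simp: transl_in_def h_def)
    show 1: "h x \<in> E" "h x \<noteq> x" using gx hx pq d_sym by metis+
    show "d x (h x) \<noteq> p" "d x (h x) \<noteq> q"
      using par[of "h x" x "g x"] par[of x "g x" "h x"] gx hx 1 x pq d_sym by metis+
  qed
  have step: "d y (h y) = d x (h x)" if xy: "x \<in> E" "y \<in> E" "x \<noteq> y" "d x y \<noteq> p" "d x y \<noteq> q" for x y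
  proof -
    obtain m where m: "transl m" "m x = y" using transl_ex xy by blast
    then have tm: "transl_in (d x y) m" using translD(2)[of m x] xy by auto
    have "g x \<in> E" using D xy by (auto intro: dilD(1))
    then have "m (f (g x)) = f (m (g x))" using transl_in_commute[OF tm f xy(4)] by blast
    moreover have "m (g x) = g (m x)" using transl_in_commute[OF tm g xy(5,1)] .
    ultimately have "h y = m (h x)" using m by (simp add: h_def)
    then have "d y (h y) = d (m x) (m (h x))" using m by simp
    then show ?thesis using dilD(3)[OF transl_dil[OF m(1)], of x "h x"] h xy by metis
  qed
  have all: "d y (h y) = d x (h x)" if xy: "x \<in> E" "y \<in> E" for x y
  proof (cases "x = y \<or> d x y \<noteq> p \<and> d x y \<noteq> q")
    case True then show ?thesis using step xy by auto
  next
    case False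
    have fl: "flat (ln p q)" using flat_line pq by auto
    have pl: "p \<in> ln p q" "q \<in> ln p q" using ln_fst ln_snd pq by auto
    obtain r where r: "r \<in> H" "r \<notin> ln p q" using not_line pq by blast
    obtain z where z: "z \<in> E" "z \<noteq> x" "d x z = r" using ex_pt xy r by blast
    have 1: "d x z \<noteq> p" "d x z \<noteq> q" "z \<noteq> y" using z r pl False by auto
    have "d z y \<notin> ln p q"
      using flat_trans[OF fl, of x y z] xy z 1 False pl r d_sym[of y z] by auto
    then have "d z y \<noteq> p" "d z y \<noteq> q" using pl by auto
    then have "d y (h y) = d z (h z)" by (intro step[OF z(1) xy(2) 1(3)])
    also have "\<dots> = d x (h x)" by (intro step[OF xy(1) z(1) z(2)[symmetric] 1(1,2)])
    finally show ?thesis .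
  qed
  obtain x where x: "x \<in> E" using nonempty by auto
  have "transl_in (d x (h x)) h" using all[OF x] h(2) Dh unfolding transl_in_def by blast
  moreover have "d x (h x) \<in> H" using h[OF x] d_in[OF x h(1)[OF x]] by simp
  ultimately show ?thesis using h(3,4)[OF x] unfolding h_def by blast
qed

lemma transl_comp:
  assumes f: "transl f" and g: "transl g"
  shows "transl (\<lambda>x. f (g x))"
proof (cases "(\<forall>x\<in>E. f x = x) \<or> (\<forall>x\<in>E. g x = x)")
  case True
  have D: "dil f" "dil g" using transl_dil f g by auto
  from True show ?thesis
  proof
    assume a: "\<forall>x\<in>E. f x = x"
    then have "\<forall>x\<in>E. f (g x) = g x" using D by (auto intro: dilD(1))
    then show ?thesis using g by (auto simp: transl_def transl_in_def dil_def)
  next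
    assume a: "\<forall>x\<in>E. g x = x"
    then show ?thesis using f by (auto simp: transl_def transl_in_def dil_def)
  qed
next
  case False
  then obtain p q where pq: "p \<in> H" "q \<in> H" "transl_in p f" "transl_in q g" using f g by (auto simp: transl_def)
  have D: "dil f" "dil g" using transl_dil f g by auto
  show ?thesis
  proof (cases "p = q")
    case False
    then show ?thesis using transl_in_comp[OF pq(1,2) False pq(3,4)] by (auto simp: transl_def)
  next
    case True
    have "f (g x) = x \<or> d x (f (g x)) = p" if x: "x \<in> E" for x
      using par[of "g x" x "f (g x)"] pq True x dilD(1)[OF D(2)] dilD(1)[OF D(1)] d_sym unfolding transl_in_def
      by metis
    then show ?thesis using translI[OF pq(1)] dil_comp[OF D] by auto
  qed
qed

text \<open>Different directions are the parallelogram case. For a common direction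
  \<open>p\<close>, choose a translation \<open>h\<close> in another direction \<open>r\<close>:
  both \<open>h\<close> and the composition of \<open>g\<close> with \<open>h\<close> have
  directions other than \<open>p\<close>, so \<open>f\<close> commutes with both. Hence the two
  products agree at \<open>y = h x\<close>, and a translation is determined by one value.\<close>

lemma transl_commute:
  assumes f: "transl f" and g: "transl g" and x: "x \<in> E"
  shows "f (g x) = g (f x)"
proof (cases "(\<forall>x\<in>E. f x = x) \<or> (\<forall>x\<in>E. g x = x)")
  case True
  then show ?thesis using x dilD(1)[OF transl_dil[OF f]] dilD(1)[OF transl_dil[OF g]] by auto
next
  case False
  then obtain p q where pq: "p \<in> H" "q \<in> H" "transl_in p f" "transl_in q g" using f g by (auto simp: transl_def)
  show ?thesis
  proof (cases "p = q")
    case False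
    then show ?thesis using transl_in_commute pq x by auto
  next
    case True
    obtain r where r: "r \<in> H" "r \<noteq> p" using ex_other_dir by blast
    obtain y where y: "y \<in> E" "y \<noteq> x" "d x y = r" using ex_pt x r by blast
    obtain h where h: "transl h" "h x = y" using transl_ex x y by blast
    have th: "transl_in r h" using translD(2)[OF h(1) x] h y by auto
    obtain s where s: "s \<in> H" "s \<noteq> p" "transl_in s (\<lambda>x. g (h x))"
      using transl_in_comp[of p r g h] pq True r th by auto
    have "f (g (h x)) = g (h (f x))" using transl_in_commute[OF pq(3) s(3)] s x by auto
    also have "\<dots> = g (f (h x))" using transl_in_commute[OF pq(3) th] r x by auto
    finally have "f (g y) = g (f y)" using h by simp
    then show ?thesis using transl_unique[OF transl_comp[OF f g] transl_comp[OF g f] y(1) _ x] by simp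
  qed
qed

end

section \<open>The group of an affine space and its directions\<close>

lemma (in abelian_group) a_left_cancel:
  assumes "x \<in> carrier G" "y \<in> carrier G" "z \<in> carrier G"
  shows "x \<oplus> y = x \<oplus> z \<longleftrightarrow> y = z"
proof
  assume "x \<oplus> y = x \<oplus> z"
  then have "\<ominus> x \<oplus> (x \<oplus> y) = \<ominus> x \<oplus> (x \<oplus> z)" by simp
  then show "y = z" using assms by (simp add: a_assoc[symmetric] l_neg)
qed simp

text \<open>What the algebra uses of the geometry: vectors, and a direction for every nonzero one.
  \<open>dir_ln_ex\<close> is the converse of \<open>dir_add_ln\<close>, and
  \<open>homothety\<close> supplies enough scalars to reach every vector on a line through
  zero.\<close>

locale dir_group = abelian_group G for G :: "('e, 'm) ring_scheme" (structure) +
  fixes H :: "'h set" and ln :: "'h \<Rightarrow> 'h \<Rightarrow> 'h set" and dir :: "'e \<Rightarrow> 'h"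
  assumes dir_in: "x \<in> carrier G \<Longrightarrow> x \<noteq> \<zero> \<Longrightarrow> dir x \<in> H"
    and dir_minus: "x \<in> carrier G \<Longrightarrow> x \<noteq> \<zero> \<Longrightarrow> dir (\<ominus> x) = dir x"
    and dir_add: "x \<in> carrier G \<Longrightarrow> y \<in> carrier G \<Longrightarrow> x \<noteq> \<zero> \<Longrightarrow> y \<noteq> \<zero> \<Longrightarrow> x \<oplus> y \<noteq> \<zero> \<Longrightarrow>
      dir x = dir y \<Longrightarrow> dir (x \<oplus> y) = dir x"
    and dir_add_ln: "x \<in> carrier G \<Longrightarrow> y \<in> carrier G \<Longrightarrow> x \<noteq> \<zero> \<Longrightarrow> y \<noteq> \<zero> \<Longrightarrow>
      dir x \<noteq> dir y \<Longrightarrow> dir (x \<oplus> y) \<in> ln (dir x) (dir y)"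
    and dir_ln_ex: "p \<in> H \<Longrightarrow> q \<in> H \<Longrightarrow> p \<noteq> q \<Longrightarrow> s \<in> ln p q \<Longrightarrow> s \<noteq> p \<Longrightarrow> s \<noteq> q \<Longrightarrow>
      \<exists>x\<in>carrier G. \<exists>y\<in>carrier G. x \<noteq> \<zero> \<and> y \<noteq> \<zero> \<and> dir x = p \<and> dir y = q \<and> dir (x \<oplus> y) = s"
    and dir_ex: "p \<in> H \<Longrightarrow> \<exists>x\<in>carrier G. x \<noteq> \<zero> \<and> dir x = p"
    and homothety: "x \<in> carrier G \<Longrightarrow> y \<in> carrier G \<Longrightarrow> x \<noteq> \<zero> \<Longrightarrow> y \<noteq> \<zero> \<Longrightarrow> dir x = dir y \<Longrightarrow>
      \<exists>f. (\<forall>u\<in>carrier G. f u \<in> carrier G \<and> (u \<noteq> \<zero> \<longrightarrow> f u \<noteq> \<zero> \<and> dir (f u) = dir u)) \<and>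
        (\<forall>u\<in>carrier G. \<forall>v\<in>carrier G. f (u \<oplus> v) = f u \<oplus> f v) \<and> f x = y"
    and two_directions: "\<exists>p\<in>H. \<exists>q\<in>H. p \<noteq> q"

locale aff_pointed = aff_space E H d ln
  for E :: "'e set" and H :: "'h set" and d and ln +
  fixes orig :: 'e
  assumes orig: "orig \<in> E"
begin

text \<open>A point stands for the translation that takes \<open>orig\<close> to it, so
  \<open>shift x y\<close> is the sum of two points as vectors from \<open>orig\<close>.\<close>

definition shift :: "'e \<Rightarrow> 'e \<Rightarrow> 'e" where
  "shift x = (SOME f. transl f \<and> f orig = x)"

definition gr :: "'e ring" where
  "gr = \<lparr>carrier = E, mult = \<lambda>_ _. orig, one = orig, zero = orig, add = shift\<rparr>"

lemma gr_simps [simp]: "carrier gr = E" "zero gr = orig" "add gr = shift"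
  by (auto simp: gr_def)

lemma shift: "x \<in> E \<Longrightarrow> transl (shift x)" "x \<in> E \<Longrightarrow> shift x orig = x"
  using someI_ex[OF transl_ex[OF orig, of x]] unfolding shift_def by auto

lemma shift_dil: "x \<in> E \<Longrightarrow> dil (shift x)"
  using shift transl_dil by auto

lemma shift_in: "x \<in> E \<Longrightarrow> y \<in> E \<Longrightarrow> shift x y \<in> E"
  using shift_dil dilD(1) by metis

lemma shift_comm: "x \<in> E \<Longrightarrow> y \<in> E \<Longrightarrow> shift x y = shift y x"
  using transl_commute[OF shift(1) shift(1) orig, of x y] shift(2) by auto

lemma shift_orig: "x \<in> E \<Longrightarrow> shift orig x = x"
  using shift_comm[OF orig] shift(2) by auto

lemma shift_assoc:
  assumes "x \<in> E" "y \<in> E" "z \<in> E"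
  shows "shift (shift x y) z = shift x (shift y z)"
  by (rule transl_unique[OF shift(1) transl_comp[OF shift(1) shift(1)] orig])
    (use assms shift_in shift(2) in auto)

lemma shift_inv: assumes "x \<in> E" shows "\<exists>y\<in>E. shift y x = orig"
proof -
  obtain f where f: "transl f" "f x = orig" using transl_ex assms orig by blast
  define y where "y = f orig"
  have y: "y \<in> E" using dilD(1)[OF transl_dil[OF f(1)] orig] by (simp add: y_def)
  have "shift y x = f x" using transl_unique[OF shift(1)[OF y] f(1) orig _ assms] shift(2)[OF y] by (simp add: y_def)
  then show ?thesis using f y by auto
qed

lemma d_shift: "x \<in> E \<Longrightarrow> y \<in> E \<Longrightarrow> y \<noteq> orig \<Longrightarrow> shift x y \<noteq> x \<and> d x (shift x y) = d orig y"
  using dilD(2,3)[OF shift_dil orig, of x y] shift(2) by auto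

lemma abelian_group_gr: "abelian_group gr"
proof (rule abelian_groupI)
  fix x assume "x \<in> carrier gr"
  then show "\<exists>y\<in>carrier gr. y \<oplus>\<^bsub>gr\<^esub> x = \<zero>\<^bsub>gr\<^esub>" using shift_inv by simp
next
  fix x y assume "x \<in> carrier gr" "y \<in> carrier gr"
  then show "x \<oplus>\<^bsub>gr\<^esub> y = y \<oplus>\<^bsub>gr\<^esub> x" using shift_comm by simp
qed (simp_all add: shift_in orig shift_assoc shift_orig)

sublocale gr: abelian_group gr by (rule abelian_group_gr)

lemma gr_diff:
  assumes "x \<in> E" "y \<in> E" "x \<noteq> y"
  shows "y \<ominus>\<^bsub>gr\<^esub> x \<noteq> orig" "d x y = d orig (y \<ominus>\<^bsub>gr\<^esub> x)"
proof -
  have c: "y \<ominus>\<^bsub>gr\<^esub> x \<in> E" using gr.minus_closed assms by auto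
  have "shift x (y \<ominus>\<^bsub>gr\<^esub> x) = y"
    using gr.a_lcomm[of x y "\<ominus>\<^bsub>gr\<^esub> x"] gr.a_inv_closed[of x] gr.r_neg[of x] shift assms by (simp add: a_minus_def)
  moreover show "y \<ominus>\<^bsub>gr\<^esub> x \<noteq> orig" using shift(2)[OF assms(1)] calculation assms(3) by auto
  ultimately show "d x y = d orig (y \<ominus>\<^bsub>gr\<^esub> x)" using d_shift[OF assms(1) c] by auto
qed

text \<open>For vectors in different directions the sum is the fourth vertex of a parallelogram, and
  \<open>f\<close> preserves directions. For parallel \<open>u\<close> and \<open>v\<close>, add a
  vector \<open>w\<close> of another direction, expand the image of \<open>u + v + w\<close> in two
  ways by the first case, and cancel \<open>f w\<close>.\<close>

lemma dil_additive:
  assumes f: "dil f" "f orig = orig" and uv: "u \<in> E" "v \<in> E"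
  shows "f (shift u v) = shift (f u) (f v)"
proof -
  have fE: "f x \<in> E" if "x \<in> E" for x using dilD(1)[OF f(1) that] .
  have f0: "f x \<noteq> orig \<and> d orig (f x) = d orig x" if "x \<in> E" "x \<noteq> orig" for x
    using dilD(2,3)[OF f(1) orig that(1)] that(2) f(2) by auto
  have diff: "f (shift u v) = shift (f u) (f v)"
    if uv: "u \<in> E" "v \<in> E" "u \<noteq> orig" "v \<noteq> orig" "d orig u \<noteq> d orig v" for u v
  proof -
    note uv' = d_shift[OF uv(1,2,4)] d_shift[OF uv(2,1,3)] shift_comm[OF uv(2,1)]
    have F: "f u \<in> E" "f v \<in> E" "f u \<noteq> orig" "f v \<noteq> orig" "d orig (f u) = d orig u" "d orig (f v) = d orig v"
      using fE f0 uv by auto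
    note F' = d_shift[OF F(1,2,4)] d_shift[OF F(2,1,3)] shift_comm[OF F(2,1)]
    have t: "shift u v \<in> E" using shift_in uv by auto
    have g: "f (shift u v) \<noteq> f u" "f (shift u v) \<noteq> f v" "d (f u) (f (shift u v)) = d orig v" "d (f v) (f (shift u v)) = d orig u"
      using dilD(2,3)[OF f(1) uv(1) t] dilD(2,3)[OF f(1) uv(2) t] uv' by metis+
    show ?thesis
      by (rule unique_meet[of "f u" "f v"]) (use F F' g fE[OF t] shift_in[OF F(1,2)] uv(5) in auto)
  qed
  show ?thesis
  proof (cases "u = orig \<or> v = orig")
    case True
    then show ?thesis using f fE uv shift_orig shift(2) by auto
  next
    case False
    show ?thesis
    proof (cases "d orig u = d orig v")
      case False
      then show ?thesis using diff uv \<open>\<not> (u = orig \<or> v = orig)\<close> by auto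
    next
      case True
      obtain r where r: "r \<in> H" "r \<noteq> d orig u" using ex_other_dir by blast
      obtain w where w: "w \<in> E" "w \<noteq> orig" "d orig w = r" using ex_pt orig r by blast
      have ne: "u \<noteq> orig" "v \<noteq> orig" using False by auto
      have vw: "shift v w \<in> E" "shift v w \<noteq> orig" "d orig (shift v w) \<noteq> d orig u"
      proof -
        have a: "shift v w \<in> E" using shift_in uv w by auto
        have b: "d v (shift v w) = r \<and> shift v w \<noteq> v" using d_shift[OF uv(2) w(1,2)] w by auto
        show "shift v w \<in> E" by (rule a)
        show c: "shift v w \<noteq> orig" using b r True d_sym[of v orig] by auto
        show "d orig (shift v w) \<noteq> d orig u"
          using par[of orig v "shift v w"] a b c ne uv orig r True by auto
      qed
      have 1: "f (shift (shift u v) w) = shift (f u) (shift (f v) (f w))"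
        using diff[OF uv(1) vw(1) ne(1) vw(2)] vw(3) diff[OF uv(2) w(1) ne(2) w(2)] w r True
          shift_assoc[OF uv w(1)] by simp
      have 2: "f (shift (shift u v) w) = shift (f (shift u v)) (f w)"
      proof (cases "shift u v = orig")
        case True
        then show ?thesis using shift_orig f w fE by auto
      next
        case ne': False
        have "d orig (shift u v) = d orig u"
          using par[of u orig "shift u v"] d_shift[OF uv ne(2)] True ne ne' uv orig shift_in[OF uv] d_sym[of u orig] by auto
        then show ?thesis using diff[OF shift_in[OF uv] w(1) ne' w(2)] r w by auto
      qed
      have "shift (f w) (f (shift u v)) = shift (f w) (shift (f u) (f v))"
        using 1 2 shift_assoc shift_comm shift_in fE uv w by metis
      moreover have "f w \<in> E" "f (shift u v) \<in> E" "shift (f u) (f v) \<in> E" using fE uv w shift_in by auto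
      ultimately show ?thesis using gr.a_left_cancel[of "f w" "f (shift u v)" "shift (f u) (f v)"] by auto
    qed
  qed
qed

sublocale dg: dir_group gr H ln "d orig"
proof unfold_locales
  fix x assume x: "x \<in> carrier gr" "x \<noteq> \<zero>\<^bsub>gr\<^esub>"
  show "d orig x \<in> H" using x d_in orig by auto
  show "d orig (\<ominus>\<^bsub>gr\<^esub> x) = d orig x"
    using gr_diff(2)[of x orig] x orig d_sym[of x orig] gr.a_inv_closed[of x] by (simp add: a_minus_def shift_orig)
next
  fix x y assume xy: "x \<in> carrier gr" "y \<in> carrier gr" "x \<noteq> \<zero>\<^bsub>gr\<^esub>" "y \<noteq> \<zero>\<^bsub>gr\<^esub>"
  then have xy': "x \<in> E" "y \<in> E" "x \<noteq> orig" "y \<noteq> orig" by auto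
  have t: "shift x y \<in> E" "shift x y \<noteq> x" "d x (shift x y) = d orig y" using d_shift xy' shift_in by auto
  { assume "x \<oplus>\<^bsub>gr\<^esub> y \<noteq> \<zero>\<^bsub>gr\<^esub>" "d orig x = d orig y"
    then show "d orig (x \<oplus>\<^bsub>gr\<^esub> y) = d orig x"
      using par[of x orig "shift x y"] t xy' orig d_sym[of x orig] by auto }
  { assume a: "d orig x \<noteq> d orig y"
    have "shift x y \<noteq> orig" using t a d_sym[of x orig] by auto
    then have "d orig (shift x y) \<in> ln (d x orig) (d x (shift x y))"
      using triangle[of x orig "shift x y"] t a xy' orig d_sym[of x orig] by auto
    then show "d orig (x \<oplus>\<^bsub>gr\<^esub> y) \<in> ln (d orig x) (d orig y)" using t d_sym[of x orig] by simp }
  { assume "d orig x = d orig y"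
    then obtain f where f: "dil f" "f orig = orig" "f x = y" using homothety_ex[OF orig xy'(1,2,3,4)] by auto
    have f0: "f u \<in> E \<and> (u \<noteq> orig \<longrightarrow> f u \<noteq> orig \<and> d orig (f u) = d orig u)" if "u \<in> E" for u
      using dilD(1)[OF f(1) that] dilD(2,3)[OF f(1) orig that] f(2) by auto
    show "\<exists>f. (\<forall>u\<in>carrier gr. f u \<in> carrier gr \<and> (u \<noteq> \<zero>\<^bsub>gr\<^esub> \<longrightarrow> f u \<noteq> \<zero>\<^bsub>gr\<^esub> \<and> d orig (f u) = d orig u)) \<and>
        (\<forall>u\<in>carrier gr. \<forall>v\<in>carrier gr. f (u \<oplus>\<^bsub>gr\<^esub> v) = f u \<oplus>\<^bsub>gr\<^esub> f v) \<and> f x = y"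
      using f0 dil_additive[OF f(1,2)] f(3) by (intro exI[of _ f]) auto }
next
  fix p q s assume a: "p \<in> H" "q \<in> H" "p \<noteq> q" "s \<in> ln p q" "s \<noteq> p" "s \<noteq> q"
  then have "s \<in> H" using ln_sub by blast
  then obtain z where z: "z \<in> E" "z \<noteq> orig" "d orig z = s" using ex_pt orig by blast
  \<comment> \<open>Decomposition of the vector \<open>z\<close>: the line through
    \<open>orig\<close> in direction \<open>p\<close> meets the line through \<open>z\<close> in
    direction \<open>q\<close>, and the meeting point and its difference to \<open>z\<close> are the
    two summands.\<close>
  obtain x where x: "x \<in> E" "x \<noteq> orig" "x \<noteq> z" "d orig x = p" "d z x = q"
    using meet[of orig z p q] orig z a by auto
  have y: "z \<ominus>\<^bsub>gr\<^esub> x \<noteq> orig" "d orig (z \<ominus>\<^bsub>gr\<^esub> x) = q" "z \<ominus>\<^bsub>gr\<^esub> x \<in> E"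
    using gr_diff[of x z] x z d_sym gr.minus_closed by auto
  have "shift x (z \<ominus>\<^bsub>gr\<^esub> x) = z"
    using gr.a_lcomm[of x z "\<ominus>\<^bsub>gr\<^esub> x"] gr.a_inv_closed[of x] gr.r_neg[of x] shift x z by (simp add: a_minus_def)
  then show "\<exists>x\<in>carrier gr. \<exists>y\<in>carrier gr. x \<noteq> \<zero>\<^bsub>gr\<^esub> \<and> y \<noteq> \<zero>\<^bsub>gr\<^esub> \<and> d orig x = p \<and> d orig y = q \<and> d orig (x \<oplus>\<^bsub>gr\<^esub> y) = s"
    using x y z by (intro bexI[of _ x] bexI[of _ "z \<ominus>\<^bsub>gr\<^esub> x"]) auto
next
  fix p assume "p \<in> H"
  then show "\<exists>x\<in>carrier gr. x \<noteq> \<zero>\<^bsub>gr\<^esub> \<and> d orig x = p" using ex_pt orig by auto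
qed (rule two_dirs)

end

section \<open>Coordinates\<close>

context dir_group
begin

lemma sum_dir_neq:
  assumes "x \<in> carrier G" "y \<in> carrier G" "x \<noteq> \<zero>" "y \<noteq> \<zero>" "dir x \<noteq> dir y"
  shows "x \<oplus> y \<noteq> \<zero>" "dir (x \<oplus> y) \<noteq> dir y"
proof -
  show 0: "x \<oplus> y \<noteq> \<zero>"
  proof
    assume "x \<oplus> y = \<zero>"
    then have "\<ominus> y = x" using minus_equality assms by auto
    then show False using dir_minus[of y] assms by auto
  qed
  show "dir (x \<oplus> y) \<noteq> dir y"
  proof
    assume a: "dir (x \<oplus> y) = dir y"
    have x: "(x \<oplus> y) \<oplus> \<ominus> y = x" using assms by (simp add: a_assoc r_neg)
    have n: "\<ominus> y \<noteq> \<zero>" using assms minus_minus[of y] by auto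
    have "dir ((x \<oplus> y) \<oplus> \<ominus> y) = dir (x \<oplus> y)"
      by (rule dir_add) (use 0 n x a dir_minus[of y] assms in auto)
    then show False using x a assms by simp
  qed
qed

lemma ex_other_direction: "\<exists>y\<in>carrier G. y \<noteq> \<zero> \<and> dir y \<noteq> p"
  using two_directions dir_ex by metis

text \<open>Artin's trace-preserving endomorphisms. Directions are constrained only where the value
  is nonzero, so that sums, which may vanish, remain of this kind.\<close>

definition endo :: "('e \<Rightarrow> 'e) \<Rightarrow> bool" where
  "endo f \<longleftrightarrow> (\<forall>u\<in>carrier G. f u \<in> carrier G \<and> (u \<noteq> \<zero> \<longrightarrow> f u \<noteq> \<zero> \<longrightarrow> dir (f u) = dir u)) \<and>
     (\<forall>u\<in>carrier G. \<forall>v\<in>carrier G. f (u \<oplus> v) = f u \<oplus> f v)"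

lemma endoD:
  "endo f \<Longrightarrow> u \<in> carrier G \<Longrightarrow> f u \<in> carrier G"
  "endo f \<Longrightarrow> u \<in> carrier G \<Longrightarrow> v \<in> carrier G \<Longrightarrow> f (u \<oplus> v) = f u \<oplus> f v"
  "endo f \<Longrightarrow> u \<in> carrier G \<Longrightarrow> u \<noteq> \<zero> \<Longrightarrow> f u \<noteq> \<zero> \<Longrightarrow> dir (f u) = dir u"
  by (auto simp: endo_def)

lemma endo_zero: "endo f \<Longrightarrow> f \<zero> = \<zero>"
  using endoD(2)[of f \<zero> \<zero>] endoD(1)[of f \<zero>] a_left_cancel[of "f \<zero>" "f \<zero>" \<zero>] by auto

lemma endo_minus: "endo f \<Longrightarrow> u \<in> carrier G \<Longrightarrow> f (\<ominus> u) = \<ominus> (f u)"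
  using endoD(2)[of f "\<ominus> u" u] endo_zero[of f] minus_equality[of "f (\<ominus> u)" "f u"] endoD(1)[of f]
  by (auto simp: l_neg)

lemma endo_id: "endo (\<lambda>u. u)" by (auto simp: endo_def)

lemma endo_0: "endo (\<lambda>u. \<zero>)" by (auto simp: endo_def)

lemma endo_comp:
  assumes f: "endo f" and g: "endo g"
  shows "endo (\<lambda>u. f (g u))"
  unfolding endo_def
proof (intro conjI ballI impI)
  fix u assume u: "u \<in> carrier G"
  show "f (g u) \<in> carrier G" using endoD(1) f g u by blast
  assume "u \<noteq> \<zero>" "f (g u) \<noteq> \<zero>"
  then show "dir (f (g u)) = dir u"
    using endoD(3)[OF f endoD(1)[OF g u]] endoD(3)[OF g u] endo_zero[OF f] by force
next
  fix u v assume uv: "u \<in> carrier G" "v \<in> carrier G"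
  then show "f (g (u \<oplus> v)) = f (g u) \<oplus> f (g v)"
    using endoD(2)[OF g uv] endoD(2)[OF f endoD(1)[OF g uv(1)] endoD(1)[OF g uv(2)]] by simp
qed

lemma endo_add:
  assumes "endo f" "endo g"
  shows "endo (\<lambda>u. f u \<oplus> g u)"
  unfolding endo_def
proof (intro conjI ballI impI)
  fix u v assume uv: "u \<in> carrier G" "v \<in> carrier G"
  have c: "f u \<in> carrier G" "g u \<in> carrier G" "f v \<in> carrier G" "g v \<in> carrier G" using assms uv endoD by auto
  show "f u \<oplus> g u \<in> carrier G" using c by auto
  show "f (u \<oplus> v) \<oplus> g (u \<oplus> v) = f u \<oplus> g u \<oplus> (f v \<oplus> g v)"
    using c endoD(2)[OF assms(1) uv] endoD(2)[OF assms(2) uv] by (simp add: a_ac)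
next
  fix u assume u: "u \<in> carrier G" "u \<noteq> \<zero>" "f u \<oplus> g u \<noteq> \<zero>"
  have c: "f u \<in> carrier G" "g u \<in> carrier G" using assms u endoD by auto
  show "dir (f u \<oplus> g u) = dir u"
    using dir_add[of "f u" "g u"] endoD(3)[OF assms(1), of u] endoD(3)[OF assms(2), of u] u c
    by (cases "f u = \<zero>"; cases "g u = \<zero>") auto
qed

lemma endo_uminus: "endo f \<Longrightarrow> endo (\<lambda>u. \<ominus> (f u))"
  unfolding endo_def using dir_minus minus_add a_comm by (auto simp: a_comm)

text \<open>If \<open>y\<close> has another direction than \<open>x\<close>, then
  \<open>f (x + y) = f y\<close>; a nonzero value would have both the direction of
  \<open>x + y\<close> and that of \<open>y\<close>. If the directions agree, pass through a vector
  \<open>z\<close> of another direction.\<close>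

lemma endo_rigid_zero:
  assumes f: "endo f" and x: "x \<in> carrier G" "x \<noteq> \<zero>" "f x = \<zero>" and y: "y \<in> carrier G"
  shows "f y = \<zero>"
proof -
  have off: "f y = \<zero>" if x: "x \<in> carrier G" "x \<noteq> \<zero>" "f x = \<zero>" and y: "y \<in> carrier G" "y \<noteq> \<zero>" "dir x \<noteq> dir y" for x y
  proof (rule ccontr)
    assume a: "f y \<noteq> \<zero>"
    have "f (x \<oplus> y) = f y" using endoD[OF f] x y by simp
    moreover have "x \<oplus> y \<noteq> \<zero>" "dir (x \<oplus> y) \<noteq> dir y" using sum_dir_neq x y by auto
    ultimately show False using endoD(3)[OF f, of y] endoD(3)[OF f, of "x \<oplus> y"] a x y by auto
  qed
  show ?thesis
  proof (cases "y = \<zero>")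
    case True then show ?thesis using endo_zero f by auto
  next
    case False
    obtain z where z: "z \<in> carrier G" "z \<noteq> \<zero>" "dir z \<noteq> dir x" using ex_other_direction by blast
    show ?thesis
    proof (cases "dir x = dir y")
      case True
      have "f z = \<zero>" by (rule off[OF x z(1,2) z(3)[symmetric]])
      then show ?thesis using off[OF z(1,2) _ y False] z(3) True by metis
    next
      case F: False
      show ?thesis by (rule off[OF x y False F])
    qed
  qed
qed

lemma endo_rigid:
  assumes f: "endo f" and g: "endo g" and x: "x \<in> carrier G" "x \<noteq> \<zero>" "f x = g x" and y: "y \<in> carrier G"
  shows "f y = g y"
proof -
  have h: "endo (\<lambda>u. f u \<oplus> \<ominus> (g u))" using endo_add[OF f endo_uminus[OF g]] .
  have "f y \<oplus> \<ominus> (g y) = \<zero>"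
    using endo_rigid_zero[OF h x(1,2) _ y] x endoD(1)[OF g, of x] by (simp add: r_neg)
  then show ?thesis using minus_equality[of "f y" "\<ominus> (g y)"] endoD(1)[OF f y] endoD(1)[OF g y] minus_minus by auto
qed

lemma endo_ex:
  assumes "x \<in> carrier G" "x \<noteq> \<zero>" "y \<in> carrier G" "y = \<zero> \<or> dir y = dir x"
  shows "\<exists>f. endo f \<and> f x = y"
proof (cases "y = \<zero>")
  case True then show ?thesis using endo_0 by auto
next
  case False
  then obtain f where "\<forall>u\<in>carrier G. f u \<in> carrier G \<and> (u \<noteq> \<zero> \<longrightarrow> f u \<noteq> \<zero> \<and> dir (f u) = dir u)"
    "\<forall>u\<in>carrier G. \<forall>v\<in>carrier G. f (u \<oplus> v) = f u \<oplus> f v" "f x = y"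
    using homothety[of x y] assms by auto
  then show ?thesis by (intro exI[of _ f]) (auto simp: endo_def)
qed

end

section \<open>Scalars and the homogenized vector space\<close>

locale dir_group_unit = dir_group G H ln dir
  for G :: "('e, 'm) ring_scheme" (structure) and H :: "'h set" and ln dir +
  fixes e :: 'e
  assumes unit: "e \<in> carrier G" "e \<noteq> \<zero>"
begin

text \<open>By rigidity an endomorphism is known from its value at \<open>e\<close>. Scalars are
  encoded as these values, which fill the line through zero and \<open>e\<close>.\<close>

definition K :: "'e set" where
  "K = {x \<in> carrier G. x = \<zero> \<or> dir x = dir e}"

definition hm :: "'e \<Rightarrow> 'e \<Rightarrow> 'e" where
  "hm x = (SOME f. endo f \<and> f e = x)"

lemma K_carrier: "x \<in> K \<Longrightarrow> x \<in> carrier G" by (auto simp: K_def)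

lemma hm: "x \<in> K \<Longrightarrow> endo (hm x)" "x \<in> K \<Longrightarrow> hm x e = x"
  using someI_ex[OF endo_ex[OF unit, of x]] by (auto simp: K_def hm_def)

lemma endo_K: "endo f \<Longrightarrow> x \<in> K \<Longrightarrow> f x \<in> K"
  unfolding K_def mem_Collect_eq using endoD(1,3)[of f x] endo_zero[of f] by metis

lemma unit_K: "e \<in> K" "\<zero> \<in> K" using unit by (auto simp: K_def)

lemma endo_e_K: "endo f \<Longrightarrow> f e \<in> K" using endo_K unit_K by auto

text \<open>Reduces an identity between scalars to evaluation at \<open>e\<close>; the laws of the
  skew field and of its action are obtained this way.\<close>

lemma hm_eq: "endo f \<Longrightarrow> f e = x \<Longrightarrow> u \<in> carrier G \<Longrightarrow> hm x u = f u"
  using endo_rigid[OF hm(1) _ unit, of x f u] hm(2) endo_e_K by auto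

lemma hm_in: "x \<in> K \<Longrightarrow> u \<in> carrier G \<Longrightarrow> hm x u \<in> carrier G"
  "x \<in> K \<Longrightarrow> y \<in> K \<Longrightarrow> hm x y \<in> K"
  using hm(1) endoD(1) endo_K by auto

lemma K_add: "x \<in> K \<Longrightarrow> y \<in> K \<Longrightarrow> x \<oplus> y \<in> K"
  using endo_e_K[OF endo_add[OF hm(1) hm(1)], of x y] hm(2) by auto

lemma K_minus: "x \<in> K \<Longrightarrow> \<ominus> x \<in> K"
  using endo_e_K[OF endo_uminus[OF hm(1)], of x] hm(2) by auto

lemma hm_add: "x \<in> K \<Longrightarrow> y \<in> K \<Longrightarrow> u \<in> carrier G \<Longrightarrow> hm (x \<oplus> y) u = hm x u \<oplus> hm y u"
  by (rule hm_eq[OF endo_add[OF hm(1) hm(1)]]) (auto simp: hm(2))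

lemma hm_minus: "x \<in> K \<Longrightarrow> u \<in> carrier G \<Longrightarrow> hm (\<ominus> x) u = \<ominus> (hm x u)"
  by (rule hm_eq[OF endo_uminus[OF hm(1)]]) (auto simp: hm(2))

lemma hm_hm: "x \<in> K \<Longrightarrow> y \<in> K \<Longrightarrow> u \<in> carrier G \<Longrightarrow> hm (hm y x) u = hm y (hm x u)"
  by (rule hm_eq[OF endo_comp[OF hm(1) hm(1)]]) (auto simp: hm(2))

lemma hm_e: "u \<in> carrier G \<Longrightarrow> hm e u = u"
  by (rule hm_eq[OF endo_id]) auto

lemma hm_0: "u \<in> carrier G \<Longrightarrow> hm \<zero> u = \<zero>"
  by (rule hm_eq[OF endo_0]) auto

lemma hm_distr: "x \<in> K \<Longrightarrow> u \<in> carrier G \<Longrightarrow> v \<in> carrier G \<Longrightarrow> hm x (u \<oplus> v) = hm x u \<oplus> hm x v"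
  using endoD(2) hm(1) by auto

lemma hm_nonzero: "x \<in> K \<Longrightarrow> x \<noteq> \<zero> \<Longrightarrow> u \<in> carrier G \<Longrightarrow> u \<noteq> \<zero> \<Longrightarrow> hm x u \<noteq> \<zero> \<and> dir (hm x u) = dir u"
  using endo_rigid_zero[OF hm(1), of x u e] hm(2) unit endoD(3)[OF hm(1), of x u] by auto

text \<open>The inverse is the endomorphism taking \<open>x\<close> back to \<open>e\<close>. One
  composition fixes \<open>x\<close>, the other fixes \<open>e\<close>, so by rigidity both are the
  identity.\<close>

lemma hm_inv:
  assumes "x \<in> K" "x \<noteq> \<zero>"
  shows "\<exists>y\<in>K. y \<noteq> \<zero> \<and> (\<forall>u\<in>carrier G. hm x (hm y u) = u \<and> hm y (hm x u) = u)"
proof -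
  obtain g where g: "endo g" "g x = e" using endo_ex[of x e] assms unit by (auto simp: K_def)
  define y where "y = g e"
  have y: "y \<in> K" using endo_e_K g by (simp add: y_def)
  have gy: "hm y u = g u" if "u \<in> carrier G" for u using hm_eq[OF g(1) y_def[symmetric] that] .
  have 1: "hm x (g u) = u" if "u \<in> carrier G" for u
    by (rule endo_rigid[OF endo_comp[OF hm(1) g(1)] endo_id, of x]) (use assms K_carrier hm(2) g that in auto)
  have 2: "g (hm x u) = u" if "u \<in> carrier G" for u
    by (rule endo_rigid[OF endo_comp[OF g(1) hm(1)] endo_id unit]) (use assms K_carrier hm(2) g that in auto)
  have "y \<noteq> \<zero>" using 1[OF unit(1)] endo_zero[OF hm(1)[OF assms(1)]] unit by (auto simp: y_def)
  then show ?thesis using y gy 1 2 hm_in assms by (intro bexI[of _ y]) auto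
qed

text \<open>A scalar \<open>x\<close> stands for the endomorphism \<open>hm x\<close>; the product is reversed because scalars act on the right.\<close>

definition SF :: "'e ring" where
  "SF = \<lparr>carrier = K, mult = (\<lambda>x y. hm y x), one = e, zero = \<zero>, add = add G\<rparr>"

text \<open>The affine group, homogenized by one more coordinate.\<close>

definition VS :: "('e, 'e \<times> 'e) module" where
  "VS = \<lparr>carrier = carrier G \<times> K, mult = (\<lambda>_ _. (\<zero>, \<zero>)), one = (\<zero>, \<zero>), zero = (\<zero>, \<zero>),
     add = (\<lambda>u v. (fst u \<oplus> fst v, snd u \<oplus> snd v)), smult = (\<lambda>a v. (hm a (fst v), hm a (snd v)))\<rparr>"

lemma SF_simps [simp]: "carrier SF = K" "mult SF x y = hm y x" "one SF = e" "zero SF = \<zero>" "add SF = add G"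
  by (auto simp: SF_def)

lemma VS_simps [simp]: "carrier VS = carrier G \<times> K" "zero VS = (\<zero>, \<zero>)"
  "add VS u v = (fst u \<oplus> fst v, snd u \<oplus> snd v)" "smult VS a v = (hm a (fst v), hm a (snd v))"
  by (auto simp: VS_def)

lemma abelian_group_SF: "abelian_group SF"
proof (rule abelian_groupI)
  fix x assume "x \<in> carrier SF"
  then show "\<exists>y\<in>carrier SF. y \<oplus>\<^bsub>SF\<^esub> x = \<zero>\<^bsub>SF\<^esub>" using K_minus K_carrier l_neg by auto
qed (use K_add K_carrier unit_K in \<open>auto simp: a_assoc intro: a_comm\<close>)

lemma skew_field_SF: "skew_field SF"
proof -
  have m: "monoid SF"
    by (rule monoidI) (use hm_in unit_K hm hm_hm hm_e K_carrier in auto)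
  interpret R: ring SF
    by (rule ringI[OF abelian_group_SF m]) (use hm_add hm_distr K_carrier in auto)
  show ?thesis
  proof unfold_locales
    show "\<one>\<^bsub>SF\<^esub> \<noteq> \<zero>\<^bsub>SF\<^esub>" using unit by auto
    show "Units SF = carrier SF - {\<zero>\<^bsub>SF\<^esub>}"
    proof (intro Set.set_eqI iffI)
      fix x assume "x \<in> Units SF"
      then obtain y where "x \<in> K" "y \<in> K" "hm x y = e" by (auto simp: Units_def)
      then show "x \<in> carrier SF - {\<zero>\<^bsub>SF\<^esub>}" using hm_0[of y] unit K_carrier by auto
    next
      fix x assume "x \<in> carrier SF - {\<zero>\<^bsub>SF\<^esub>}"
      then have x: "x \<in> K" "x \<noteq> \<zero>" by auto
      then obtain y where y: "y \<in> K" "\<forall>u\<in>carrier G. hm x (hm y u) = u \<and> hm y (hm x u) = u" using hm_inv by blast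
      then have "hm x y = e" "hm y x = e" using hm(2) x unit by metis+
      then show "x \<in> Units SF" using x y by (auto simp: Units_def)
    qed
  qed
qed

lemma abelian_group_VS: "abelian_group VS"
proof (rule abelian_groupI)
  fix x assume "x \<in> carrier VS"
  then show "\<exists>y\<in>carrier VS. y \<oplus>\<^bsub>VS\<^esub> x = \<zero>\<^bsub>VS\<^esub>"
    using K_minus K_carrier l_neg by (intro bexI[of _ "(\<ominus> fst x, \<ominus> snd x)"]) auto
qed (use K_add K_carrier unit_K in \<open>auto simp: a_assoc intro: a_comm\<close>)

lemma right_vector_space_VS: "right_vector_space SF VS"
proof -
  interpret F: skew_field SF by (rule skew_field_SF)
  interpret V: abelian_group VS by (rule abelian_group_VS)
  show ?thesis
    by unfold_locales (use hm_in hm_add hm_distr hm_hm hm_e K_carrier in auto)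
qed

section \<open>Linear relations between three homogeneous vectors\<close>

lemma hm_eq_neg:
  assumes "a \<in> K" "a \<noteq> \<zero>" "u \<in> carrier G" "u \<noteq> \<zero>" "b \<in> K" "b \<noteq> \<zero>" "v \<in> carrier G" "v \<noteq> \<zero>" "hm a u \<oplus> hm b v = \<zero>"
  shows "dir u = dir v"
proof -
  have "hm a u = \<ominus> (hm b v)" using minus_equality[of "hm a u" "hm b v"] assms hm_in by auto
  then show ?thesis using hm_nonzero[of a u] hm_nonzero[of b v] dir_minus[of "hm b v"] hm_in assms by auto
qed

lemma hm_ex:
  assumes "x \<in> carrier G" "x \<noteq> \<zero>" "y \<in> carrier G" "y \<noteq> \<zero>" "dir y = dir x"
  shows "\<exists>a\<in>K. a \<noteq> \<zero> \<and> hm a x = y"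
proof -
  obtain f where f: "endo f" "f x = y" using endo_ex assms by auto
  then have "hm (f e) x = y" using hm_eq[OF f(1) refl] assms by auto
  moreover have "f e \<noteq> \<zero>" using endo_rigid_zero[OF f(1) unit _ assms(1)] f assms by auto
  ultimately show ?thesis using endo_e_K f by blast
qed

text \<open>All three coefficients are required to be nonzero: for pairwise non-proportional vectors
  this is the same as linear dependence, and it is symmetric in the three vectors.\<close>

definition dep :: "'e \<times> 'e \<Rightarrow> 'e \<times> 'e \<Rightarrow> 'e \<times> 'e \<Rightarrow> bool" where
  "dep u v w \<longleftrightarrow> (\<exists>a\<in>K-{\<zero>}. \<exists>b\<in>K-{\<zero>}. \<exists>c\<in>K-{\<zero>}.
     smult VS a u \<oplus>\<^bsub>VS\<^esub> (smult VS b v \<oplus>\<^bsub>VS\<^esub> smult VS c w) = \<zero>\<^bsub>VS\<^esub>)"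

lemma minus_nonzero: "x \<in> carrier G \<Longrightarrow> y \<in> carrier G \<Longrightarrow> x \<noteq> y \<Longrightarrow> y \<ominus> x \<noteq> \<zero>"
  unfolding a_minus_def using minus_equality[of y "\<ominus> x"] minus_minus[of x] by auto

text \<open>The last coordinate forces \<open>a = -(b + c)\<close>, which turns the relation into
  one between the differences \<open>y - x\<close> and \<open>z - x\<close>; two nonzero vectors
  satisfy such a relation exactly when they have the same direction.\<close>

lemma dep_EEE:
  assumes c: "x \<in> carrier G" "y \<in> carrier G" "z \<in> carrier G" and n: "x \<noteq> y" "x \<noteq> z" "y \<noteq> z"
  shows "dep (x, e) (y, e) (z, e) \<longleftrightarrow> dir (y \<ominus> x) = dir (z \<ominus> x)"
proof
  have ne: "y \<ominus> x \<noteq> \<zero>" "z \<ominus> x \<noteq> \<zero>" using c n minus_nonzero by auto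
  have cc: "y \<ominus> x \<in> carrier G" "z \<ominus> x \<in> carrier G" using c by auto
  have key: "hm a x \<oplus> (hm b y \<oplus> hm c z) = hm b (y \<ominus> x) \<oplus> hm c (z \<ominus> x)"
    if "b \<in> K" "c \<in> K" "a = \<ominus> (b \<oplus> c)" for a b c
    using that c hm_minus[of "b \<oplus> c" x] K_add[of b c] hm_add[of b c x] hm_in(1)
      hm_distr[of b y "\<ominus> x"] hm_distr[of c z "\<ominus> x"] endo_minus[OF hm(1)]
    by (simp add: a_minus_def minus_add a_ac)
  {
    assume "dep (x, e) (y, e) (z, e)"
    then obtain a b c where abc: "a \<in> K" "b \<in> K" "c \<in> K" "a \<noteq> \<zero>" "b \<noteq> \<zero>" "c \<noteq> \<zero>"
      and 1: "hm a x \<oplus> (hm b y \<oplus> hm c z) = \<zero>" and 2: "hm a e \<oplus> (hm b e \<oplus> hm c e) = \<zero>"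
      unfolding dep_def by auto
    have "a = \<ominus> (b \<oplus> c)" using 2 abc hm(2) minus_equality[of a "b \<oplus> c"] K_carrier K_add by auto
    then show "dir (y \<ominus> x) = dir (z \<ominus> x)" using key[OF abc(2,3)] 1 hm_eq_neg[of b "y \<ominus> x" c "z \<ominus> x"] abc ne cc by auto
  }
  {
    assume a: "dir (y \<ominus> x) = dir (z \<ominus> x)"
    then obtain c where c': "c \<in> K" "c \<noteq> \<zero>" "hm c (z \<ominus> x) = \<ominus> (y \<ominus> x)"
      using hm_ex[OF cc(2) ne(2), of "\<ominus> (y \<ominus> x)"] ne cc dir_minus[OF cc(1) ne(1)] minus_minus[OF cc(1)] by fastforce
    have s: "hm e (y \<ominus> x) \<oplus> hm c (z \<ominus> x) = \<zero>" using c' cc hm_e by (simp add: r_neg)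
    \<comment> \<open>The third coefficient must not vanish either: \<open>c = -e\<close> would give
      \<open>z - x = y - x\<close>, hence \<open>y = z\<close>.\<close>
    have "e \<oplus> c \<noteq> \<zero>"
    proof
      assume "e \<oplus> c = \<zero>"
      then have "c = \<ominus> e" using minus_equality[of c e] K_carrier[OF c'(1)] unit by (simp add: a_comm)
      then have "\<ominus> (z \<ominus> x) = \<ominus> (y \<ominus> x)" using c' hm_minus[OF unit_K(1) cc(2)] hm_e cc by auto
      then have "z \<ominus> x = y \<ominus> x" using cc minus_minus by metis
      then have "\<ominus> x \<oplus> z = \<ominus> x \<oplus> y" using c by (simp add: a_minus_def a_comm)
      then show False using a_left_cancel[of "\<ominus> x" z y] c n by auto
    qed
    then have na: "\<ominus> (e \<oplus> c) \<noteq> \<zero>" using minus_minus[of "e \<oplus> c"] K_add[OF unit_K(1) c'(1)] K_carrier by force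
    have aK: "\<ominus> (e \<oplus> c) \<in> K" using K_add K_minus unit_K c' by auto
    have "hm (\<ominus> (e \<oplus> c)) x \<oplus> (hm e y \<oplus> hm c z) = \<zero>" using key[OF unit_K(1) c'(1) refl] s by simp
    moreover have "hm (\<ominus> (e \<oplus> c)) e \<oplus> (hm e e \<oplus> hm c e) = \<zero>"
      using hm(2) aK unit_K c' K_add K_carrier by (simp add: l_neg)
    ultimately show "dep (x, e) (y, e) (z, e)"
      unfolding dep_def using aK na c' unit_K unit
      by (intro bexI[of _ "\<ominus> (e \<oplus> c)"] bexI[of _ e] bexI[of _ c]) auto
  }
qed

lemma dep_EEH:
  assumes c: "x \<in> carrier G" "y \<in> carrier G" "u \<in> carrier G" and n: "x \<noteq> y" "u \<noteq> \<zero>"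
  shows "dep (x, e) (y, e) (u, \<zero>) \<longleftrightarrow> dir (y \<ominus> x) = dir u"
proof
  have ne: "y \<ominus> x \<noteq> \<zero>" using c n minus_nonzero by auto
  have cc: "y \<ominus> x \<in> carrier G" using c by auto
  have key: "hm a x \<oplus> (hm b y \<oplus> hm c u) = hm b (y \<ominus> x) \<oplus> hm c u"
    if "b \<in> K" "c \<in> K" "a = \<ominus> b" for a b c
    using that c hm_minus[of b x] hm_in(1) hm_distr[of b y "\<ominus> x"] endo_minus[OF hm(1)]
    by (simp add: a_minus_def minus_add a_ac)
  {
    assume "dep (x, e) (y, e) (u, \<zero>)"
    then obtain a b c where abc: "a \<in> K" "b \<in> K" "c \<in> K" "a \<noteq> \<zero>" "b \<noteq> \<zero>" "c \<noteq> \<zero>"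
      and 1: "hm a x \<oplus> (hm b y \<oplus> hm c u) = \<zero>" and 2: "hm a e \<oplus> (hm b e \<oplus> hm c \<zero>) = \<zero>"
      unfolding dep_def by auto
    have "a = \<ominus> b" using 2 abc hm(2) minus_equality[of a b] K_carrier endo_zero[OF hm(1)] by auto
    then show "dir (y \<ominus> x) = dir u" using key[OF abc(2,3)] 1 hm_eq_neg[of b "y \<ominus> x" c u] abc ne n c cc by auto
  }
  {
    assume a: "dir (y \<ominus> x) = dir u"
    then obtain c where c': "c \<in> K" "c \<noteq> \<zero>" "hm c u = \<ominus> (y \<ominus> x)"
      using hm_ex[OF c(3) n(2), of "\<ominus> (y \<ominus> x)"] ne cc dir_minus[OF cc ne] minus_minus[OF cc] by fastforce
    have s: "hm e (y \<ominus> x) \<oplus> hm c u = \<zero>" using c' cc hm_e by (simp add: r_neg)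
    have na: "\<ominus> e \<noteq> \<zero>" using minus_minus[of e] unit by force
    have aK: "\<ominus> e \<in> K" using K_minus unit_K by auto
    have "hm (\<ominus> e) x \<oplus> (hm e y \<oplus> hm c u) = \<zero>" using key[OF unit_K(1) c'(1) refl] s by simp
    moreover have "hm (\<ominus> e) e \<oplus> (hm e e \<oplus> hm c \<zero>) = \<zero>"
      using hm(2) aK unit_K c' endo_zero[OF hm(1)] unit by (simp add: l_neg)
    ultimately show "dep (x, e) (y, e) (u, \<zero>)"
      unfolding dep_def using aK na c' unit_K unit
      by (intro bexI[of _ "\<ominus> e"] bexI[of _ e] bexI[of _ c]) auto
  }
qed

text \<open>The last coordinate of the combination is the coefficient \<open>a\<close> itself, which
  is nonzero.\<close>

lemma dep_EHH:
  assumes c: "u \<in> carrier G" "v \<in> carrier G"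
  shows "\<not> dep (x, e) (u, \<zero>) (v, \<zero>)"
proof
  assume "dep (x, e) (u, \<zero>) (v, \<zero>)"
  then obtain a b c where abc: "a \<in> K" "b \<in> K" "c \<in> K" "a \<noteq> \<zero>"
    and 2: "hm a e \<oplus> (hm b \<zero> \<oplus> hm c \<zero>) = \<zero>"
    unfolding dep_def by auto
  then show False using hm endo_zero[OF hm(1)] K_carrier by auto
qed

text \<open>A relation writes a multiple of \<open>w\<close> as a sum of multiples of
  \<open>u\<close> and \<open>v\<close>, and scaling keeps directions. Conversely, vectors in the
  directions of \<open>u\<close> and \<open>v\<close> with sum in that of \<open>w\<close> come from
  \<open>dir_ln_ex\<close>, and \<open>hm_ex\<close> expresses all three as multiples.\<close>

lemma dep_HHH:
  assumes c: "u \<in> carrier G" "v \<in> carrier G" "w \<in> carrier G" and n: "u \<noteq> \<zero>" "v \<noteq> \<zero>" "w \<noteq> \<zero>"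
    and d: "dir u \<noteq> dir v" "dir u \<noteq> dir w" "dir v \<noteq> dir w"
  shows "dep (u, \<zero>) (v, \<zero>) (w, \<zero>) \<longleftrightarrow> dir w \<in> ln (dir u) (dir v)"
proof
  assume "dep (u, \<zero>) (v, \<zero>) (w, \<zero>)"
  then obtain a b c' where abc: "a \<in> K" "b \<in> K" "c' \<in> K" "a \<noteq> \<zero>" "b \<noteq> \<zero>" "c' \<noteq> \<zero>"
    and 1: "hm a u \<oplus> (hm b v \<oplus> hm c' w) = \<zero>"
    unfolding dep_def by auto
  have cc: "hm a u \<in> carrier G" "hm b v \<in> carrier G" "hm c' w \<in> carrier G" using hm_in abc c by auto
  have "hm a u \<oplus> hm b v = \<ominus> (hm c' w)" using 1 cc minus_equality[of "hm a u \<oplus> hm b v" "hm c' w"] by (simp add: a_assoc)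
  then have "dir (hm a u \<oplus> hm b v) = dir w" using hm_nonzero abc c n dir_minus[OF cc(3)] by auto
  then show "dir w \<in> ln (dir u) (dir v)"
    using dir_add_ln[OF cc(1,2)] hm_nonzero[of a u] hm_nonzero[of b v] abc c n d by auto
next
  assume "dir w \<in> ln (dir u) (dir v)"
  then obtain x y where xy: "x \<in> carrier G" "y \<in> carrier G" "x \<noteq> \<zero>" "y \<noteq> \<zero>" "dir x = dir u" "dir y = dir v" "dir (x \<oplus> y) = dir w"
    using dir_ln_ex[of "dir u" "dir v" "dir w"] dir_in c n d by metis
  obtain a where a: "a \<in> K" "a \<noteq> \<zero>" "hm a u = x" using hm_ex[OF c(1) n(1) xy(1,3,5)] by blast
  obtain b where b: "b \<in> K" "b \<noteq> \<zero>" "hm b v = y" using hm_ex[OF c(2) n(2) xy(2,4,6)] by blast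
  have s: "x \<oplus> y \<noteq> \<zero>" "x \<oplus> y \<in> carrier G" using sum_dir_neq[OF xy(1-4)] xy d by auto
  have "\<ominus> (x \<oplus> y) \<noteq> \<zero>" "dir (\<ominus> (x \<oplus> y)) = dir w" using s minus_minus[OF s(2)] dir_minus[OF s(2,1)] xy by auto
  then obtain c' where c': "c' \<in> K" "c' \<noteq> \<zero>" "hm c' w = \<ominus> (x \<oplus> y)"
    using hm_ex[OF c(3) n(3), of "\<ominus> (x \<oplus> y)"] s by auto
  have "x \<oplus> (y \<oplus> \<ominus> (x \<oplus> y)) = \<zero>" using xy s by (simp add: a_assoc[symmetric] r_neg)
  then show "dep (u, \<zero>) (v, \<zero>) (w, \<zero>)"
    unfolding dep_def using a b c' endo_zero[OF hm(1)]
    by (intro bexI[of _ a] bexI[of _ b] bexI[of _ c']) auto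
qed

lemma dep_perm:
  assumes "u \<in> carrier VS" "v \<in> carrier VS" "w \<in> carrier VS"
  shows "dep u v w \<longleftrightarrow> dep v u w" "dep u v w \<longleftrightarrow> dep u w v"
proof -
  interpret V: right_vector_space SF VS by (rule right_vector_space_VS)
  have c: "smult VS a x \<in> carrier VS" if "a \<in> K" "x \<in> carrier VS" for a x using V.rsmult_closed that by auto
  show "dep u v w \<longleftrightarrow> dep v u w" unfolding dep_def
    using V.V.a_lcomm[OF c c c] assms by (metis (no_types, lifting) DiffD1)
  show "dep u v w \<longleftrightarrow> dep u w v" unfolding dep_def
    using V.V.a_comm[OF c c] assms by (metis (no_types, lifting) DiffD1)
qed

end

section \<open>Linear algebra over skew fields\<close>

context skew_field
begin

lemma unit_inv: "a \<in> carrier F \<Longrightarrow> a \<noteq> \<zero> \<Longrightarrow> inv a \<in> carrier F \<and> a \<otimes> inv a = \<one> \<and> inv a \<otimes> a = \<one> \<and> inv a \<noteq> \<zero>"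
  using skew_field_Units Units_inv_closed[of a] Units_r_inv[of a] Units_l_inv[of a] one_neq_zero by auto

lemma neg_one: "\<ominus> \<one> \<in> carrier F" "\<ominus> \<one> \<oplus> \<one> = \<zero>" "\<ominus> \<one> \<noteq> \<zero>"
proof -
  show "\<ominus> \<one> \<in> carrier F" "\<ominus> \<one> \<oplus> \<one> = \<zero>" by (auto simp: l_neg)
  then show "\<ominus> \<one> \<noteq> \<zero>" using one_neq_zero by auto
qed

end

context right_vector_space
begin

lemma smult_zero: "x \<in> carrier V \<Longrightarrow> \<zero> \<odot>\<^bsub>V\<^esub> x = \<zero>\<^bsub>V\<^esub>"
  using rsmult_distr_scalar[of \<zero> \<zero> x] rsmult_closed[of \<zero> x]
    V.a_left_cancel[of "\<zero> \<odot>\<^bsub>V\<^esub> x" "\<zero> \<odot>\<^bsub>V\<^esub> x" "\<zero>\<^bsub>V\<^esub>"] by auto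

lemma smult_vzero: "a \<in> carrier F \<Longrightarrow> a \<odot>\<^bsub>V\<^esub> \<zero>\<^bsub>V\<^esub> = \<zero>\<^bsub>V\<^esub>"
  using rsmult_distr_vector[of a "\<zero>\<^bsub>V\<^esub>" "\<zero>\<^bsub>V\<^esub>"] rsmult_closed[of a "\<zero>\<^bsub>V\<^esub>"]
    V.a_left_cancel[of "a \<odot>\<^bsub>V\<^esub> \<zero>\<^bsub>V\<^esub>" "a \<odot>\<^bsub>V\<^esub> \<zero>\<^bsub>V\<^esub>" "\<zero>\<^bsub>V\<^esub>"] by auto

lemma smult_minus_one: "x \<in> carrier V \<Longrightarrow> (\<ominus> \<one>) \<odot>\<^bsub>V\<^esub> x = \<ominus>\<^bsub>V\<^esub> x"
  using rsmult_distr_scalar[of "\<ominus> \<one>" \<one> x] smult_zero[of x] rsmult_one[of x] rsmult_closed[of "\<ominus> \<one>" x]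
    V.minus_equality[of "(\<ominus> \<one>) \<odot>\<^bsub>V\<^esub> x" x] by (auto simp: neg_one)

lemma smult_inv:
  assumes "a \<in> carrier F" "a \<noteq> \<zero>" "x \<in> carrier V"
  shows "inv a \<odot>\<^bsub>V\<^esub> (a \<odot>\<^bsub>V\<^esub> x) = x" "a \<odot>\<^bsub>V\<^esub> (inv a \<odot>\<^bsub>V\<^esub> x) = x"
  using rsmult_assoc[of a "inv a" x] rsmult_assoc[of "inv a" a x] unit_inv[OF assms(1,2)] assms rsmult_one by auto

inductive_set span :: "'v set \<Rightarrow> 'v set" for X where
  span_zero: "\<zero>\<^bsub>V\<^esub> \<in> span X"
| span_step: "u \<in> span X \<Longrightarrow> x \<in> X \<Longrightarrow> x \<in> carrier V \<Longrightarrow> a \<in> carrier F \<Longrightarrow> u \<oplus>\<^bsub>V\<^esub> a \<odot>\<^bsub>V\<^esub> x \<in> span X"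

lemma span_carrier: "u \<in> span X \<Longrightarrow> u \<in> carrier V"
  by (induction rule: span.induct) (auto intro: rsmult_closed)

lemma span_base: "x \<in> X \<Longrightarrow> x \<in> carrier V \<Longrightarrow> x \<in> span X"
  using span_step[OF span_zero, of x X \<one>] rsmult_one[of x] by auto

lemma span_add:
  assumes "u \<in> span X" "v \<in> span X" shows "u \<oplus>\<^bsub>V\<^esub> v \<in> span X"
  using assms(2,1)
proof (induction v rule: span.induct)
  case (span_step v x a)
  then have "u \<oplus>\<^bsub>V\<^esub> (v \<oplus>\<^bsub>V\<^esub> a \<odot>\<^bsub>V\<^esub> x) = (u \<oplus>\<^bsub>V\<^esub> v) \<oplus>\<^bsub>V\<^esub> a \<odot>\<^bsub>V\<^esub> x"
    using span_carrier[of u X] span_carrier[of v X] rsmult_closed[of a x] V.a_assoc by auto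
  then show ?case using span_step span.span_step[of "u \<oplus>\<^bsub>V\<^esub> v" X x a] by auto
qed (use span_carrier in auto)

lemma span_smult: "u \<in> span X \<Longrightarrow> b \<in> carrier F \<Longrightarrow> b \<odot>\<^bsub>V\<^esub> u \<in> span X"
proof (induction u rule: span.induct)
  case span_zero
  then show ?case using smult_vzero span.span_zero by auto
next
  case (span_step u x a)
  then have "b \<odot>\<^bsub>V\<^esub> (u \<oplus>\<^bsub>V\<^esub> a \<odot>\<^bsub>V\<^esub> x) = b \<odot>\<^bsub>V\<^esub> u \<oplus>\<^bsub>V\<^esub> (a \<otimes> b) \<odot>\<^bsub>V\<^esub> x"
    using span_carrier[of u X] rsmult_closed[of a x] rsmult_distr_vector rsmult_assoc by auto
  then show ?case using span_step span.span_step[of "b \<odot>\<^bsub>V\<^esub> u" X x "a \<otimes> b"] by auto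
qed

lemma span_minus: "u \<in> span X \<Longrightarrow> \<ominus>\<^bsub>V\<^esub> u \<in> span X"
  using span_smult[of u X "\<ominus> \<one>"] smult_minus_one[of u] span_carrier[of u X] by auto

lemma span_subset: "X \<subseteq> span Y \<Longrightarrow> span X \<subseteq> span Y"
proof
  fix u assume "u \<in> span X" "X \<subseteq> span Y"
  then show "u \<in> span Y"
    by (induction u rule: span.induct) (auto intro: span.span_zero span_add span_smult)
qed

lemma span_mono: "X \<subseteq> Y \<Longrightarrow> span X \<subseteq> span Y"
proof
  fix u assume "u \<in> span X" "X \<subseteq> Y"
  then show "u \<in> span Y"
    by (induction u rule: span.induct) (auto intro: span.span_zero span.span_step)
qed

lemma span_cancel:
  assumes "u \<in> span X" "u \<oplus>\<^bsub>V\<^esub> v \<in> span X" "v \<in> carrier V"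
  shows "v \<in> span X"
proof -
  have "\<ominus>\<^bsub>V\<^esub> u \<oplus>\<^bsub>V\<^esub> (u \<oplus>\<^bsub>V\<^esub> v) = v"
    using assms span_carrier[of u X] by (simp add: V.a_assoc[symmetric] V.l_neg)
  then show ?thesis using span_add[OF span_minus[OF assms(1)] assms(2)] by simp
qed

lemma span_smult_cancel:
  assumes "a \<odot>\<^bsub>V\<^esub> x \<in> span X" "a \<in> carrier F" "a \<noteq> \<zero>" "x \<in> carrier V"
  shows "x \<in> span X"
  using span_smult[OF assms(1), of "inv a"] smult_inv assms unit_inv by auto

lemma span_Un: "w \<in> span (X \<union> Y) \<Longrightarrow> \<exists>u\<in>span X. \<exists>v\<in>span Y. w = u \<oplus>\<^bsub>V\<^esub> v"
proof (induction w rule: span.induct)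
  case span_zero
  then show ?case using span.span_zero by (intro bexI[of _ "\<zero>\<^bsub>V\<^esub>"]) auto
next
  case (span_step w x a)
  then obtain u v where uv: "u \<in> span X" "v \<in> span Y" "w = u \<oplus>\<^bsub>V\<^esub> v" by auto
  have c: "u \<in> carrier V" "v \<in> carrier V" "a \<odot>\<^bsub>V\<^esub> x \<in> carrier V" using uv span_carrier span_step rsmult_closed by auto
  show ?case
  proof (cases "x \<in> X")
    case True
    then have "u \<oplus>\<^bsub>V\<^esub> a \<odot>\<^bsub>V\<^esub> x \<in> span X" using uv span_step span.span_step by auto
    moreover have "w \<oplus>\<^bsub>V\<^esub> a \<odot>\<^bsub>V\<^esub> x = (u \<oplus>\<^bsub>V\<^esub> a \<odot>\<^bsub>V\<^esub> x) \<oplus>\<^bsub>V\<^esub> v" using uv c by (simp add: V.a_ac)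
    ultimately show ?thesis using uv by blast
  next
    case False
    then have "v \<oplus>\<^bsub>V\<^esub> a \<odot>\<^bsub>V\<^esub> x \<in> span Y" using uv span_step span.span_step by auto
    moreover have "w \<oplus>\<^bsub>V\<^esub> a \<odot>\<^bsub>V\<^esub> x = u \<oplus>\<^bsub>V\<^esub> (v \<oplus>\<^bsub>V\<^esub> a \<odot>\<^bsub>V\<^esub> x)" using uv c by (simp add: V.a_assoc)
    ultimately show ?thesis using uv by blast
  qed
qed

lemma span_singleton: "w \<in> span {x} \<Longrightarrow> x \<in> carrier V \<Longrightarrow> \<exists>a\<in>carrier F. w = a \<odot>\<^bsub>V\<^esub> x"
proof (induction w rule: span.induct)
  case span_zero
  then show ?case using smult_zero by (intro bexI[of _ \<zero>]) auto
next
  case (span_step w y a)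
  then obtain b where "b \<in> carrier F" "w = b \<odot>\<^bsub>V\<^esub> x" by auto
  then show ?case using span_step rsmult_distr_scalar by (intro bexI[of _ "b \<oplus> a"]) auto
qed

lemma span_insert: "w \<in> span (insert x X) \<Longrightarrow> x \<in> carrier V \<Longrightarrow> \<exists>a\<in>carrier F. \<exists>u\<in>span X. w = a \<odot>\<^bsub>V\<^esub> x \<oplus>\<^bsub>V\<^esub> u"
  using span_Un[of w "{x}" X] span_singleton by fastforce

sublocale exchange_closure "carrier V" span
proof
  fix X x y assume a: "X \<subseteq> carrier V" "x \<in> carrier V" "y \<in> carrier V" "x \<notin> span X" "x \<in> span (insert y X)"
  then obtain b u where b: "b \<in> carrier F" "u \<in> span X" "x = b \<odot>\<^bsub>V\<^esub> y \<oplus>\<^bsub>V\<^esub> u" using span_insert by blast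
  have c: "u \<in> carrier V" "b \<odot>\<^bsub>V\<^esub> y \<in> carrier V" using b span_carrier rsmult_closed a by auto
  have "b \<noteq> \<zero>" using a b c smult_zero by auto
  have m: "span X \<subseteq> span (insert x X)" by (rule span_mono) auto
  have "x \<in> span (insert x X)" using span_base a by auto
  then have "b \<odot>\<^bsub>V\<^esub> y \<in> span (insert x X)"
    using span_cancel[of u "insert x X" "b \<odot>\<^bsub>V\<^esub> y"] b c m V.a_comm by auto
  then show "y \<in> span (insert x X)" using span_smult_cancel b \<open>b \<noteq> \<zero>\<close> a by auto
next
  fix X assume a: "X \<subseteq> carrier V"
  show "span (span X) = span X" using span_subset[of "span X" X] span_carrier span_base by auto
qed (use span_carrier span_base span_mono in auto)

lemma span_family:
  assumes "finite X" "v \<in> X \<rightarrow> carrier V"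
  shows "w \<in> span (v ` X) \<longleftrightarrow> (\<exists>c\<in>X \<rightarrow> carrier F. w = (\<Oplus>\<^bsub>V\<^esub>x\<in>X. c x \<odot>\<^bsub>V\<^esub> v x))"
  using assms
proof (induction X arbitrary: w rule: finite_induct)
  case empty
  show ?case
  proof
    assume "w \<in> span (v ` {})"
    then have "w = \<zero>\<^bsub>V\<^esub>" by (induction w rule: span.induct) auto
    then show "\<exists>c\<in>{} \<rightarrow> carrier F. w = (\<Oplus>\<^bsub>V\<^esub>x\<in>{}. c x \<odot>\<^bsub>V\<^esub> v x)" by auto
  qed (auto intro: span_zero)
next
  case (insert x X)
  have vx: "v x \<in> carrier V" "v \<in> X \<rightarrow> carrier V" using insert by auto
  have fs: "(\<Oplus>\<^bsub>V\<^esub>y\<in>insert x X. c y \<odot>\<^bsub>V\<^esub> v y) = c x \<odot>\<^bsub>V\<^esub> v x \<oplus>\<^bsub>V\<^esub> (\<Oplus>\<^bsub>V\<^esub>y\<in>X. c y \<odot>\<^bsub>V\<^esub> v y)"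
    if "c \<in> insert x X \<rightarrow> carrier F" for c
    by (rule V.finsum_insert) (use that insert.hyps vx in \<open>auto intro!: rsmult_closed\<close>)
  show ?case
  proof
    assume "w \<in> span (v ` insert x X)"
    then obtain a u where a: "a \<in> carrier F" "u \<in> span (v ` X)" "w = a \<odot>\<^bsub>V\<^esub> v x \<oplus>\<^bsub>V\<^esub> u" using span_insert[of w "v x" "v ` X"] vx by auto
    then obtain c where c: "c \<in> X \<rightarrow> carrier F" "u = (\<Oplus>\<^bsub>V\<^esub>x\<in>X. c x \<odot>\<^bsub>V\<^esub> v x)" using insert.IH[OF vx(2)] by blast
    define c' where "c' = c(x := a)"
    have c': "c' \<in> insert x X \<rightarrow> carrier F" using c a by (auto simp: c'_def)
    have "(\<Oplus>\<^bsub>V\<^esub>y\<in>X. c' y \<odot>\<^bsub>V\<^esub> v y) = u" unfolding c(2)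
      by (rule V.finsum_cong') (use insert.hyps c vx in \<open>auto simp: c'_def intro!: rsmult_closed\<close>)
    then have "w = (\<Oplus>\<^bsub>V\<^esub>y\<in>insert x X. c' y \<odot>\<^bsub>V\<^esub> v y)" using fs[OF c'] a by (simp add: c'_def)
    then show "\<exists>c\<in>insert x X \<rightarrow> carrier F. w = (\<Oplus>\<^bsub>V\<^esub>x\<in>insert x X. c x \<odot>\<^bsub>V\<^esub> v x)" using c' by blast
  next
    assume "\<exists>c\<in>insert x X \<rightarrow> carrier F. w = (\<Oplus>\<^bsub>V\<^esub>x\<in>insert x X. c x \<odot>\<^bsub>V\<^esub> v x)"
    then obtain c where c: "c \<in> insert x X \<rightarrow> carrier F" "w = c x \<odot>\<^bsub>V\<^esub> v x \<oplus>\<^bsub>V\<^esub> (\<Oplus>\<^bsub>V\<^esub>y\<in>X. c y \<odot>\<^bsub>V\<^esub> v y)" using fs by auto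
    have "(\<Oplus>\<^bsub>V\<^esub>y\<in>X. c y \<odot>\<^bsub>V\<^esub> v y) \<in> span (v ` X)" unfolding insert.IH[OF vx(2)] using c(1) by blast
    moreover have "span (v ` X) \<subseteq> span (v ` insert x X)" by (rule span_mono) auto
    moreover have "v x \<in> span (v ` insert x X)" using span_base vx by auto
    ultimately show "w \<in> span (v ` insert x X)" unfolding c(2) using c(1) by (intro span_add span_smult) auto
  qed
qed

end

lemma lin_indep_insert:
  fixes F :: "'f ring" and V :: "('f, 'v) module"
  assumes "right_vector_space F V" and X: "finite X" "x \<notin> X" and v: "v \<in> insert x X \<rightarrow> carrier V"
  shows "lin_indep_family F V v (insert x X) \<longleftrightarrow>
    lin_indep_family F V v X \<and> v x \<notin> right_vector_space.span F V (v ` X)"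
proof -
  interpret right_vector_space F V by fact
  have vx: "v x \<in> carrier V" "v \<in> X \<rightarrow> carrier V" using v by auto
  have fs: "(\<Oplus>\<^bsub>V\<^esub>y\<in>insert x X. c y \<odot>\<^bsub>V\<^esub> v y) = c x \<odot>\<^bsub>V\<^esub> v x \<oplus>\<^bsub>V\<^esub> (\<Oplus>\<^bsub>V\<^esub>y\<in>X. c y \<odot>\<^bsub>V\<^esub> v y)"
    if "c \<in> insert x X \<rightarrow> carrier F" for c
    by (rule V.finsum_insert) (use that X vx in \<open>auto intro!: rsmult_closed\<close>)
  have upd: "(\<Oplus>\<^bsub>V\<^esub>y\<in>insert x X. (c(x := a)) y \<odot>\<^bsub>V\<^esub> v y) = a \<odot>\<^bsub>V\<^esub> v x \<oplus>\<^bsub>V\<^esub> (\<Oplus>\<^bsub>V\<^esub>y\<in>X. c y \<odot>\<^bsub>V\<^esub> v y)"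
    if "c \<in> X \<rightarrow> carrier F" "a \<in> carrier F" for c a
  proof -
    have "(\<Oplus>\<^bsub>V\<^esub>y\<in>X. (c(x := a)) y \<odot>\<^bsub>V\<^esub> v y) = (\<Oplus>\<^bsub>V\<^esub>y\<in>X. c y \<odot>\<^bsub>V\<^esub> v y)"
      by (rule V.finsum_cong') (use X that vx in \<open>auto intro!: rsmult_closed\<close>)
    then show ?thesis using fs[of "c(x := a)"] that by (auto simp: Pi_def)
  qed
  have cl: "(\<Oplus>\<^bsub>V\<^esub>y\<in>X. c y \<odot>\<^bsub>V\<^esub> v y) \<in> carrier V" if "c \<in> X \<rightarrow> carrier F" for c
    using that vx by (intro V.finsum_closed) (auto intro!: rsmult_closed)
  show ?thesis
  proof
    assume L: "lin_indep_family F V v (insert x X)"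
    have "lin_indep_family F V v X" unfolding lin_indep_family_def
    proof (intro ballI impI)
      fix c y assume c: "c \<in> X \<rightarrow> carrier F" "(\<Oplus>\<^bsub>V\<^esub>x\<in>X. c x \<odot>\<^bsub>V\<^esub> v x) = \<zero>\<^bsub>V\<^esub>" "y \<in> X"
      have "(\<Oplus>\<^bsub>V\<^esub>y\<in>insert x X. (c(x := \<zero>\<^bsub>F\<^esub>)) y \<odot>\<^bsub>V\<^esub> v y) = \<zero>\<^bsub>V\<^esub>" using upd[OF c(1), of "\<zero>\<^bsub>F\<^esub>"] c smult_zero vx by auto
      moreover have "c(x := \<zero>\<^bsub>F\<^esub>) \<in> insert x X \<rightarrow> carrier F" using c by auto
      ultimately have "\<forall>y\<in>insert x X. (c(x := \<zero>\<^bsub>F\<^esub>)) y = \<zero>\<^bsub>F\<^esub>" using L unfolding lin_indep_family_def by blast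
      then show "c y = \<zero>\<^bsub>F\<^esub>" using c X by (metis fun_upd_apply insertCI)
    qed
    moreover have "v x \<notin> span (v ` X)"
    proof
      assume "v x \<in> span (v ` X)"
      then obtain c where c: "c \<in> X \<rightarrow> carrier F" "v x = (\<Oplus>\<^bsub>V\<^esub>x\<in>X. c x \<odot>\<^bsub>V\<^esub> v x)" using span_family X vx by blast
      have "(\<Oplus>\<^bsub>V\<^esub>y\<in>insert x X. (c(x := \<ominus>\<^bsub>F\<^esub> \<one>\<^bsub>F\<^esub>)) y \<odot>\<^bsub>V\<^esub> v y) = \<ominus>\<^bsub>V\<^esub> v x \<oplus>\<^bsub>V\<^esub> v x"
        using upd[OF c(1), of "\<ominus>\<^bsub>F\<^esub> \<one>\<^bsub>F\<^esub>"] c(2) smult_minus_one[OF vx(1)] by simp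
      also have "\<dots> = \<zero>\<^bsub>V\<^esub>" using vx by (simp add: V.l_neg)
      finally have "(\<Oplus>\<^bsub>V\<^esub>y\<in>insert x X. (c(x := \<ominus>\<^bsub>F\<^esub> \<one>\<^bsub>F\<^esub>)) y \<odot>\<^bsub>V\<^esub> v y) = \<zero>\<^bsub>V\<^esub>" .
      moreover have "c(x := \<ominus>\<^bsub>F\<^esub> \<one>\<^bsub>F\<^esub>) \<in> insert x X \<rightarrow> carrier F" using c(1) neg_one by auto
      ultimately have "\<forall>y\<in>insert x X. (c(x := \<ominus>\<^bsub>F\<^esub> \<one>\<^bsub>F\<^esub>)) y = \<zero>\<^bsub>F\<^esub>"
        using L unfolding lin_indep_family_def by blast
      then have "\<ominus>\<^bsub>F\<^esub> \<one>\<^bsub>F\<^esub> = \<zero>\<^bsub>F\<^esub>" by auto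
      then show False using neg_one by auto
    qed
    ultimately show "lin_indep_family F V v X \<and> v x \<notin> span (v ` X)" by auto
  next
    assume R: "lin_indep_family F V v X \<and> v x \<notin> span (v ` X)"
    show "lin_indep_family F V v (insert x X)" unfolding lin_indep_family_def
    proof (intro ballI impI)
      fix c y assume c: "c \<in> insert x X \<rightarrow> carrier F" "(\<Oplus>\<^bsub>V\<^esub>x\<in>insert x X. c x \<odot>\<^bsub>V\<^esub> v x) = \<zero>\<^bsub>V\<^esub>" "y \<in> insert x X"
      let ?s = "\<Oplus>\<^bsub>V\<^esub>x\<in>X. c x \<odot>\<^bsub>V\<^esub> v x"
      have cX: "c \<in> X \<rightarrow> carrier F" "c x \<in> carrier F" using c by auto
      have s: "?s \<in> span (v ` X)" using span_family[OF X(1) vx(2)] cX by auto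
      have eq: "c x \<odot>\<^bsub>V\<^esub> v x \<oplus>\<^bsub>V\<^esub> ?s = \<zero>\<^bsub>V\<^esub>" using fs c by auto
      have "c x = \<zero>\<^bsub>F\<^esub>"
      proof (rule ccontr)
        assume n: "c x \<noteq> \<zero>\<^bsub>F\<^esub>"
        have "?s \<oplus>\<^bsub>V\<^esub> c x \<odot>\<^bsub>V\<^esub> v x = \<zero>\<^bsub>V\<^esub>" using eq cl[OF cX(1)] rsmult_closed[OF cX(2) vx(1)] by (simp add: V.a_comm)
        then have "c x \<odot>\<^bsub>V\<^esub> v x \<in> span (v ` X)" using span_cancel[OF s] rsmult_closed[OF cX(2) vx(1)] span_zero by simp
        then show False using span_smult_cancel[OF _ cX(2) n vx(1)] R by auto
      qed
      moreover have "\<forall>z\<in>X. c z = \<zero>\<^bsub>F\<^esub>"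
        using eq calculation smult_zero[OF vx(1)] cl[OF cX(1)] R cX unfolding lin_indep_family_def by simp
      ultimately show "c y = \<zero>\<^bsub>F\<^esub>" using c by auto
    qed
  qed
qed

text \<open>Repeated vectors are covered: the image then has fewer than \<open>card X\<close>
  elements, which bounds its rank, and the family is dependent.\<close>

lemma lin_indep_iff_rk:
  fixes F :: "'f ring" and V :: "('f, 'v) module"
  assumes "right_vector_space F V" and X: "finite X" and v: "v \<in> X \<rightarrow> carrier V"
  shows "lin_indep_family F V v X \<longleftrightarrow> exchange_closure.rk (carrier V) (right_vector_space.span F V) (v ` X) = card X"
proof -
  interpret right_vector_space F V by fact
  show ?thesis using X v
  proof (induction X rule: finite_induct)
    case empty
    then show ?case by (simp add: lin_indep_family_def rk_empty)
  next
    case (insert x X)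
    have s: "v ` X \<subseteq> carrier V" "v x \<in> carrier V" using insert by auto
    have "rk (v ` X) \<le> card X" using le_card[of "v ` X"] card_image_le[of X v] insert s by auto
    then show ?case
      using lin_indep_insert[OF assms(1) insert(1,2,4)] insert rk_insert[of "v ` X" "v x"] s by auto
  qed
qed

section \<open>Representable matroids are fully modular extendable\<close>

lemma rank_fun_cong:
  assumes "\<And>X. X \<subseteq> S \<Longrightarrow> r X = r' X" shows "rank_fun S r = rank_fun S r'"
proof -
  have "rank_fun S r'" if "rank_fun S r" "\<And>X. X \<subseteq> S \<Longrightarrow> r X = r' X" for r r' :: "'a set \<Rightarrow> nat"
  proof -
    interpret rank_fun S r by fact
    show ?thesis
    proof
      fix X assume "finite X" "X \<subseteq> S"
      then show "r' X \<le> card X" using le_card that(2)[of X] by metis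
    next
      fix X Y assume "finite Y" "X \<subseteq> Y" "Y \<subseteq> S"
      then show "r' X \<le> r' Y" using mono[of Y X] that(2)[of X] that(2)[of Y] by simp
    next
      fix X Y assume "finite X" "finite Y" "X \<subseteq> S" "Y \<subseteq> S"
      then show "r' (X \<union> Y) + r' (X \<inter> Y) \<le> r' X + r' Y"
        using submodular[of X Y] that(2)[of X] that(2)[of Y] that(2)[of "X \<union> Y"] that(2)[of "X \<inter> Y"]
        by (simp add: le_infI1)
    qed
  qed
  from this[of r r'] this[of r' r] show ?thesis using assms by metis
qed

section \<open>Modularity of spans\<close>

context right_vector_space
begin

lemma rk_Un_span:
  assumes "finite X" "X \<subseteq> carrier V" "finite Z" "Z \<subseteq> span X"
  shows "rk (X \<union> Z) = rk X"
proof (rule rank_union_spanned)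
  fix z assume "z \<in> Z"
  then show "spanned X z" using spanned_iff[OF assms(1,2)] span_carrier[of z X] assms by auto
qed (use assms span_carrier in auto)

text \<open>A largest finite independent subset of the intersection works; sizes are bounded by
  \<open>rk A\<close>, and a vector outside its span could be added.\<close>

lemma span_Int_basis:
  assumes A: "finite A" "A \<subseteq> carrier V"
  shows "\<exists>Z. finite Z \<and> Z \<subseteq> span A \<inter> span B \<and> rk Z = card Z \<and> span A \<inter> span B \<subseteq> span Z"
proof -
  let ?W = "span A \<inter> span B"
  let ?P = "\<lambda>Z. finite Z \<and> Z \<subseteq> ?W \<and> rk Z = card Z"
  have c: "Z \<subseteq> carrier V" if "?P Z" for Z using that span_carrier by auto
  have b: "card Z \<le> rk A" if "?P Z" for Z
  proof -
    have "rk Z \<le> rk (A \<union> Z)" using mono[of "A \<union> Z" Z] that c[OF that] A by auto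
    also have "\<dots> = rk A" using that A by (intro rk_Un_span) auto
    finally show ?thesis using that by simp
  qed
  have P0: "?P {}" using rk_empty by auto
  have "\<forall>Z. ?P Z \<longrightarrow> card Z < rk A + 1" using b by fastforce
  from ex_has_greatest_nat[of ?P "{}" card "rk A + 1", OF P0 this]
  obtain Z where "?P Z \<and> (\<forall>Z'. ?P Z' \<longrightarrow> card Z' \<le> card Z)" by (rule exE)
  then have Z: "?P Z" and max: "\<forall>Z'. ?P Z' \<longrightarrow> card Z' \<le> card Z" by simp_all
  have "w \<in> span Z" if w: "w \<in> ?W" for w
  proof (rule ccontr)
    assume n: "w \<notin> span Z"
    then have "w \<notin> Z" using span_base c[OF Z] by auto
    moreover have "rk (insert w Z) = rk Z + 1" using rk_insert[of Z w] Z c[OF Z] n w span_carrier by auto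
    ultimately have "?P (insert w Z)" using Z w by auto
    then have "card (insert w Z) \<le> card Z" using max by blast
    then show False using Z \<open>w \<notin> Z\<close> by auto
  qed
  then show ?thesis using Z by blast
qed

text \<open>The dimension formula. Extend \<open>Z\<close> to a basis \<open>J\<close> of
  \<open>A \<union> Z\<close>; the elements of \<open>J - Z\<close> stay independent over
  \<open>B\<close>, which gives one inequality. The other is submodularity, since the closures of
  \<open>A\<close> and \<open>B\<close> both contain \<open>Z\<close>.\<close>

lemma rk_modular:
  assumes A: "finite A" "A \<subseteq> carrier V" and B: "finite B" "B \<subseteq> carrier V"
    and Z: "finite Z" "Z \<subseteq> span A \<inter> span B" "rk Z = card Z" "span A \<inter> span B \<subseteq> span Z"
  shows "rk (A \<union> Z) = rk A" "rk (B \<union> Z) = rk B" "rk (A \<union> B) + rk Z = rk A + rk B"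
proof -
  have Zc: "Z \<subseteq> carrier V" using Z span_carrier by auto
  show 1: "rk (A \<union> Z) = rk A" by (rule rk_Un_span) (use A Z in auto)
  show 2: "rk (B \<union> Z) = rk B" by (rule rk_Un_span) (use B Z in auto)
  obtain J where J: "Z \<subseteq> J" "J \<subseteq> A \<union> Z" "rk J = card J" "rk J = rk (A \<union> Z)"
    using basis_extend[of "A \<union> Z" Z] A Z Zc by auto
  have fJ: "finite J" "J \<subseteq> carrier V" using J A Z Zc finite_subset[of J "A \<union> Z"] by auto
  have JA: "span J \<subseteq> span A"
  proof (rule span_subset, rule subsetI)
    fix x assume "x \<in> J"
    then show "x \<in> span A" using J Z span_base[of x A] A by blast
  qed
  have D: "rk (B \<union> D) = rk B + card D" if "finite D" "D \<subseteq> J - Z" for D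
    using that
  proof (induction D rule: finite_induct)
    case (insert a D)
    have ac: "a \<in> carrier V" "D \<subseteq> carrier V" using insert fJ by auto
    \<comment> \<open>Otherwise \<open>a = w + u\<close> with \<open>w\<close> in the span of
      \<open>B\<close> and \<open>u\<close> in that of \<open>D\<close>. Then \<open>w\<close> is
      also in the span of \<open>A\<close>, hence in that of \<open>Z\<close>, and \<open>a\<close>
      would depend on the other elements of \<open>J\<close>.\<close>
    have "a \<notin> span (B \<union> D)"
    proof
      assume "a \<in> span (B \<union> D)"
      then obtain w u where wu: "w \<in> span B" "u \<in> span D" "a = w \<oplus>\<^bsub>V\<^esub> u" using span_Un by blast
      have c: "w \<in> carrier V" "u \<in> carrier V" using wu span_carrier by auto
      have "u \<in> span J" using wu span_mono[of D J] insert by auto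
      moreover have "u \<oplus>\<^bsub>V\<^esub> w \<in> span J" using span_base[of a J] insert ac wu c V.a_comm by auto
      ultimately have "w \<in> span A" using span_cancel c JA by blast
      then have "w \<in> span Z" using wu Z by auto
      then have "a \<in> span (Z \<union> D)" unfolding wu(3)
        using wu span_mono[of Z "Z \<union> D"] span_mono[of D "Z \<union> D"] by (intro span_add) auto
      moreover have "rk (insert a (Z \<union> D)) = card (insert a (Z \<union> D))"
        by (rule indep_subset[OF fJ J(3)]) (use insert J in auto)
      ultimately show False
        using indep_insert[of "Z \<union> D" a] spanned_iff[of "Z \<union> D" a] insert.hyps insert.prems Z(1) Zc ac by auto
    qed
    then show ?case using insert.IH insert.hyps insert.prems rk_insert[of "B \<union> D" a] B ac by auto
  qed simp
  have "rk (B \<union> (J - Z)) \<le> rk ((A \<union> B) \<union> Z)" by (rule mono) (use A B Z Zc J in auto)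
  also have "\<dots> = rk (A \<union> B)"
    by (rule rk_Un_span) (use A B Z span_mono[of A "A \<union> B"] in auto)
  finally have "rk B + card (J - Z) \<le> rk (A \<union> B)" using D[of "J - Z"] fJ by auto
  moreover have "card (J - Z) = card J - card Z" "card Z \<le> card J" using J(1) fJ Z(1) by (auto simp: card_Diff_subset card_mono)
  ultimately have ge: "rk A + rk B \<le> rk (A \<union> B) + rk Z" using J 1 Z by auto
  have "rk ((A \<union> Z) \<union> (B \<union> Z)) + rk ((A \<union> Z) \<inter> (B \<union> Z)) \<le> rk A + rk B"
    using submodular[of "A \<union> Z" "B \<union> Z"] A B Z Zc 1 2 by auto
  moreover have "rk (A \<union> B) \<le> rk ((A \<union> Z) \<union> (B \<union> Z))" by (rule mono) (use A B Z Zc in auto)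
  moreover have "rk Z \<le> rk ((A \<union> Z) \<inter> (B \<union> Z))" by (rule mono) (use A B Z Zc in auto)
  ultimately show "rk (A \<union> B) + rk Z = rk A + rk B" using ge by linarith
qed

lemma vectors_modular_extendable:
  fixes S :: "'a::infinite set"
  assumes "finite S" "w ` S \<subseteq> carrier V" "\<And>X. X \<subseteq> S \<Longrightarrow> r X = rk (w ` X)"
  shows "modular_extendable k S r"
  using assms
proof (induction k arbitrary: S w r)
  have m: "rank_matroid S r" if "finite S" "w ` S \<subseteq> carrier V" "\<And>X. X \<subseteq> S \<Longrightarrow> r X = rk (w ` X)"
    for S :: "'a set" and w r
    using pullback[OF that(2)] rank_fun_cong[of S r "\<lambda>X. rk (w ` X)"] that rank_matroid_iff_rank_fun by metis
  {
    case 0 then show ?case using m by simp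
  next
    case (Suc k)
    have "\<exists>S' r'. one_step_extension S r A B S' r' \<and> modular_extendable k S' r'" if AB: "A \<subseteq> S" "B \<subseteq> S" for A B
    proof -
      have f: "finite (w ` A)" "w ` A \<subseteq> carrier V" "finite (w ` B)" "w ` B \<subseteq> carrier V"
        using AB Suc.prems finite_subset by (auto intro: finite_subset)
      obtain Z where Z: "finite Z" "Z \<subseteq> span (w ` A) \<inter> span (w ` B)" "rk Z = card Z"
        "span (w ` A) \<inter> span (w ` B) \<subseteq> span Z"
        using span_Int_basis[OF f(1,2)] by blast
      note mod = rk_modular[OF f Z]
      \<comment> \<open>Fresh ground elements are taken even for vectors that already occur in the
        family; the infinite type provides \<open>card Z\<close> of them.\<close>
      have "infinite (- S)" using Suc.prems(1) infinite_UNIV by (metis Compl_eq_Diff_UNIV finite_Diff2)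
      then obtain N where N: "finite N" "card N = card Z" "N \<subseteq> - S" using infinite_arbitrarily_large by blast
      then obtain b where b: "bij_betw b N Z" using Z finite_same_card_bij by blast
      define w' where "w' = (\<lambda>x. if x \<in> N then b x else w x)"
      define r' where "r' = (\<lambda>X. rk (w' ` X))"
      have wS: "w' ` X = w ` X" if "X \<subseteq> S" for X using that N by (auto simp: w'_def intro!: image_cong)
      have wN: "w' ` N = Z" using b by (auto simp: w'_def bij_betw_def)
      have c: "w' ` (S \<union> N) \<subseteq> carrier V" using wS[of S] wN Suc.prems Z span_carrier by (auto simp: image_Un)
      have fS: "finite (S \<union> N)" using Suc.prems N by auto
      have "one_step_extension S r A B (S \<union> N) r'"
        unfolding one_step_extension_def
      proof (intro conjI allI impI exI[of _ N])
        show "rank_matroid (S \<union> N) r'" by (rule m[OF fS c]) (simp add: r'_def)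
        fix X assume "X \<subseteq> S" then show "r' X = r X" using wS Suc.prems by (simp add: r'_def)
      next
        show "r' (A \<union> N) = r A" "r' (B \<union> N) = r B"
          using mod(1,2) wS[OF AB(1)] wS[OF AB(2)] wN Suc.prems(3) AB by (simp_all add: r'_def image_Un)
        show "r' N = r A + r B - r (A \<union> B)"
          using mod(3) wN Suc.prems(3) AB by (simp add: r'_def image_Un)
      qed auto
      moreover have "modular_extendable k (S \<union> N) r'" by (rule Suc.IH[OF fS c]) (simp add: r'_def)
      ultimately show ?thesis by blast
    qed
    then show ?case using m[OF Suc.prems] by simp
  }
qed

end

lemma skew_representable_imp_extendable:
  fixes S :: "'a::infinite set"
  assumes S: "rank_matroid S r" and rep: "skew_representable TYPE('f::infinite) TYPE('v::infinite) S r"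
  shows "fully_modular_extendable S r"
proof -
  obtain F :: "'f ring" and V :: "('f, 'v) module" and v where R: "matroid_representation F V S r v"
    using rep unfolding skew_representable_def by blast
  interpret right_vector_space F V using R by (simp add: matroid_representation_def)
  have fS: "finite S" using S rank_matroid.finite_ground by blast
  have v: "v ` S \<subseteq> carrier V" using R by (auto simp: matroid_representation_def)
  have "r X = rk (v ` X)" if X: "X \<subseteq> S" for X
  proof (rule rank_fun_eqI[of S])
    show "rank_fun S r" using S fS rank_matroid_iff_rank_fun by blast
    show "rank_fun S (\<lambda>X. rk (v ` X))" by (rule pullback[OF v])
    fix Y assume Y: "finite Y" "Y \<subseteq> S"
    then show "(r Y = card Y) = (rk (v ` Y) = card Y)"
      using R lin_indep_iff_rk[OF right_vector_space_axioms Y(1), of v] v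
      by (auto simp: matroid_representation_def matroid_indep_def)
  qed (use X fS finite_subset in auto)
  then show ?thesis unfolding fully_modular_extendable_def using vectors_modular_extendable[OF fS v] by blast
qed

section \<open>Limits of modular extensions\<close>

text \<open>The pigeonhole principle, applied to one coordinate after the other, gives nested
  infinite index sets \<open>K j\<close>; any index in \<open>K N\<close> agrees with the limit on
  the first \<open>N\<close> coordinates.\<close>

lemma diagonal_limit:
  fixes f :: "nat \<Rightarrow> nat \<Rightarrow> nat"
  assumes "\<And>k j. f k j \<le> n"
  shows "\<exists>g. \<forall>N. \<exists>k\<ge>N. \<forall>j<N. f k j = g j"
proof -
  have "\<exists>K. \<forall>j. infinite (K j) \<and> (K (Suc j) \<subseteq> K j \<and> (\<exists>c. \<forall>k\<in>K (Suc j). f k j = c))"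
  proof (rule dependent_nat_choice)
    show "\<exists>K. infinite (K :: nat set)" using infinite_UNIV_nat by blast
    fix K :: "nat set" and j assume K: "infinite K"
    have "(\<lambda>k. f k j) ` K \<subseteq> {..n}" using assms by auto
    then have "finite ((\<lambda>k. f k j) ` K)" using finite_subset by blast
    from pigeonhole_infinite[OF K this] obtain a where "infinite {k \<in> K. f k j = f a j}" by blast
    then show "\<exists>K'. infinite K' \<and> K' \<subseteq> K \<and> (\<exists>c. \<forall>k\<in>K'. f k j = c)"
      by (intro exI[of _ "{k \<in> K. f k j = f a j}"]) auto
  qed
  then obtain K where K: "\<And>j. infinite (K j)" "\<And>j. K (Suc j) \<subseteq> K j" "\<And>j. \<exists>c. \<forall>k\<in>K (Suc j). f k j = c" by blast
  from K(3) obtain g where g: "\<And>j k. k \<in> K (Suc j) \<Longrightarrow> f k j = g j" by metis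
  have "\<exists>k\<ge>N. \<forall>j<N. f k j = g j" for N
  proof -
    obtain k where k: "k \<ge> N" "k \<in> K N" using K(1)[of N] unfolding infinite_nat_iff_unbounded_le by blast
    have "k \<in> K (Suc j)" if "j < N" for j
      using k(2) lift_Suc_antimono_le[of K "Suc j" N] K(2) that by (auto simp: Suc_le_eq)
    then show ?thesis using g k by blast
  qed
  then show ?thesis by blast
qed

text \<open>The condition on \<open>Z\<close> in a one-step extension, written without subtraction.
  It involves only finitely many values of \<open>r\<close>, so it survives the limit.\<close>

definition meets :: "('a set \<Rightarrow> nat) \<Rightarrow> 'a set \<Rightarrow> 'a set \<Rightarrow> 'a set \<Rightarrow> bool" where
  "meets r A B Z \<longleftrightarrow> r (A \<union> Z) = r A \<and> r (B \<union> Z) = r B \<and> r Z + r (A \<union> B) = r A + r B"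

text \<open>
  Pair number \<open>t\<close> of finite sets only contains labels below \<open>t\<close>, so it is available at stage \<open>t\<close> of the
  construction below, which adds \<open>r S\<close> labels per stage (some of them for old elements).
\<close>

definition task_fst :: "nat \<Rightarrow> nat set" where
  "task_fst t = set_decode (fst (prod_decode t))"

definition task_snd :: "nat \<Rightarrow> nat set" where
  "task_snd t = set_decode (snd (prod_decode t))"

lemma set_decode_less: "x \<in> set_decode k \<Longrightarrow> x < k"
proof -
  assume x: "x \<in> set_decode k"
  have "(2::nat) ^ x = set_encode {x}" by simp
  also have "\<dots> \<le> set_encode (set_decode k)" unfolding set_encode_def using x by (intro sum_mono2) auto
  also have "\<dots> = k" by simp
  finally show "x < k" using less_exp[of x] by linarith
qed

lemma task_less: "task_fst t \<subseteq> {..<t}" "task_snd t \<subseteq> {..<t}"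
proof -
  have "fst (prod_decode t) \<le> t" "snd (prod_decode t) \<le> t"
    using le_prod_encode_1[of "fst (prod_decode t)" "snd (prod_decode t)"]
      le_prod_encode_2[of "snd (prod_decode t)" "fst (prod_decode t)"] by auto
  then show "task_fst t \<subseteq> {..<t}" "task_snd t \<subseteq> {..<t}"
    unfolding task_fst_def task_snd_def using set_decode_less by fastforce+
qed

lemma task_ex: "finite A \<Longrightarrow> finite B \<Longrightarrow> \<exists>t. task_fst t = A \<and> task_snd t = B"
  by (intro exI[of _ "prod_encode (set_encode A, set_encode B)"]) (simp add: task_fst_def task_snd_def)

text \<open>The number of labels after \<open>t\<close> stages does not depend on the extensions
  chosen, which makes towers of different heights comparable. The rank bound concerns only the
  labelled elements, because an extension may contain others.\<close>

lemma extension_stage: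
  fixes S :: "'a::infinite set"
  assumes S: "rank_matroid S r" "0 < r S" and ext: "modular_extendable k S r"
    and h: "h ` {..<m} = S" and t: "t \<le> k"
  shows "\<exists>S' r' \<phi>. modular_extendable (k - t) S' r' \<and> S \<subseteq> S' \<and> (\<forall>X\<subseteq>S. r' X = r X) \<and> \<phi> ` {..<m + r S * t} \<subseteq> S' \<and>
    (\<forall>i<m. \<phi> i = h i) \<and> r' (\<phi> ` {..<m + r S * t}) \<le> r S \<and>
    (\<forall>s<t. \<exists>Z\<subseteq>{..<m + r S * Suc s}. meets (\<lambda>X. r' (\<phi> ` X)) (task_fst s) (task_snd s) Z)"
  using t
proof (induction t)
  case 0
  then show ?case using ext h by (intro exI[of _ S] exI[of _ r] exI[of _ h]) auto
next
  case (Suc t)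
  define G where "G = {..<m + r S * t}"
  define G' where "G' = {..<m + r S * Suc t}"
  from Suc obtain S1 r1 \<phi> where IH: "modular_extendable (k - t) S1 r1" "S \<subseteq> S1" "\<forall>X\<subseteq>S. r1 X = r X" "\<phi> ` G \<subseteq> S1"
    "\<forall>i<m. \<phi> i = h i" "r1 (\<phi> ` G) \<le> r S"
    "\<forall>s<t. \<exists>Z\<subseteq>{..<m + r S * Suc s}. meets (\<lambda>X. r1 (\<phi> ` X)) (task_fst s) (task_snd s) Z"
    unfolding G_def by force
  \<comment> \<open>A positive rank lets the supply of labels keep pace with the task
    numbers.\<close>
  have "t \<le> m + r S * t" using S(2) by (simp add: trans_le_add2)
  then have "{..<t} \<subseteq> G" unfolding G_def by auto
  then have tG: "task_fst t \<subseteq> G" "task_snd t \<subseteq> G" using task_less by blast+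
  define A B where "A = \<phi> ` task_fst t" and "B = \<phi> ` task_snd t"
  have AB: "A \<subseteq> S1" "B \<subseteq> S1" "A \<subseteq> \<phi> ` G" "B \<subseteq> \<phi> ` G" using tG IH(4) by (auto simp: A_def B_def)
  have "k - t = Suc (k - Suc t)" using Suc by simp
  then have "\<forall>A B. A \<subseteq> S1 \<longrightarrow> B \<subseteq> S1 \<longrightarrow> (\<exists>S' r'. one_step_extension S1 r1 A B S' r' \<and> modular_extendable (k - Suc t) S' r')"
    using IH(1) by simp
  then obtain S2 r2 where e: "one_step_extension S1 r1 A B S2 r2" and m2: "modular_extendable (k - Suc t) S2 r2"
    using AB by meson
  obtain Z where Z: "Z \<subseteq> S2" "r2 (A \<union> Z) = r1 A" "r2 (B \<union> Z) = r1 B" "r2 Z = r1 A + r1 B - r1 (A \<union> B)"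
    and S12: "S1 \<subseteq> S2" "\<And>X. X \<subseteq> S1 \<Longrightarrow> r2 X = r1 X" and mat: "rank_matroid S2 r2"
    using e unfolding one_step_extension_def by blast
  have f2: "finite S2" using mat rank_matroid.finite_ground by blast
  interpret R: rank_fun S2 r2 using mat rank_matroid_iff_rank_fun[OF f2] by simp
  have fin: "finite X" if "X \<subseteq> S2" for X using that f2 finite_subset by blast
  have sub: "A \<subseteq> S2" "B \<subseteq> S2" "\<phi> ` G \<subseteq> S2" using AB S12 IH(4) by auto
  \<comment> \<open>\<open>Z\<close> may be large; a basis of it meets the same task and has at most
    \<open>r S\<close> elements, the number of labels of one stage.\<close>
  obtain I where I: "I \<subseteq> Z" "r2 I = card I" "r2 I = r2 Z" using R.basis_ex[OF fin[OF Z(1)] Z(1)] by blast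
  have IS: "I \<subseteq> S2" using I Z by auto
  have AI: "r2 (A \<union> I) = r2 A"
  proof (rule antisym)
    have "r2 (A \<union> I) \<le> r2 (A \<union> Z)" by (rule R.mono) (use I Z sub fin in auto)
    then show "r2 (A \<union> I) \<le> r2 A" using Z S12 AB by simp
    show "r2 A \<le> r2 (A \<union> I)" by (rule R.mono) (use IS sub fin in auto)
  qed
  have BI: "r2 (B \<union> I) = r2 B"
  proof (rule antisym)
    have "r2 (B \<union> I) \<le> r2 (B \<union> Z)" by (rule R.mono) (use I Z sub fin in auto)
    then show "r2 (B \<union> I) \<le> r2 B" using Z S12 AB by simp
    show "r2 B \<le> r2 (B \<union> I)" by (rule R.mono) (use IS sub fin in auto)
  qed
  have "r2 (A \<union> B) + r2 (A \<inter> B) \<le> r2 A + r2 B" by (rule R.submodular) (use sub fin in auto)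
  moreover have "r2 Z = r2 A + r2 B - r2 (A \<union> B)" using Z(4) S12(2)[of A] S12(2)[of B] S12(2)[of "A \<union> B"] AB by simp
  ultimately have IZ: "r2 I + r2 (A \<union> B) = r2 A + r2 B" using I(3) by simp
  \<comment> \<open>The new labelled elements are in the span of \<open>A\<close>, which is labelled
    already, so the bound \<open>r S\<close> is inherited.\<close>
  have GI: "r2 (\<phi> ` G \<union> I) = r2 (\<phi> ` G)"
  proof (rule R.rank_union_spanned[OF fin[OF sub(3)] sub(3) fin[OF IS] IS])
    fix y assume y: "y \<in> I"
    have "r2 (insert y A) \<le> r2 (A \<union> I)" by (rule R.mono) (use y IS sub fin in auto)
    moreover have "r2 A \<le> r2 (insert y A)" by (rule R.mono) (use y IS sub fin in auto)
    ultimately have "R.spanned A y" using AI by (simp add: R.spanned_def)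
    then show "R.spanned (\<phi> ` G) y" by (rule R.spanned_mono[rotated -1]) (use y IS sub AB fin in auto)
  qed
  have "r2 I \<le> r2 (A \<union> I)" by (rule R.mono) (use IS sub fin in auto)
  also have "\<dots> \<le> r2 (\<phi> ` G)" unfolding AI by (rule R.mono) (use AB sub fin in auto)
  also have "\<dots> \<le> r S" using IH(6) S12(2) IH(4) by simp
  finally have cI: "card I \<le> r S" using I by simp
  obtain b where b: "bij_betw b {..<card I} I"
    using ex_bij_betw_nat_finite[OF fin[OF IS]] by (auto simp: atLeast0LessThan)
  have mpos: "0 < m" using h S rank_matroid_iff_rank_fun[of S r] rank_fun.rank_empty[of S r] rank_matroid.finite_ground[of S r]
    by (cases m) auto
  \<comment> \<open>Labels left over at this stage repeat the element \<open>\<phi> 0\<close>; label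
    \<open>0\<close> exists because a positive rank forces \<open>0 < m\<close>.\<close>
  define \<psi> where "\<psi> i = (if i \<in> G then \<phi> i else if i - (m + r S * t) < card I then b (i - (m + r S * t)) else \<phi> 0)" for i
  define Y where "Y = {m + r S * t..<m + r S * t + card I}"
  have \<psi>G: "\<psi> ` X = \<phi> ` X" if "X \<subseteq> G" for X using that by (auto simp: \<psi>_def intro!: image_cong)
  have "\<psi> ` Y = b ` {..<card I}"
  proof -
    have "Y = (\<lambda>j. m + r S * t + j) ` {..<card I}" unfolding Y_def using image_add_atLeastLessThan[of "m + r S * t" 0 "card I"]
      by (simp add: atLeast0LessThan add.commute)
    then have "\<psi> ` Y = (\<lambda>j. \<psi> (m + r S * t + j)) ` {..<card I}" by (simp add: image_image)
    also have "\<dots> = b ` {..<card I}" by (rule image_cong) (auto simp: \<psi>_def G_def)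
    finally show ?thesis .
  qed
  then have \<psi>Y: "\<psi> ` Y = I" using b by (simp add: bij_betw_def)
  have YG': "Y \<subseteq> G'" using cI by (auto simp: Y_def G'_def)
  have 0: "0 \<in> G" using mpos by (auto simp: G_def)
  have \<psi>G': "\<psi> ` G' \<subseteq> \<phi> ` G \<union> I"
  proof
    fix x assume "x \<in> \<psi> ` G'"
    then obtain i where i: "x = \<psi> i" by blast
    show "x \<in> \<phi> ` G \<union> I"
      using 0 b unfolding i \<psi>_def by (auto simp: bij_betw_def)
  qed
  have le: "r2 (\<psi> ` G') \<le> r S"
  proof -
    have "r2 (\<psi> ` G') \<le> r2 (\<phi> ` G \<union> I)" by (rule R.mono) (use \<psi>G' sub IS fin in auto)
    then show ?thesis using GI IH(6) S12(2) IH(4) by simp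
  qed
  have old: "meets (\<lambda>X. r2 (\<psi> ` X)) (task_fst s) (task_snd s) Z'"
    if Z': "Z' \<subseteq> {..<m + r S * Suc s}" "meets (\<lambda>X. r1 (\<phi> ` X)) (task_fst s) (task_snd s) Z'" "s < t" for s Z'
  proof -
    have "m + r S * Suc s \<le> m + r S * t" using that(3) by (intro add_left_mono mult_le_mono2) simp
    then have "Z' \<subseteq> G" using Z'(1) by (auto simp: G_def)
    moreover have "task_fst s \<subseteq> G" "task_snd s \<subseteq> G" using task_less[of s] \<open>{..<t} \<subseteq> G\<close> that(3) by fastforce+
    moreover have "r2 (\<psi> ` X) = r1 (\<phi> ` X)" if "X \<subseteq> G" for X
      using \<psi>G[OF that] S12(2)[of "\<phi> ` X"] IH(4) that by auto
    ultimately show ?thesis using Z'(2) by (simp add: meets_def)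
  qed
  have new: "meets (\<lambda>X. r2 (\<psi> ` X)) (task_fst t) (task_snd t) Y"
    using AI BI IZ \<psi>Y \<psi>G[OF tG(1)] \<psi>G[OF tG(2)] by (simp add: meets_def A_def B_def image_Un)
  have "\<forall>s<Suc t. \<exists>Z\<subseteq>{..<m + r S * Suc s}. meets (\<lambda>X. r2 (\<psi> ` X)) (task_fst s) (task_snd s) Z"
  proof (intro allI impI)
    fix s assume "s < Suc t"
    then consider "s < t" | "s = t" by linarith
    then show "\<exists>Z\<subseteq>{..<m + r S * Suc s}. meets (\<lambda>X. r2 (\<psi> ` X)) (task_fst s) (task_snd s) Z"
    proof cases
      case 1
      then show ?thesis using IH(7) old by blast
    next
      case 2
      then show ?thesis using new YG' unfolding G'_def by blast
    qed
  qed
  moreover have "\<psi> ` G' \<subseteq> S2" using \<psi>G' sub IS by blast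
  moreover have "\<forall>i<m. \<psi> i = h i" using IH(5) by (auto simp: \<psi>_def G_def)
  moreover have "\<forall>X\<subseteq>S. r2 X = r X" using IH(2,3) S12(2) by auto
  moreover have "S \<subseteq> S2" using IH(2) S12(1) by auto
  ultimately show ?case using m2 le unfolding G'_def by blast
qed

text \<open>Every property claimed for \<open>\<rho>\<close> concerns the subsets of some finite
  window \<open>{..<N}\<close>, and on each window the limit coincides with the rank function of an
  actual tower, which may be taken as high as desired.\<close>

lemma modular_limit:
  fixes S :: "'a::infinite set"
  assumes S: "rank_matroid S r" "0 < r S" and ext: "fully_modular_extendable S r"
    and h: "h ` {..<m} = S"
  shows "\<exists>\<rho> :: nat set \<Rightarrow> nat. rank_fun UNIV \<rho> \<and> (\<forall>X. finite X \<longrightarrow> \<rho> X \<le> r S) \<and> (\<forall>X\<subseteq>{..<m}. \<rho> X = r (h ` X)) \<and>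
    (\<forall>A B. finite A \<longrightarrow> finite B \<longrightarrow> (\<exists>Z. finite Z \<and> meets \<rho> A B Z))"
proof -
  define G where "G k = {..<m + r S * k}" for k
  define good where "good k \<rho> \<longleftrightarrow> rank_fun (G k) \<rho> \<and> (\<forall>X\<subseteq>G k. \<rho> X \<le> r S) \<and> (\<forall>X\<subseteq>{..<m}. \<rho> X = r (h ` X)) \<and>
    (\<forall>s<k. \<exists>Z\<subseteq>G (Suc s). meets \<rho> (task_fst s) (task_snd s) Z)" for k and \<rho> :: "nat set \<Rightarrow> nat"
  have "\<exists>\<rho>. good k \<rho>" for k
  proof -
    have "modular_extendable k S r" using ext S unfolding fully_modular_extendable_def
      by (cases "k = 0") (auto simp del: modular_extendable.simps(2))
    from extension_stage[OF S this h order_refl, folded G_def] obtain S' r' \<phi> where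
      "modular_extendable (k - k) S' r' \<and> S \<subseteq> S' \<and> (\<forall>X\<subseteq>S. r' X = r X) \<and> \<phi> ` G k \<subseteq> S' \<and>
        (\<forall>i<m. \<phi> i = h i) \<and> r' (\<phi> ` G k) \<le> r S \<and>
        (\<forall>s<k. \<exists>Z\<subseteq>G (Suc s). meets (\<lambda>X. r' (\<phi> ` X)) (task_fst s) (task_snd s) Z)"
      by (elim exE)
    then have 1: "rank_matroid S' r'" "S \<subseteq> S'" "\<forall>X\<subseteq>S. r' X = r X" "\<phi> ` G k \<subseteq> S'" "\<forall>i<m. \<phi> i = h i" "r' (\<phi> ` G k) \<le> r S"
      "\<forall>s<k. \<exists>Z\<subseteq>G (Suc s). meets (\<lambda>X. r' (\<phi> ` X)) (task_fst s) (task_snd s) Z"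
      by simp_all
    interpret R: rank_fun S' r' using 1(1) rank_matroid_iff_rank_fun rank_matroid.finite_ground by blast
    have "good k (\<lambda>X. r' (\<phi> ` X))" unfolding good_def
    proof (intro conjI allI impI)
      show "rank_fun (G k) (\<lambda>X. r' (\<phi> ` X))" by (rule R.pullback[OF 1(4)])
      fix X assume "X \<subseteq> G k"
      then have "r' (\<phi> ` X) \<le> r' (\<phi> ` G k)" by (intro R.mono) (use 1(4) in \<open>auto simp: G_def\<close>)
      then show "r' (\<phi> ` X) \<le> r S" using 1(6) by simp
    next
      fix X assume X: "X \<subseteq> {..<m}"
      then have "\<phi> ` X = h ` X" using 1(5) by (auto intro!: image_cong)
      moreover have "h ` X \<subseteq> S" using h X by auto
      ultimately show "r' (\<phi> ` X) = r (h ` X)" using 1(3) by simp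
    next
      fix s assume "s < k"
      then show "\<exists>Z\<subseteq>G (Suc s). meets (\<lambda>X. r' (\<phi> ` X)) (task_fst s) (task_snd s) Z" using 1(7) by blast
    qed
    then show ?thesis by blast
  qed
  then obtain \<rho>s where \<rho>s: "\<And>k. good k (\<rho>s k)" by metis
  \<comment> \<open>Finite sets are enumerated by their binary codes; the value 0 is a default for
    sets that contain labels not yet assigned in tower \<open>k\<close>.\<close>
  define f where "f k j = (if set_decode j \<subseteq> G k then \<rho>s k (set_decode j) else 0)" for k j
  have "f k j \<le> r S" for k j using \<rho>s[of k] by (auto simp: f_def good_def)
  from diagonal_limit[of f, OF this] obtain g where g: "\<And>N. \<exists>k\<ge>N. \<forall>j<N. f k j = g j" by blast
  define \<rho> where "\<rho> X = g (set_encode X)" for X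
  \<comment> \<open>All subsets of \<open>{..<N}\<close> have codes below \<open>2 ^ N\<close>, so
    agreement on the first \<open>2 ^ N\<close> coordinates covers the whole window.\<close>
  have lim: "\<exists>k\<ge>N. {..<N} \<subseteq> G k \<and> (\<forall>X\<subseteq>{..<N}. \<rho> X = \<rho>s k X)" for N
  proof -
    obtain k where k: "k \<ge> 2 ^ N" "\<forall>j<2 ^ N. f k j = g j" using g by blast
    have kN: "k \<ge> N" using k(1) less_exp[of N] by linarith
    have NG: "{..<N} \<subseteq> G k"
    proof -
      have "k \<le> m + r S * k" using S(2) by (simp add: trans_le_add2)
      then show ?thesis using kN unfolding G_def by auto
    qed
    have "\<rho> X = \<rho>s k X" if X: "X \<subseteq> {..<N}" for X
    proof -
      have fX: "finite X" using X finite_subset by blast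
      have "set_encode X \<le> set_encode {..<N}" unfolding set_encode_def using X by (intro sum_mono2) auto
      also have "\<dots> < 2 ^ N" unfolding set_encode_def by (induction N) auto
      finally have "f k (set_encode X) = \<rho> X" using k(2) by (simp add: \<rho>_def)
      moreover have "X \<subseteq> G k" using X NG by blast
      ultimately show ?thesis using fX by (simp add: f_def)
    qed
    then show ?thesis using kN NG by blast
  qed
  have bound: "\<exists>N. X \<subseteq> {..<N}" if "finite X" for X :: "nat set"
    using that finite_nat_iff_bounded by blast
  have "rank_fun UNIV \<rho>"
  proof
    fix X :: "nat set" assume X: "finite X"
    then obtain N where N: "X \<subseteq> {..<N}" using bound by blast
    then obtain k where k: "{..<N} \<subseteq> G k" "\<forall>X\<subseteq>{..<N}. \<rho> X = \<rho>s k X" using lim by blast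
    interpret R: rank_fun "G k" "\<rho>s k" using \<rho>s by (simp add: good_def)
    show "\<rho> X \<le> card X" using R.le_card[OF X] N k by auto
  next
    fix X Y :: "nat set" assume X: "finite Y" "X \<subseteq> Y"
    then obtain N where N: "Y \<subseteq> {..<N}" using bound by blast
    then obtain k where k: "{..<N} \<subseteq> G k" "\<forall>X\<subseteq>{..<N}. \<rho> X = \<rho>s k X" using lim by blast
    interpret R: rank_fun "G k" "\<rho>s k" using \<rho>s by (simp add: good_def)
    have "X \<subseteq> {..<N}" "Y \<subseteq> G k" using X N k by auto
    then show "\<rho> X \<le> \<rho> Y" using R.mono[OF X] N k by auto
  next
    fix X Y :: "nat set" assume X: "finite X" "finite Y"
    then obtain N where N: "X \<union> Y \<subseteq> {..<N}" using bound[of "X \<union> Y"] by blast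
    then obtain k where k: "{..<N} \<subseteq> G k" "\<forall>X\<subseteq>{..<N}. \<rho> X = \<rho>s k X" using lim by blast
    interpret R: rank_fun "G k" "\<rho>s k" using \<rho>s by (simp add: good_def)
    have "X \<subseteq> {..<N}" "Y \<subseteq> {..<N}" "X \<inter> Y \<subseteq> {..<N}" using N by auto
    then show "\<rho> (X \<union> Y) + \<rho> (X \<inter> Y) \<le> \<rho> X + \<rho> Y"
      using R.submodular[OF X] N k by (metis order.trans)
  qed
  moreover have "\<rho> X \<le> r S" if X: "finite X" for X
  proof -
    obtain N where N: "X \<subseteq> {..<N}" using bound X by blast
    then obtain k where k: "{..<N} \<subseteq> G k" "\<forall>X\<subseteq>{..<N}. \<rho> X = \<rho>s k X" using lim by blast
    then show ?thesis using \<rho>s[of k] N unfolding good_def by (metis order.trans)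
  qed
  moreover have "\<rho> X = r (h ` X)" if X: "X \<subseteq> {..<m}" for X
  proof -
    obtain k where k: "\<forall>X\<subseteq>{..<m}. \<rho> X = \<rho>s k X" using lim by blast
    then show ?thesis using \<rho>s[of k] X unfolding good_def by metis
  qed
  moreover have "\<exists>Z. finite Z \<and> meets \<rho> A B Z" if AB: "finite A" "finite B" for A B
  proof -
    obtain t where t: "task_fst t = A" "task_snd t = B" using task_ex AB by blast
    \<comment> \<open>The window holds the labels of task \<open>t\<close>, which are below
      \<open>t\<close>, and those of its solution; the summand \<open>Suc t\<close> also forces
      \<open>t < k\<close>, so tower \<open>k\<close> has treated the task.\<close>
    define N where "N = m + r S * Suc t + Suc t"
    obtain k where k: "k \<ge> N" "{..<N} \<subseteq> G k" "\<forall>X\<subseteq>{..<N}. \<rho> X = \<rho>s k X" using lim by blast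
    have "t < k" using k(1) by (simp add: N_def)
    then obtain Z where Z: "Z \<subseteq> {..<m + r S * Suc t}" "meets (\<rho>s k) A B Z"
      using \<rho>s[of k] t unfolding good_def G_def by blast
    have "Z \<subseteq> {..<N}" "A \<subseteq> {..<N}" "B \<subseteq> {..<N}" using Z task_less[of t] t by (fastforce simp: N_def)+
    then have "meets \<rho> A B Z" using Z(2) k(3) by (simp add: meets_def)
    moreover have "finite Z" using Z finite_subset by blast
    ultimately show ?thesis by blast
  qed
  ultimately show ?thesis by blast
qed

section \<open>Modular rank functions as projective spaces\<close>

locale modular_rank = rank_fun UNIV \<rho> for \<rho> :: "'p set \<Rightarrow> nat" +
  fixes n :: nat
  assumes bounded: "finite X \<Longrightarrow> \<rho> X \<le> n"
    and modular: "finite A \<Longrightarrow> finite B \<Longrightarrow> \<exists>Z. finite Z \<and> meets \<rho> A B Z"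
begin

text \<open>Modularity becomes an incidence axiom here: the rank deficit is the rank of the common
  part \<open>Z\<close>, so \<open>Z\<close> has a basis element.\<close>

lemma meet_element:
  assumes "finite A" "finite B" "\<rho> (A \<union> B) < \<rho> A + \<rho> B"
  shows "\<exists>z. \<rho> {z} = 1 \<and> spanned A z \<and> spanned B z"
proof -
  obtain Z where Z: "finite Z" "meets \<rho> A B Z" using modular assms by blast
  then have "\<rho> Z > 0" using assms by (simp add: meets_def)
  obtain J where J: "J \<subseteq> Z" "\<rho> J = card J" "\<rho> J = \<rho> Z" using basis_ex[OF Z(1)] by auto
  then obtain z where z: "z \<in> J" using \<open>\<rho> Z > 0\<close> by fastforce
  have "\<rho> {z} = 1" using indep_subset[of J "{z}"] J Z z finite_subset by auto
  moreover have "spanned X z" if "finite X" "\<rho> (X \<union> Z) = \<rho> X" for X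
    using mono[of "X \<union> Z" "insert z X"] mono[of "insert z X" X, OF _ subset_insertI] that z J Z by (auto simp: spanned_def)
  ultimately show ?thesis using assms Z by (auto simp: meets_def)
qed

lemma spanned_base: "x \<in> X \<Longrightarrow> spanned X x"
  by (simp add: spanned_def insert_absorb)

end

text \<open>\<open>P\<close> picks one element from each parallel class.\<close>

locale modular_points = modular_rank \<rho> n for \<rho> :: "'p set \<Rightarrow> nat" and n +
  fixes P :: "'p set"
  assumes P1: "x \<in> P \<Longrightarrow> \<rho> {x} = 1"
    and P2: "x \<in> P \<Longrightarrow> y \<in> P \<Longrightarrow> x \<noteq> y \<Longrightarrow> \<rho> {x, y} = 2"
    and P_rep: "\<rho> {z} = 1 \<Longrightarrow> \<exists>x\<in>P. spanned {x} z \<and> spanned {z} x"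
begin

lemma meet_point:
  assumes "finite A" "finite B" "\<rho> (A \<union> B) < \<rho> A + \<rho> B"
  shows "\<exists>z\<in>P. spanned A z \<and> spanned B z"
proof -
  obtain w where w: "\<rho> {w} = 1" "spanned A w" "spanned B w" using meet_element assms by blast
  then obtain z where z: "z \<in> P" "spanned {w} z" using P_rep by blast
  have "spanned X z" if "finite X" "spanned X w" for X
    by (rule spanned_trans[of X "{w}"]) (use that z in auto)
  then show ?thesis using z w assms by blast
qed

definition col :: "'p \<Rightarrow> 'p \<Rightarrow> 'p \<Rightarrow> bool" where
  "col x y z \<longleftrightarrow> \<rho> {x, y, z} \<le> 2"

lemma col_perm: "col x y z \<Longrightarrow> col y x z" "col x y z \<Longrightarrow> col x z y"
  by (auto simp: col_def insert_commute)

lemma col_spanned: "x \<in> P \<Longrightarrow> y \<in> P \<Longrightarrow> x \<noteq> y \<Longrightarrow> col x y z \<longleftrightarrow> spanned {x, y} z"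
  using P2[of x y] mono[of "{x, y, z}" "{x, y}"] by (auto simp: col_def spanned_def insert_commute)

lemma col_two: "x \<in> P \<Longrightarrow> y \<in> P \<Longrightarrow> col x x y" "x \<in> P \<Longrightarrow> y \<in> P \<Longrightarrow> col x y y" "x \<in> P \<Longrightarrow> y \<in> P \<Longrightarrow> col x y x"
  using le_card[of "{x, y}"] card_insert_le_m1[of 2 "{y}" x] by (auto simp: col_def insert_commute)

lemma col_trans:
  assumes "x \<in> P" "y \<in> P" "x \<noteq> y" "col x y z" "col x y w"
  shows "col x z w" "col y z w"
proof -
  have "spanned {x, y} z" "spanned {x, y} w" using col_spanned assms by auto
  then have "\<rho> ({x, y} \<union> {z, w}) = \<rho> {x, y}" by (intro rank_union_spanned) auto
  then have r: "\<rho> ({x, y} \<union> {z, w}) = 2" using P2 assms by simp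
  have "\<rho> {x, z, w} \<le> \<rho> ({x, y} \<union> {z, w})" "\<rho> {y, z, w} \<le> \<rho> ({x, y} \<union> {z, w})" by (intro mono; auto)+
  then show "col x z w" "col y z w" using r by (auto simp: col_def)
qed

lemma col_trans2:
  assumes "x \<in> P" "y \<in> P" "z \<in> P" "w \<in> P" "v \<in> P" "x \<noteq> y" "col x y z" "col x y w" "col x y v"
  shows "col z w v"
proof (cases "z = x")
  case True then show ?thesis using col_trans(1)[OF assms(1,2,6,8,9)] by simp
next
  case False
  have "col x z w" "col x z v"
    using col_trans(1)[OF assms(1,2,6,7,8)] col_trans(1)[OF assms(1,2,6,7,9)] by auto
  then show ?thesis using col_trans(2)[OF assms(1,3) False[symmetric]] by blast
qed

lemma spanned_rep_iff: "\<rho> {z} = 1 \<Longrightarrow> \<exists>x\<in>P. \<forall>X. finite X \<longrightarrow> spanned X x \<longleftrightarrow> spanned X z"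
proof -
  assume "\<rho> {z} = 1"
  then obtain x where x: "x \<in> P" "spanned {x} z" "spanned {z} x" using P_rep by blast
  have "spanned X x \<longleftrightarrow> spanned X z" if "finite X" for X
    using spanned_trans[of X "{x}" z] spanned_trans[of X "{z}" x] that x by auto
  then show ?thesis using x by blast
qed

end

locale modular_space = modular_points \<rho> n P for \<rho> :: "'p set \<Rightarrow> nat" and n and P +
  assumes thick: "x \<in> P \<Longrightarrow> y \<in> P \<Longrightarrow> x \<noteq> y \<Longrightarrow> \<exists>z\<in>P. z \<noteq> x \<and> z \<noteq> y \<and> \<rho> {x, y, z} = 2"
    and full_rank: "\<exists>B. finite B \<and> \<rho> B = n"
    and n4: "n \<ge> 4"
begin

definition basis :: "'p set" where
  "basis = (SOME B. finite B \<and> \<rho> B = n \<and> card B = n)"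

lemma basis: "finite basis" "\<rho> basis = n" "card basis = n"
proof -
  obtain B where B: "finite B" "\<rho> B = n" using full_rank by blast
  obtain J where "J \<subseteq> B" "\<rho> J = card J" "\<rho> J = \<rho> B" using basis_ex[OF B(1)] by auto
  then have "finite J \<and> \<rho> J = n \<and> card J = n" using B finite_subset by auto
  then have "finite basis \<and> \<rho> basis = n \<and> card basis = n" unfolding basis_def by (rule someI)
  then show "finite basis" "\<rho> basis = n" "card basis = n" by auto
qed

definition b0 :: 'p where "b0 = (SOME b. b \<in> basis)"

definition B0 :: "'p set" where "B0 = basis - {b0}"

lemma B0: "finite B0" "\<rho> B0 = n - 1" "card B0 = n - 1" "\<rho> (insert b0 B0) = n"
proof -
  have "basis \<noteq> {}" using basis n4 by auto
  then have b: "b0 \<in> basis" unfolding b0_def by (simp add: some_in_eq)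
  show 1: "finite B0" "card B0 = n - 1" using basis b by (auto simp: B0_def)
  show "\<rho> B0 = n - 1" using indep_subset[of basis B0] basis 1 by (auto simp: B0_def)
  show "\<rho> (insert b0 B0) = n" using basis b by (simp add: B0_def insert_absorb)
qed

definition H :: "'p set" where "H = {x \<in> P. spanned B0 x}"

definition E :: "'p set" where "E = P - H"

lemma HP: "x \<in> H \<Longrightarrow> x \<in> P" by (simp add: H_def)
lemma EP: "x \<in> E \<Longrightarrow> x \<in> P" by (simp add: E_def)
lemma EH: "x \<in> E \<Longrightarrow> y \<in> H \<Longrightarrow> x \<noteq> y" by (auto simp: E_def)

lemma H_span: "finite X \<Longrightarrow> X \<subseteq> H \<Longrightarrow> spanned X x \<Longrightarrow> x \<in> P \<Longrightarrow> x \<in> H"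
  using spanned_trans[of B0 X x] B0 by (auto simp: H_def)

lemma H_col: "p \<in> H \<Longrightarrow> q \<in> H \<Longrightarrow> p \<noteq> q \<Longrightarrow> col p q x \<Longrightarrow> x \<in> P \<Longrightarrow> x \<in> H"
  using H_span[of "{p, q}" x] col_spanned HP by auto

text \<open>The ranks \<open>2\<close> and \<open>n - 1\<close> of a line and of the hyperplane add
  up to more than the total rank \<open>n\<close>, so the two meet.\<close>

lemma d_ex:
  assumes "x \<in> E" "y \<in> E" "x \<noteq> y"
  shows "\<exists>z\<in>H. col x y z"
proof -
  have "\<rho> ({x, y} \<union> B0) < \<rho> {x, y} + \<rho> B0"
    using bounded[of "{x, y} \<union> B0"] P2[of x y] EP assms B0 n4 by auto
  then obtain z where "z \<in> P" "spanned {x, y} z" "spanned B0 z" using meet_point[of "{x, y}" B0] B0 by auto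
  then show ?thesis using col_spanned EP assms by (auto simp: H_def)
qed

lemma d_unique:
  assumes "x \<in> E" "y \<in> E" "x \<noteq> y" "z \<in> H" "col x y z" "w \<in> H" "col x y w"
  shows "z = w"
proof (rule ccontr)
  assume n: "z \<noteq> w"
  have P: "x \<in> P" "y \<in> P" "z \<in> P" "w \<in> P" using assms EP HP by blast+
  have "col z w x" by (rule col_trans2[OF P(1,2,3,4,1) assms(3,5,7) col_two(3)[OF P(1,2)]])
  then have "x \<in> H" by (rule H_col[OF assms(4,6) n _ P(1)])
  then show False using assms by (auto simp: E_def)
qed

definition d :: "'p \<Rightarrow> 'p \<Rightarrow> 'p" where
  "d x y = (SOME z. z \<in> H \<and> col x y z)"

lemma d: "x \<in> E \<Longrightarrow> y \<in> E \<Longrightarrow> x \<noteq> y \<Longrightarrow> d x y \<in> H" "x \<in> E \<Longrightarrow> y \<in> E \<Longrightarrow> x \<noteq> y \<Longrightarrow> col x y (d x y)"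
  using someI_ex[of "\<lambda>z. z \<in> H \<and> col x y z"] d_ex[of x y] unfolding d_def by blast+

lemma d_eq: "x \<in> E \<Longrightarrow> y \<in> E \<Longrightarrow> x \<noteq> y \<Longrightarrow> z \<in> H \<Longrightarrow> d x y = z \<longleftrightarrow> col x y z"
  using d d_unique by blast

definition ln :: "'p \<Rightarrow> 'p \<Rightarrow> 'p set" where
  "ln p q = {z \<in> H. col p q z}"

text \<open>Applied to a line, of rank \<open>2 < n - 1\<close>, this is how rank at least 4 yields
  the axiom \<open>not_line\<close>.\<close>

lemma ex_H_not_spanned:
  assumes "finite X" "\<rho> X < n - 1"
  shows "\<exists>s\<in>H. \<not> spanned X s"
proof -
  have "\<exists>b\<in>B0. \<not> spanned X b"
  proof (rule ccontr)
    assume "\<not> ?thesis"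
    then have "\<rho> (X \<union> B0) = \<rho> X" using rank_union_spanned[of X B0] assms B0 by auto
    moreover have "\<rho> B0 \<le> \<rho> (X \<union> B0)" by (rule mono) (use assms B0 in auto)
    ultimately show False using assms B0 by auto
  qed
  then obtain b where b: "b \<in> B0" "\<not> spanned X b" by blast
  have "\<rho> {b} = 1" using indep_subset[of B0 "{b}"] B0 b by auto
  then obtain s where "s \<in> P" "\<forall>Y. finite Y \<longrightarrow> spanned Y s \<longleftrightarrow> spanned Y b" using spanned_rep_iff by blast
  then show ?thesis using b assms spanned_base[of b B0] B0 by (auto simp: H_def)
qed

text \<open>The three directions lie in \<open>H\<close>, so \<open>x\<close> is not in their span,
  yet all four points lie in the plane \<open>x y z\<close> of rank at most 3. This leaves rank at
  most 2 for the directions.\<close>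

lemma triangle_H:
  assumes "x \<in> E" "y \<in> E" "z \<in> E" "x \<noteq> y" "x \<noteq> z" "y \<noteq> z"
  shows "col (d x y) (d x z) (d y z)"
proof -
  let ?D = "{d x y, d x z, d y z}"
  have D: "?D \<subseteq> H" using d(1) assms by auto
  have "\<not> spanned ?D x" using H_span[of ?D x] D assms EP by (auto simp: E_def)
  then have "\<rho> (insert x ?D) = \<rho> ?D + 1" using not_spanned by auto
  moreover have "\<rho> (insert x ?D) \<le> \<rho> ({x, y, z} \<union> ?D)" by (rule mono) auto
  moreover have "\<rho> ({x, y, z} \<union> ?D) = \<rho> {x, y, z}"
  proof (rule rank_union_spanned)
    have s: "spanned {x, y} (d x y)" "spanned {x, z} (d x z)" "spanned {y, z} (d y z)"
      using d(2)[of x y] d(2)[of x z] d(2)[of y z] col_spanned[of x y] col_spanned[of x z] col_spanned[of y z] assms EP by blast+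
    fix w assume "w \<in> ?D"
    then show "spanned {x, y, z} w"
      using spanned_mono[OF _ _ _ _ s(1), of "{x, y, z}"] spanned_mono[OF _ _ _ _ s(2), of "{x, y, z}"]
        spanned_mono[OF _ _ _ _ s(3), of "{x, y, z}"] by auto
  qed auto
  moreover have "\<rho> {x, y, z} \<le> 3" using le_card[of "{x, y, z}"] assms by auto
  ultimately show ?thesis by (simp add: col_def)
qed

lemma aff_space: "aff_space E H d ln"
proof
  fix x y assume "x \<in> E" "y \<in> E" "x \<noteq> y"
  then show "d x y \<in> H" by (rule d(1))
next
  fix x y show "d x y = d y x" unfolding d_def by (metis col_perm(1))
next
  fix p q assume pq: "p \<in> H" "q \<in> H" "p \<noteq> q"
  show "ln p q \<subseteq> H" "p \<in> ln p q" "q \<in> ln p q" using pq col_two HP by (auto simp: ln_def)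
  show "\<exists>s\<in>H. s \<notin> ln p q" using ex_H_not_spanned[of "{p, q}"] P2[of p q] col_spanned[of p q] pq HP n4 by (auto simp: ln_def)
  fix s t assume st: "s \<in> ln p q" "t \<in> ln p q" "s \<noteq> t"
  then have st': "s \<in> H" "t \<in> H" "col p q s" "col p q t" by (auto simp: ln_def)
  note PP = HP[OF pq(1)] HP[OF pq(2)] HP[OF st'(1)] HP[OF st'(2)]
  have stp: "col s t p" by (rule col_trans2[OF PP(1-4,1) pq(3) st'(3,4) col_two(3)[OF PP(1,2)]])
  have stq: "col s t q" by (rule col_trans2[OF PP(1-4,2) pq(3) st'(3,4) col_two(2)[OF PP(1,2)]])
  have "col s t z \<longleftrightarrow> col p q z" if "z \<in> H" for z
    using col_trans2[OF PP(1-4) HP[OF that] pq(3) st'(3,4)] col_trans2[OF PP(3,4,1,2) HP[OF that] st(3) stp stq]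
    by blast
  then show "ln s t = ln p q" by (auto simp: ln_def)
next
  fix x y z assume a: "x \<in> E" "y \<in> E" "z \<in> E" "x \<noteq> y" "x \<noteq> z" "y \<noteq> z"
  { assume e: "d x y = d x z"
    have h: "d x y \<in> H" "col x y (d x y)" "col x z (d x y)" using d a e by metis+
    have "x \<noteq> d x y" using EH a h by auto
    have PP: "x \<in> P" "d x y \<in> P" "y \<in> P" "z \<in> P" using a h EP HP by blast+
    have "col y z (d x y)"
      by (rule col_trans2[OF PP(1-4,2) \<open>x \<noteq> d x y\<close> col_perm(2)[OF h(2)] col_perm(2)[OF h(3)] col_two(2)[OF PP(1,2)]])
    then show "d y z = d x y" using d_eq[OF a(2,3,6) h(1)] by blast }
  { assume "d x y \<noteq> d x z"
    then show "d y z \<in> ln (d x y) (d x z)" using triangle_H[OF a] d(1)[OF a(2,3,6)] by (simp add: ln_def) }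
next
  fix x p assume a: "x \<in> E" "p \<in> H"
  \<comment> \<open>The third point on the line through \<open>x\<close> and \<open>p\<close>;
    without thick lines there might be no affine point in the given direction.\<close>
  then obtain z where z: "z \<in> P" "z \<noteq> x" "z \<noteq> p" "\<rho> {x, p, z} = 2" using thick[of x p] EP HP EH by blast
  have c: "col x p z" using z by (simp add: col_def)
  have "col p z x" using c col_perm by blast
  then have "z \<notin> H" using H_col[of p z x] a z EP[of x] EH[of x x] by metis
  then have "z \<in> E" using z by (auto simp: E_def)
  moreover have "d x z = p" using d_eq[OF a(1) calculation z(2)[symmetric] a(2)] col_perm(2)[OF c] by blast
  ultimately show "\<exists>y\<in>E. y \<noteq> x \<and> d x y = p" using z by auto
next
  fix x y p q assume a: "x \<in> E" "y \<in> E" "x \<noteq> y" "p \<in> H" "q \<in> H" "p \<noteq> q" "d x y \<noteq> p" "d x y \<noteq> q" "d x y \<in> ln p q"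
  let ?a = "d x y"
  have h: "?a \<in> H" "col x y ?a" "col p q ?a" using d a by (auto simp: ln_def)
  have n: "x \<noteq> p" "x \<noteq> q" "y \<noteq> p" "y \<noteq> q" "x \<noteq> ?a" using a h EH by auto
  have s1: "spanned {p, q} ?a" using col_spanned[OF HP[OF a(4)] HP[OF a(5)] a(6)] h(3) by blast
  have s2: "spanned {x, ?a} y" using col_spanned[OF EP[OF a(1)] HP[OF h(1)] n(5)] col_perm(2)[OF h(2)] by blast
  have s1': "spanned {x, p, q} ?a" by (rule spanned_mono[OF _ _ _ _ s1]) auto
  \<comment> \<open>The lines \<open>x p\<close> and \<open>y q\<close> lie in one plane, because
    the point at infinity of \<open>x y\<close> is on the line \<open>p q\<close>. Two lines in a
    set of rank at most 3 meet.\<close>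
  have "spanned {x, p, q} y"
    by (rule spanned_trans[OF _ _ _ _ _ _ s2]) (use s1' spanned_base in auto)
  then have "\<rho> {y, x, p, q} \<le> 3" using le_card[of "{x, p, q}"] n a by (auto simp: spanned_def)
  moreover have "{x, p} \<union> {y, q} = {y, x, p, q}" by auto
  ultimately have "\<rho> ({x, p} \<union> {y, q}) < \<rho> {x, p} + \<rho> {y, q}" using P2[of x p] P2[of y q] a n EP HP by auto
  then obtain z where z: "z \<in> P" "spanned {x, p} z" "spanned {y, q} z" using meet_point[of "{x, p}" "{y, q}"] by auto
  then have c: "col x p z" "col y q z"
    using col_spanned[OF EP[OF a(1)] HP[OF a(4)] n(1)] col_spanned[OF EP[OF a(2)] HP[OF a(5)] n(4)] by blast+
  have zH: "z \<notin> H"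
  proof
    assume zh: "z \<in> H"
    have "z = p"
      using H_col[OF a(4) zh, of x] col_perm(1)[OF c(1)] col_perm(2) EP[OF a(1)] EH[OF a(1)] by blast
    moreover have "z = q"
      using H_col[OF a(5) zh, of y] col_perm(1)[OF c(2)] col_perm(2) EP[OF a(2)] EH[OF a(2)] by blast
    ultimately show False using a by auto
  qed
  then have zE: "z \<in> E" using z by (auto simp: E_def)
  have zx: "z \<noteq> x"
  proof
    assume "z = x"
    then have "col x y q" using c(2) col_perm by blast
    then show False using d_eq[OF a(1,2,3,5)] a(8) by blast
  qed
  have zy: "z \<noteq> y"
  proof
    assume "z = y"
    then have "col x y p" using c(1) col_perm by blast
    then show False using d_eq[OF a(1,2,3,4)] a(7) by blast
  qed
  have "d x z = p" "d y z = q"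
    using d_eq[OF a(1) zE zx[symmetric] a(4)] d_eq[OF a(2) zE zy[symmetric] a(5)]
      col_perm(2)[OF c(1)] col_perm(2)[OF c(2)] by blast+
  with zx zy show "\<exists>z\<in>E. z \<noteq> x \<and> z \<noteq> y \<and> d x z = p \<and> d y z = q" using zE by auto
next
  obtain p where p: "p \<in> H" using ex_H_not_spanned[of "{}"] rank_empty n4 by auto
  have "\<rho> {p} < n - 1" using P1[OF HP[OF p]] n4 by simp
  then obtain q where q: "q \<in> H" "\<not> spanned {p} q" using ex_H_not_spanned[of "{p}"] by auto
  then have "p \<noteq> q" using spanned_base by auto
  then show "\<exists>p\<in>H. \<exists>q\<in>H. p \<noteq> q" using p q by auto
next
  \<comment> \<open>\<open>b0\<close> completes the basis of the hyperplane to a basis of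
    everything; it need not belong to \<open>P\<close>, but the point parallel to it lies off the
    hyperplane.\<close>
  have nb: "\<not> spanned B0 b0" using B0 n4 by (auto simp: spanned_def)
  have "\<not> spanned {} b0" using spanned_mono[of B0 "{}" b0] B0 nb by auto
  then have "\<rho> {b0} = 1" using not_spanned[of "{}" b0] rank_empty by auto
  then obtain s where "s \<in> P" "\<forall>Y. finite Y \<longrightarrow> spanned Y s \<longleftrightarrow> spanned Y b0" using spanned_rep_iff by blast
  then have "s \<in> E" using nb B0 by (auto simp: E_def H_def)
  then show "E \<noteq> {}" by auto
qed

end

section \<open>Coordinatization\<close>

definition dependent3 :: "('f, 'm) ring_scheme \<Rightarrow> ('f, 'v, 'n) module_scheme \<Rightarrow> 'v \<Rightarrow> 'v \<Rightarrow> 'v \<Rightarrow> bool" where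
  "dependent3 F V u v w \<longleftrightarrow> (\<exists>a\<in>carrier F - {\<zero>\<^bsub>F\<^esub>}. \<exists>b\<in>carrier F - {\<zero>\<^bsub>F\<^esub>}. \<exists>c\<in>carrier F - {\<zero>\<^bsub>F\<^esub>}.
     a \<odot>\<^bsub>V\<^esub> u \<oplus>\<^bsub>V\<^esub> (b \<odot>\<^bsub>V\<^esub> v \<oplus>\<^bsub>V\<^esub> c \<odot>\<^bsub>V\<^esub> w) = \<zero>\<^bsub>V\<^esub>)"

context modular_space
begin

text \<open>\<open>\<phi>\<close> induces a bijection from the points to the one-dimensional
  subspaces that turns collinearity into dependence. It is phrased for arbitrary \<open>F\<close>
  and \<open>V\<close> so that it can be carried over to other types.\<close>

definition coordinatized :: "('f, 'm) ring_scheme \<Rightarrow> ('f, 'v, 'n) module_scheme \<Rightarrow> ('p \<Rightarrow> 'v) \<Rightarrow> bool" where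
  "coordinatized F V \<phi> \<longleftrightarrow> right_vector_space F V \<and> (\<forall>p\<in>P. \<phi> p \<in> carrier V \<and> \<phi> p \<noteq> \<zero>\<^bsub>V\<^esub>) \<and>
     (\<forall>p\<in>P. \<forall>q\<in>P. \<forall>s\<in>P. p \<noteq> q \<longrightarrow> p \<noteq> s \<longrightarrow> q \<noteq> s \<longrightarrow> (col p q s \<longleftrightarrow> dependent3 F V (\<phi> p) (\<phi> q) (\<phi> s))) \<and>
     (\<forall>p\<in>P. \<forall>q\<in>P. p \<noteq> q \<longrightarrow> (\<forall>a\<in>carrier F. \<phi> p \<noteq> a \<odot>\<^bsub>V\<^esub> \<phi> q)) \<and>
     (\<forall>v\<in>carrier V. v \<noteq> \<zero>\<^bsub>V\<^esub> \<longrightarrow> (\<exists>p\<in>P. \<exists>a\<in>carrier F - {\<zero>\<^bsub>F\<^esub>}. v = a \<odot>\<^bsub>V\<^esub> \<phi> p))"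

lemma coordinatized_ex: "\<exists>(F :: 'p ring) (V :: ('p, 'p \<times> 'p) module) \<phi>. coordinatized F V \<phi>"
proof -
  interpret A0: aff_space E H d ln by (rule aff_space)
  obtain orig where orig: "orig \<in> E" using A0.nonempty by auto
  interpret A: aff_pointed E H d ln orig by unfold_locales (rule orig)
  obtain e where e: "e \<in> E" "e \<noteq> orig" using A0.ex_pt[OF orig] A0.two_dirs by blast
  interpret D: dir_group_unit A.gr H ln "d orig" e by unfold_locales (use e in auto)
  define u where "u p = (SOME x. x \<in> E \<and> x \<noteq> orig \<and> d orig x = p)" for p
  have u: "u p \<in> E" "u p \<noteq> orig" "d orig (u p) = p" if "p \<in> H" for p
    using someI_ex[of "\<lambda>x. x \<in> E \<and> x \<noteq> orig \<and> d orig x = p"] A0.ex_pt[OF orig that] unfolding u_def by blast+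
  \<comment> \<open>Homogeneous coordinates: an affine point gets last coordinate one, which is
    \<open>e\<close>; a point at infinity gets a vector of its direction and last coordinate zero,
    which is \<open>orig\<close>.\<close>
  define \<phi> where "\<phi> p = (if p \<in> E then (p, e) else (u p, orig))" for p
  have \<phi>E: "\<phi> p = (p, e)" if "p \<in> E" for p using that by (simp add: \<phi>_def)
  have \<phi>H: "\<phi> p = (u p, orig)" if "p \<in> H" for p using that by (auto simp: \<phi>_def E_def)
  have PEH: "p \<in> E \<or> p \<in> H" if "p \<in> P" for p using that by (auto simp: E_def)
  have K: "e \<in> D.K" "orig \<in> D.K" using D.unit_K by auto
  interpret V: right_vector_space D.SF D.VS by (rule D.right_vector_space_VS)
  have \<phi>V: "\<phi> p \<in> carrier D.VS \<and> \<phi> p \<noteq> \<zero>\<^bsub>D.VS\<^esub>" if "p \<in> P" for p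
    using PEH[OF that] \<phi>E[of p] \<phi>H[of p] u[of p] K e by auto
  \<comment> \<open>\<open>Q\<close> is invariant under permutations, so of the eight distributions
    of three points over \<open>E\<close> and \<open>H\<close> only four need an argument.\<close>
  define Q where "Q p q s \<longleftrightarrow> (col p q s \<longleftrightarrow> D.dep (\<phi> p) (\<phi> q) (\<phi> s))" for p q s
  have Q1: "Q p q s \<Longrightarrow> Q q p s" and Q2: "Q p q s \<Longrightarrow> Q p s q" if "p \<in> P" "q \<in> P" "s \<in> P" for p q s
    unfolding Q_def using D.dep_perm[of "\<phi> p" "\<phi> q" "\<phi> s"] \<phi>V that col_perm by blast+
  have EEE: "Q p q s" if a: "p \<in> E" "q \<in> E" "s \<in> E" "p \<noteq> q" "p \<noteq> s" "q \<noteq> s" for p q s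
  proof -
    have PP: "p \<in> P" "q \<in> P" "s \<in> P" "d p q \<in> P" using a EP d(1) HP by blast+
    have "col p q s \<longleftrightarrow> d p q = d p s"
    proof
      assume "col p q s"
      then have "col p s (d p q)" using col_trans(1)[OF PP(1,2) a(4) _ d(2)[OF a(1,2,4)]] by blast
      then show "d p q = d p s" using d_eq[OF a(1,3,5) d(1)[OF a(1,2,4)]] by simp
    next
      assume "d p q = d p s"
      then have "col p (d p q) q" "col p (d p q) s"
        using d(2)[OF a(1,2,4)] d(2)[OF a(1,3,5)] col_perm(2) by auto
      then show "col p q s" using col_trans(1)[OF PP(1,4) EH[OF a(1) d(1)[OF a(1,2,4)]]] by blast
    qed
    then show ?thesis unfolding Q_def \<phi>E[OF a(1)] \<phi>E[OF a(2)] \<phi>E[OF a(3)]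
      using D.dep_EEE[of p q s] a A.gr_diff(2)[of p q] A.gr_diff(2)[of p s] by simp
  qed
  have EEH: "Q p q s" if a: "p \<in> E" "q \<in> E" "s \<in> H" "p \<noteq> q" for p q s
    unfolding Q_def \<phi>E[OF a(1)] \<phi>E[OF a(2)] \<phi>H[OF a(3)]
    using D.dep_EEH[of p q "u s"] a u[of s] A.gr_diff(2)[of p q] d_eq[OF a(1,2,4,3)] by simp
  have EHH: "Q p q s" if a: "p \<in> E" "q \<in> H" "s \<in> H" "q \<noteq> s" for p q s
  proof -
    have "\<not> col p q s" using H_col[OF a(2,3,4)] EH[OF a(1)] EP[OF a(1)] col_perm by blast
    then show ?thesis unfolding Q_def \<phi>E[OF a(1)] \<phi>H[OF a(2)] \<phi>H[OF a(3)]
      using D.dep_EHH[of "u q" "u s" p] u a by simp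
  qed
  have HHH: "Q p q s" if a: "p \<in> H" "q \<in> H" "s \<in> H" "p \<noteq> q" "p \<noteq> s" "q \<noteq> s" for p q s
    unfolding Q_def \<phi>H[OF a(1)] \<phi>H[OF a(2)] \<phi>H[OF a(3)]
    using D.dep_HHH[of "u p" "u q" "u s"] a u[of p] u[of q] u[of s] by (simp add: ln_def)
  have Q: "Q p q s" if a: "p \<in> P" "q \<in> P" "s \<in> P" "p \<noteq> q" "p \<noteq> s" "q \<noteq> s" for p q s
  proof -
    consider "p \<in> E" "q \<in> E" "s \<in> E" | "p \<in> E" "q \<in> E" "s \<in> H" | "p \<in> E" "q \<in> H" "s \<in> E" | "p \<in> H" "q \<in> E" "s \<in> E"
      | "p \<in> E" "q \<in> H" "s \<in> H" | "p \<in> H" "q \<in> E" "s \<in> H" | "p \<in> H" "q \<in> H" "s \<in> E" | "p \<in> H" "q \<in> H" "s \<in> H"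
      using PEH a(1,2,3) by blast
    then show ?thesis
    proof cases
      case 1 then show ?thesis using EEE a by blast
    next
      case 2 then show ?thesis using EEH a by blast
    next
      case 3 then show ?thesis using Q2[OF a(1,3,2)] EEH a by blast
    next
      case 4 then show ?thesis using Q1[OF a(2,1,3)] Q2[OF a(2,3,1)] EEH a by blast
    next
      case 5 then show ?thesis using EHH a by blast
    next
      case 6 then show ?thesis using Q1[OF a(2,1,3)] EHH a by blast
    next
      case 7 then show ?thesis using Q2[OF a(1,3,2)] Q1[OF a(3,1,2)] EHH a by blast
    next
      case 8 then show ?thesis using HHH a by blast
    qed
  qed
  have inj: "\<phi> p \<noteq> a \<odot>\<^bsub>D.VS\<^esub> \<phi> q" if a: "p \<in> P" "q \<in> P" "p \<noteq> q" "a \<in> D.K" for p q a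
  proof
    assume eq: "\<phi> p = a \<odot>\<^bsub>D.VS\<^esub> \<phi> q"
    have h0: "D.hm a orig = orig" using A.dg.endo_zero[OF D.hm(1)[OF a(4)]] by simp
    have he: "D.hm a e = a" using D.hm(2)[OF a(4)] .
    consider "p \<in> E" "q \<in> E" | "p \<in> E" "q \<in> H" | "p \<in> H" "q \<in> E" | "p \<in> H" "q \<in> H" using PEH a by blast
    then show False
    proof cases
      case 1
      then have "a = e" "p = D.hm a q" using eq he by (auto simp: \<phi>E)
      then show False using D.hm_e[of q] 1 a by auto
    next
      case 2
      then show False using eq h0 e by (auto simp: \<phi>E \<phi>H)
    next
      case 3
      then have "a = orig" "u p = D.hm a q" using eq he by (auto simp: \<phi>E \<phi>H)
      then show False using D.hm_0[of q] 3 u[of p] by auto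
    next
      case 4
      then have eq': "u p = D.hm a (u q)" using eq by (auto simp: \<phi>H)
      then have "a \<noteq> orig" using D.hm_0[of "u q"] 4 u[of p] u[of q] by auto
      then have "d orig (u p) = d orig (u q)" using D.hm_nonzero[of a "u q"] eq' a u[of q] 4 by simp
      then show False using u(3)[OF 4(1)] u(3)[OF 4(2)] a by simp
    qed
  qed
  \<comment> \<open>With last coordinate zero, the point at infinity of the vector works; otherwise
    scale by the inverse \<open>y\<close> of the last coordinate \<open>b\<close> to reach an affine
    point.\<close>
  have surj: "\<exists>p\<in>P. \<exists>a\<in>D.K - {orig}. v = a \<odot>\<^bsub>D.VS\<^esub> \<phi> p" if v: "v \<in> carrier D.VS" "v \<noteq> \<zero>\<^bsub>D.VS\<^esub>" for v
  proof -
    obtain x b where xb: "v = (x, b)" "x \<in> E" "b \<in> D.K" using v by auto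
    show ?thesis
    proof (cases "b = orig")
      case True
      then have x: "x \<noteq> orig" using v xb by auto
      define p where "p = d orig x"
      have p: "p \<in> H" using A0.d_in[OF orig xb(2) x[symmetric]] by (simp add: p_def)
      have "d orig x = d orig (u p)" using u(3)[OF p] by (simp add: p_def)
      then obtain a where a: "a \<in> D.K" "a \<noteq> orig" "D.hm a (u p) = x"
        using D.hm_ex[of "u p" x, unfolded A.gr_simps, OF u(1,2)[OF p] xb(2) x] by blast
      have "D.hm a orig = orig" using A.dg.endo_zero[OF D.hm(1)[OF a(1)]] by simp
      then have "v = a \<odot>\<^bsub>D.VS\<^esub> \<phi> p" using xb(1) True a(3) by (simp add: \<phi>H[OF p])
      then show ?thesis using a(1,2) HP[OF p] by blast
    next
      case False
      obtain y where y: "y \<in> D.K" "\<forall>z\<in>E. D.hm b (D.hm y z) = z"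
        using D.hm_inv[OF xb(3), unfolded A.gr_simps, OF False] by blast
      have c: "D.hm y x \<in> E" using D.hm_in(1)[OF y(1)] xb by simp
      then have "v = b \<odot>\<^bsub>D.VS\<^esub> \<phi> (D.hm y x)" using y(2) xb D.hm(2)[OF xb(3)] by (simp add: \<phi>E)
      then show ?thesis using c EP xb(3) False by blast
    qed
  qed
  have "coordinatized D.SF D.VS \<phi>"
    unfolding coordinatized_def
  proof (intro conjI ballI impI)
    fix p q s assume "p \<in> P" "q \<in> P" "s \<in> P" "p \<noteq> q" "p \<noteq> s" "q \<noteq> s"
    then show "col p q s \<longleftrightarrow> dependent3 D.SF D.VS (\<phi> p) (\<phi> q) (\<phi> s)"
      using Q[of p q s] unfolding Q_def D.dep_def dependent3_def D.SF_simps A.gr_simps by blast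
  next
    fix v assume "v \<in> carrier D.VS" "v \<noteq> \<zero>\<^bsub>D.VS\<^esub>"
    then show "\<exists>p\<in>P. \<exists>a\<in>carrier D.SF - {\<zero>\<^bsub>D.SF\<^esub>}. v = a \<odot>\<^bsub>D.VS\<^esub> \<phi> p" using surj[of v] by simp
  qed (use D.right_vector_space_VS \<phi>V inj in auto)
  then show ?thesis by blast
qed

end

section \<open>Linear independence\<close>

definition ring_copy :: "('a \<Rightarrow> 'f) \<Rightarrow> 'a ring \<Rightarrow> 'f ring" where
  "ring_copy i F = \<lparr>carrier = i ` carrier F, mult = \<lambda>x y. i (inv_into UNIV i x \<otimes>\<^bsub>F\<^esub> inv_into UNIV i y), one = i \<one>\<^bsub>F\<^esub>,
     zero = i \<zero>\<^bsub>F\<^esub>, add = \<lambda>x y. i (inv_into UNIV i x \<oplus>\<^bsub>F\<^esub> inv_into UNIV i y)\<rparr>"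

definition module_copy :: "('a \<Rightarrow> 'f) \<Rightarrow> ('b \<Rightarrow> 'v) \<Rightarrow> ('a, 'b) module \<Rightarrow> ('f, 'v) module" where
  "module_copy i j V = \<lparr>carrier = j ` carrier V, mult = \<lambda>x y. j (inv_into UNIV j x \<otimes>\<^bsub>V\<^esub> inv_into UNIV j y), one = j \<one>\<^bsub>V\<^esub>,
     zero = j \<zero>\<^bsub>V\<^esub>, add = \<lambda>x y. j (inv_into UNIV j x \<oplus>\<^bsub>V\<^esub> inv_into UNIV j y),
     smult = \<lambda>a x. j (inv_into UNIV i a \<odot>\<^bsub>V\<^esub> inv_into UNIV j x)\<rparr>"

lemma right_vector_space_copy:
  fixes F :: "'a ring" and V :: "('a, 'b) module" and i :: "'a \<Rightarrow> 'f" and j :: "'b \<Rightarrow> 'v"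
  assumes "right_vector_space F V" and i: "inj i" and j: "inj j"
  shows "right_vector_space (ring_copy i F) (module_copy i j V)"
proof -
  interpret R0: skew_field F using assms(1) by (simp add: right_vector_space_def)
  interpret R: right_vector_space F V by fact
  note [simp] = inv_f_f[OF i] inv_f_f[OF j] inj_eq[OF i] inj_eq[OF j]
  let ?F = "ring_copy i F" and ?V = "module_copy i j V"
  have F: "carrier ?F = i ` carrier F" "mult ?F x y = i (inv_into UNIV i x \<otimes>\<^bsub>F\<^esub> inv_into UNIV i y)" "one ?F = i \<one>\<^bsub>F\<^esub>"
    "zero ?F = i \<zero>\<^bsub>F\<^esub>" "add ?F x y = i (inv_into UNIV i x \<oplus>\<^bsub>F\<^esub> inv_into UNIV i y)" for x y by (auto simp: ring_copy_def)
  have V: "carrier ?V = j ` carrier V" "zero ?V = j \<zero>\<^bsub>V\<^esub>" "add ?V x y = j (inv_into UNIV j x \<oplus>\<^bsub>V\<^esub> inv_into UNIV j y)"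
    "smult ?V a x = j (inv_into UNIV i a \<odot>\<^bsub>V\<^esub> inv_into UNIV j x)" for a x y by (auto simp: module_copy_def)
  have aF: "abelian_group ?F"
  proof (rule abelian_groupI)
    fix x assume "x \<in> carrier ?F"
    then obtain a where "a \<in> carrier F" "x = i a" by (auto simp: F)
    then show "\<exists>y\<in>carrier ?F. y \<oplus>\<^bsub>?F\<^esub> x = \<zero>\<^bsub>?F\<^esub>"
      using R0.l_neg[of a] by (intro bexI[of _ "i (\<ominus>\<^bsub>F\<^esub> a)"]) (auto simp: F)
  qed (auto simp: F R0.a_assoc intro: R0.a_comm)
  interpret rF: ring ?F
    by (rule ringI[OF aF], rule monoidI) (auto simp: F R0.m_assoc R0.l_distr R0.r_distr)
  interpret vV: abelian_group ?V
  proof (rule abelian_groupI)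
    fix x assume "x \<in> carrier ?V"
    then obtain a where "a \<in> carrier V" "x = j a" by (auto simp: V)
    then show "\<exists>y\<in>carrier ?V. y \<oplus>\<^bsub>?V\<^esub> x = \<zero>\<^bsub>?V\<^esub>"
      using R.V.l_neg[of a] by (intro bexI[of _ "j (\<ominus>\<^bsub>V\<^esub> a)"]) (auto simp: V)
  qed (auto simp: V R.V.a_assoc intro: R.V.a_comm)
  interpret sF: skew_field ?F
  proof
    show "\<one>\<^bsub>?F\<^esub> \<noteq> \<zero>\<^bsub>?F\<^esub>" using R0.one_neq_zero by (simp add: F)
    show "Units ?F = carrier ?F - {\<zero>\<^bsub>?F\<^esub>}"
    proof (intro Set.set_eqI iffI)
      fix x assume "x \<in> Units ?F"
      then obtain a b where "a \<in> carrier F" "b \<in> carrier F" "x = i a" "b \<otimes>\<^bsub>F\<^esub> a = \<one>\<^bsub>F\<^esub>" by (auto simp: Units_def F)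
      then show "x \<in> carrier ?F - {\<zero>\<^bsub>?F\<^esub>}" using R0.one_neq_zero by (auto simp: F)
    next
      fix x assume "x \<in> carrier ?F - {\<zero>\<^bsub>?F\<^esub>}"
      then obtain a where a: "a \<in> carrier F" "a \<noteq> \<zero>\<^bsub>F\<^esub>" "x = i a" by (auto simp: F)
      then show "x \<in> Units ?F" using R0.unit_inv[OF a(1,2)] by (auto simp: Units_def F)
    qed
  qed
  show ?thesis
  proof
    fix a x assume "a \<in> carrier ?F" "x \<in> carrier ?V"
    then show "a \<odot>\<^bsub>?V\<^esub> x \<in> carrier ?V" by (auto simp: F V R.rsmult_closed)
  next
    fix a b x assume "a \<in> carrier ?F" "b \<in> carrier ?F" "x \<in> carrier ?V"
    then show "(a \<oplus>\<^bsub>?F\<^esub> b) \<odot>\<^bsub>?V\<^esub> x = a \<odot>\<^bsub>?V\<^esub> x \<oplus>\<^bsub>?V\<^esub> b \<odot>\<^bsub>?V\<^esub> x"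
      "(a \<otimes>\<^bsub>?F\<^esub> b) \<odot>\<^bsub>?V\<^esub> x = b \<odot>\<^bsub>?V\<^esub> (a \<odot>\<^bsub>?V\<^esub> x)"
      by (auto simp: F V R.rsmult_distr_scalar R.rsmult_assoc)
  next
    fix a x y assume "a \<in> carrier ?F" "x \<in> carrier ?V" "y \<in> carrier ?V"
    then show "a \<odot>\<^bsub>?V\<^esub> (x \<oplus>\<^bsub>?V\<^esub> y) = a \<odot>\<^bsub>?V\<^esub> x \<oplus>\<^bsub>?V\<^esub> a \<odot>\<^bsub>?V\<^esub> y"
      by (auto simp: F V R.rsmult_distr_vector)
  next
    fix x assume "x \<in> carrier ?V"
    then show "\<one>\<^bsub>?F\<^esub> \<odot>\<^bsub>?V\<^esub> x = x" by (auto simp: F V R.rsmult_one)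
  qed
qed

context right_vector_space
begin

lemma span_empty: "span {} = {\<zero>\<^bsub>V\<^esub>}"
proof -
  have "w = \<zero>\<^bsub>V\<^esub>" if "w \<in> span {}" for w using that by (induction w rule: span.induct) auto
  then show ?thesis using span_zero by auto
qed

lemma span_insert_zero: "span (insert \<zero>\<^bsub>V\<^esub> X) = span X"
proof
  have "w \<in> span X" if "w \<in> span (insert \<zero>\<^bsub>V\<^esub> X)" for w
    using that
  proof (induction w rule: span.induct)
    case (span_step u x a)
    then show ?case using span.span_step[of u X x a] smult_vzero[of a] span_carrier[of u X] by auto
  qed (rule span_zero)
  then show "span (insert \<zero>\<^bsub>V\<^esub> X) \<subseteq> span X" by auto
qed (rule span_mono, auto)

end

context modular_space
begin

lemma coordinatized_copy:
  fixes F :: "'a ring" and V :: "('a, 'b) module" and i :: "'a \<Rightarrow> 'f" and j :: "'b \<Rightarrow> 'v"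
  assumes c: "coordinatized F V \<phi>" and i: "inj i" and j: "inj j"
  shows "coordinatized (ring_copy i F) (module_copy i j V) (\<lambda>p. j (\<phi> p))"
proof -
  note [simp] = inv_f_f[OF i] inv_f_f[OF j] inj_eq[OF i] inj_eq[OF j]
  let ?F = "ring_copy i F" and ?V = "module_copy i j V"
  have F: "carrier ?F = i ` carrier F" "zero ?F = i \<zero>\<^bsub>F\<^esub>" by (auto simp: ring_copy_def)
  have V: "carrier ?V = j ` carrier V" "zero ?V = j \<zero>\<^bsub>V\<^esub>" "add ?V x y = j (inv_into UNIV j x \<oplus>\<^bsub>V\<^esub> inv_into UNIV j y)"
    "smult ?V a x = j (inv_into UNIV i a \<odot>\<^bsub>V\<^esub> inv_into UNIV j x)" for a x y by (auto simp: module_copy_def)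
  have nz: "carrier ?F - {\<zero>\<^bsub>?F\<^esub>} = i ` (carrier F - {\<zero>\<^bsub>F\<^esub>})" using i by (auto simp: F)
  have "dependent3 ?F ?V (j u) (j v) (j w) \<longleftrightarrow> dependent3 F V u v w" for u v w
    unfolding dependent3_def nz by (simp add: V)
  then show ?thesis
    using c right_vector_space_copy[OF _ i j, of F V] unfolding coordinatized_def nz
    by (auto simp: F V)
qed

lemma spanned_iff_span:
  assumes c: "coordinatized F V \<phi>" and X: "finite X" "X \<subseteq> P" and z: "z \<in> P"
  shows "spanned X z \<longleftrightarrow> \<phi> z \<in> right_vector_space.span F V (\<phi> ` X)"
proof -
  interpret V0: skew_field F using c by (simp add: coordinatized_def right_vector_space_def)
  interpret V: right_vector_space F V using c by (simp add: coordinatized_def)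
  have cV: "\<phi> p \<in> carrier V" "\<phi> p \<noteq> \<zero>\<^bsub>V\<^esub>" if "p \<in> P" for p using c that by (auto simp: coordinatized_def)
  have cdep: "col p q s \<longleftrightarrow> dependent3 F V (\<phi> p) (\<phi> q) (\<phi> s)"
    if "p \<in> P" "q \<in> P" "s \<in> P" "p \<noteq> q" "p \<noteq> s" "q \<noteq> s" for p q s using c that unfolding coordinatized_def by blast
  have cinj: "p = q" if "p \<in> P" "q \<in> P" "a \<in> carrier F" "\<phi> p = a \<odot>\<^bsub>V\<^esub> \<phi> q" for p q a
    using c that unfolding coordinatized_def by blast
  have csurj: "\<exists>p\<in>P. \<exists>a\<in>carrier F - {\<zero>\<^bsub>F\<^esub>}. v = a \<odot>\<^bsub>V\<^esub> \<phi> p" if "v \<in> carrier V" "v \<noteq> \<zero>\<^bsub>V\<^esub>" for v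
    using c that unfolding coordinatized_def by blast
  show ?thesis using X z
  proof (induction X arbitrary: z rule: finite_induct)
    case empty
    then show ?case using cV V.span_empty P1 rank_empty by (auto simp: spanned_def)
  next
    case (insert q X)
    have q: "q \<in> P" "X \<subseteq> P" using insert by auto
    let ?Y = "insert q X"
    have fY: "finite ?Y" using insert by auto
    have m: "V.span (\<phi> ` X) \<subseteq> V.span (\<phi> ` ?Y)" by (rule V.span_mono) auto
    have sp: "spanned ?Y x" if "spanned X x" for x by (rule spanned_mono[OF _ _ _ _ that]) (use fY in auto)
    have qY: "\<phi> q \<in> V.span (\<phi> ` ?Y)" using V.span_base cV q by auto
    show ?case
    proof
      assume s: "spanned ?Y z"
      consider "spanned X z" | "z = q" | "\<not> spanned X z" "z \<noteq> q" by blast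
      then show "\<phi> z \<in> V.span (\<phi> ` ?Y)"
      proof cases
        case 1
        then show ?thesis using insert.IH[OF q(2) insert.prems(2)] m by auto
      next
        case 2
        then show ?thesis using qY by simp
      next
        case 3
        have nq: "\<not> spanned X q"
        proof
          assume "spanned X q"
          then have "spanned X z" by (intro spanned_trans[of X ?Y z]) (use fY s spanned_base in auto)
          then show False using 3 by simp
        qed
        have "\<rho> ({z, q} \<union> X) = \<rho> X + 1" using s nq not_spanned[of X q] insert.hyps by (simp add: spanned_def insert_commute)
        then have "\<rho> ({z, q} \<union> X) < \<rho> {z, q} + \<rho> X" using P2[OF insert.prems(2) q(1) 3(2)] by simp
        then obtain x where x: "x \<in> P" "spanned {z, q} x" "spanned X x" using meet_point[of "{z, q}" X] insert.hyps by auto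
        have n: "z \<noteq> x" "q \<noteq> x" using 3 nq x by auto
        have "col z q x" using col_spanned[OF insert.prems(2) q(1) 3(2)] x by simp
        then have "dependent3 F V (\<phi> z) (\<phi> q) (\<phi> x)" using cdep[OF insert.prems(2) q(1) x(1) 3(2) n] by simp
        then obtain a b c' where abc: "a \<in> carrier F" "a \<noteq> \<zero>\<^bsub>F\<^esub>" "b \<in> carrier F" "c' \<in> carrier F"
          "a \<odot>\<^bsub>V\<^esub> \<phi> z \<oplus>\<^bsub>V\<^esub> (b \<odot>\<^bsub>V\<^esub> \<phi> q \<oplus>\<^bsub>V\<^esub> c' \<odot>\<^bsub>V\<^esub> \<phi> x) = \<zero>\<^bsub>V\<^esub>" unfolding dependent3_def by blast
        have xY: "\<phi> x \<in> V.span (\<phi> ` ?Y)" using insert.IH[OF q(2) x(1)] x(3) m by auto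
        have w: "b \<odot>\<^bsub>V\<^esub> \<phi> q \<oplus>\<^bsub>V\<^esub> c' \<odot>\<^bsub>V\<^esub> \<phi> x \<in> V.span (\<phi> ` ?Y)"
          using V.span_add[OF V.span_smult[OF qY abc(3)] V.span_smult[OF xY abc(4)]] .
        have az: "a \<odot>\<^bsub>V\<^esub> \<phi> z \<in> carrier V" using V.rsmult_closed abc(1) cV insert.prems by auto
        have "(b \<odot>\<^bsub>V\<^esub> \<phi> q \<oplus>\<^bsub>V\<^esub> c' \<odot>\<^bsub>V\<^esub> \<phi> x) \<oplus>\<^bsub>V\<^esub> a \<odot>\<^bsub>V\<^esub> \<phi> z = \<zero>\<^bsub>V\<^esub>"
          using abc(5) V.V.a_comm[OF az V.span_carrier[OF w]] by simp
        then have "a \<odot>\<^bsub>V\<^esub> \<phi> z \<in> V.span (\<phi> ` ?Y)" using V.span_cancel[OF w _ az] V.span_zero by simp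
        then show ?thesis using V.span_smult_cancel abc(1,2) cV(1)[OF insert.prems(2)] by blast
      qed
    next
      assume "\<phi> z \<in> V.span (\<phi> ` ?Y)"
      then obtain a w where aw: "a \<in> carrier F" "w \<in> V.span (\<phi> ` X)" "\<phi> z = a \<odot>\<^bsub>V\<^esub> \<phi> q \<oplus>\<^bsub>V\<^esub> w"
        using V.span_insert[of "\<phi> z" "\<phi> q" "\<phi> ` X"] cV[OF q(1)] by auto
      have aq: "a \<odot>\<^bsub>V\<^esub> \<phi> q \<in> carrier V" using V.rsmult_closed aw(1) cV q by auto
      show "spanned ?Y z"
      proof (cases "w = \<zero>\<^bsub>V\<^esub>")
        case True
        then have "z = q" using cinj[OF insert.prems(2) q(1) aw(1)] aw(3) aq by simp
        then show ?thesis using spanned_base by simp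
      next
        case False
        then obtain x b where x: "x \<in> P" "b \<in> carrier F" "b \<noteq> \<zero>\<^bsub>F\<^esub>" "w = b \<odot>\<^bsub>V\<^esub> \<phi> x"
          using csurj[OF V.span_carrier[OF aw(2)]] by blast
        have bx: "b \<odot>\<^bsub>V\<^esub> \<phi> x \<in> carrier V" using V.rsmult_closed x(2) cV(1)[OF x(1)] by auto
        have "\<phi> x \<in> V.span (\<phi> ` X)" using V.span_smult_cancel[of b "\<phi> x"] aw(2) x cV(1)[OF x(1)] by simp
        then have sx: "spanned ?Y x" using insert.IH[OF q(2) x(1)] sp by simp
        show ?thesis
        \<comment> \<open>These are the degenerate cases in which a coefficient vanishes or two of
          the points coincide, so that \<open>dependent3\<close> cannot be translated into
          collinearity.\<close>
        proof (cases "a = \<zero>\<^bsub>F\<^esub> \<or> z = q \<or> z = x \<or> q = x")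
          case True
          then show ?thesis
          proof (elim disjE)
            assume "a = \<zero>\<^bsub>F\<^esub>"
            then have "\<phi> z = b \<odot>\<^bsub>V\<^esub> \<phi> x" using aw(3) x(4) V.smult_zero[OF cV(1)[OF q(1)]] bx by simp
            then show ?thesis using cinj[OF insert.prems(2) x(1,2)] sx by simp
          next
            assume "z = q" then show ?thesis using spanned_base by simp
          next
            assume "z = x" then show ?thesis using sx by simp
          next
            assume "q = x"
            then have "\<phi> z = (a \<oplus>\<^bsub>F\<^esub> b) \<odot>\<^bsub>V\<^esub> \<phi> q"
              using aw(3) x(4) V.rsmult_distr_scalar[OF aw(1) x(2) cV(1)[OF q(1)]] by simp
            then have "z = q" using cinj[OF insert.prems(2) q(1) V0.a_closed[OF aw(1) x(2)]] by simp
            then show ?thesis using spanned_base by simp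
          qed
        next
          case f: False
          have zc: "\<phi> z \<in> carrier V" using cV insert.prems by simp
          have "(\<ominus>\<^bsub>F\<^esub> \<one>\<^bsub>F\<^esub>) \<odot>\<^bsub>V\<^esub> \<phi> z \<oplus>\<^bsub>V\<^esub> (a \<odot>\<^bsub>V\<^esub> \<phi> q \<oplus>\<^bsub>V\<^esub> b \<odot>\<^bsub>V\<^esub> \<phi> x) = \<zero>\<^bsub>V\<^esub>"
            using aw(3) x(4) V.smult_minus_one[OF zc] V.V.l_neg[OF zc] by simp
          then have "dependent3 F V (\<phi> z) (\<phi> q) (\<phi> x)"
            unfolding dependent3_def using V0.neg_one aw(1) x f by blast
          then have "col z q x" using cdep[OF insert.prems(2) q(1) x(1)] f by simp
          then have "col q x z" using col_perm by blast
          then have "spanned {q, x} z" using col_spanned[OF q(1) x(1)] f by simp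
          then show ?thesis by (intro spanned_trans[of ?Y "{q, x}" z]) (use fY sx spanned_base in auto)
        qed
      qed
    qed
  qed
qed

text \<open>Extends the coordinates from the chosen points to all elements: parallel elements share
  one vector, and loops get \<open>z0\<close>, for which the zero vector is inserted.\<close>

definition vec :: "'v \<Rightarrow> ('p \<Rightarrow> 'v) \<Rightarrow> 'p \<Rightarrow> 'v" where
  "vec z0 \<phi> z = (if \<rho> {z} = 1 then \<phi> (SOME x. x \<in> P \<and> spanned {x} z \<and> spanned {z} x) else z0)"

lemma indep_iff:
  fixes F :: "'f ring" and V :: "('f, 'v) module"
  assumes c: "coordinatized F V \<phi>" and X: "finite X"
  shows "vec \<zero>\<^bsub>V\<^esub> \<phi> z \<in> carrier V" "lin_indep_family F V (vec \<zero>\<^bsub>V\<^esub> \<phi>) X \<longleftrightarrow> \<rho> X = card X"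
proof -
  interpret V: right_vector_space F V using c by (simp add: coordinatized_def)
  define rep where "rep z = (SOME x. x \<in> P \<and> spanned {x} z \<and> spanned {z} x)" for z
  have rep: "rep z \<in> P" "spanned {rep z} z" "spanned {z} (rep z)" if "\<rho> {z} = 1" for z
    using someI_ex[of "\<lambda>x. x \<in> P \<and> spanned {x} z \<and> spanned {z} x"] P_rep[OF that] unfolding rep_def by blast+
  let ?v = "vec \<zero>\<^bsub>V\<^esub> \<phi>"
  have v1: "?v z = \<phi> (rep z)" if "\<rho> {z} = 1" for z using that by (simp add: vec_def rep_def)
  have v0: "?v z = \<zero>\<^bsub>V\<^esub>" if "\<rho> {z} \<noteq> 1" for z using that by (simp add: vec_def)
  have vV: "?v z \<in> carrier V" for z
    using v0[of z] v1[of z] rep(1)[of z] c unfolding coordinatized_def by (cases "\<rho> {z} = 1") auto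
  then show "?v z \<in> carrier V" .
  \<comment> \<open>Replacing the non-loops of \<open>X\<close> by their representatives
    \<open>Y\<close> changes neither the closure nor the span, which reduces the claim to
    points.\<close>
  have sv: "spanned X z \<longleftrightarrow> ?v z \<in> V.span (?v ` X)" if X: "finite X" for X z
  proof -
    define Y where "Y = rep ` {x \<in> X. \<rho> {x} = 1}"
    have Y: "finite Y" "Y \<subseteq> P" using X rep by (auto simp: Y_def)
    have loop: "spanned W x" if "\<rho> {x} \<noteq> 1" "finite W" for x W
    proof -
      have "\<rho> {x} \<le> card {x}" by (rule le_card) auto
      then have "spanned {} x" using that rank_empty by (simp add: spanned_def)
      then show ?thesis by (rule spanned_mono[rotated -1]) (use that in auto)
    qed
    have XY: "spanned Y x" if "x \<in> X" for x
    proof (cases "\<rho> {x} = 1")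
      case True
      then show ?thesis using rep(2)[OF True] that
        by (intro spanned_mono[of Y "{rep x}" x]) (auto simp: Y_def X)
    qed (use loop Y in auto)
    have YX: "spanned X y" if y: "y \<in> Y" for y
    proof -
      obtain x where "x \<in> X" "\<rho> {x} = 1" "y = rep x" using y by (auto simp: Y_def)
      then show ?thesis using rep(3)[of x] by (intro spanned_mono[of X "{x}" y]) (auto simp: X)
    qed
    have XYs: "spanned X w \<longleftrightarrow> spanned Y w" for w
      using spanned_trans[OF X subset_UNIV Y(1) subset_UNIV YX UNIV_I, of w]
        spanned_trans[OF Y(1) subset_UNIV X subset_UNIV XY UNIV_I, of w] by blast
    have 1: "?v ` X \<subseteq> insert \<zero>\<^bsub>V\<^esub> (\<phi> ` Y)"
    proof (intro image_subsetI)
      fix x assume "x \<in> X"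
      then show "?v x \<in> insert \<zero>\<^bsub>V\<^esub> (\<phi> ` Y)" using v0[of x] v1[of x] by (cases "\<rho> {x} = 1") (auto simp: Y_def)
    qed
    have 2: "\<phi> ` Y \<subseteq> ?v ` X"
    proof (intro image_subsetI)
      fix y assume "y \<in> Y"
      then obtain x where "x \<in> X" "\<rho> {x} = 1" "y = rep x" by (auto simp: Y_def)
      then show "\<phi> y \<in> ?v ` X" using v1[of x] by (intro image_eqI[of _ _ x]) auto
    qed
    have spe: "V.span (?v ` X) = V.span (\<phi> ` Y)"
      using V.span_mono[OF 1] V.span_mono[OF 2] unfolding V.span_insert_zero by (rule equalityI)
    show ?thesis
    proof (cases "\<rho> {z} = 1")
      case False
      then show ?thesis using loop[OF False X] v0[OF False] V.span_zero by simp
    next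
      case True
      have "spanned X z \<longleftrightarrow> spanned X (rep z)"
      proof
        assume "spanned X z"
        then show "spanned X (rep z)"
          by (intro spanned_trans[of X "{z}" "rep z"]) (use X rep(3)[OF True] in auto)
      next
        assume "spanned X (rep z)"
        then show "spanned X z"
          by (intro spanned_trans[of X "{rep z}" z]) (use X rep(2)[OF True] in auto)
      qed
      then show ?thesis using XYs spanned_iff_span[OF c Y rep(1)[OF True]] spe v1[OF True] by simp
    qed
  qed
  show "lin_indep_family F V ?v X \<longleftrightarrow> \<rho> X = card X" using X
  proof (induction X rule: finite_induct)
    case empty
    then show ?case by (simp add: lin_indep_family_def rank_empty)
  next
    case (insert x X)
    have "lin_indep_family F V ?v (insert x X) \<longleftrightarrow> lin_indep_family F V ?v X \<and> ?v x \<notin> V.span (?v ` X)"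
      by (rule lin_indep_insert[OF V.right_vector_space_axioms insert.hyps]) (use vV in auto)
    then show ?case using insert.IH sv[OF insert.hyps(1)] indep_insert[of X x] insert.hyps by simp
  qed
qed

end

section \<open>Connected matroids\<close>

text \<open>The choice is made from the parallel class as a set; parallel elements have equal
  classes and hence the same representative.\<close>

lemma (in modular_rank) modular_points_ex: "\<exists>P. modular_points \<rho> n P"
proof -
  define cls where "cls z = {x. \<rho> {x} = 1 \<and> spanned {x} z \<and> spanned {z} x}" for z
  define pt where "pt z = (SOME x. x \<in> cls z)" for z
  have pt: "pt z \<in> cls z" if "\<rho> {z} = 1" for z
    using that spanned_base[of z "{z}"] someI[of "\<lambda>x. x \<in> cls z" z] by (auto simp: pt_def cls_def)
  have transl: "spanned {x} z" if "spanned {x} y" "spanned {y} z" for x y z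
    by (rule spanned_trans[of "{x}" "{y}"]) (use that in auto)
  have cls_eq: "cls x = cls y" if "spanned {x} y" "spanned {y} x" for x y
    using transl that unfolding cls_def by blast
  have "modular_points \<rho> n (pt ` {z. \<rho> {z} = 1})"
  proof unfold_locales
    fix x assume "x \<in> pt ` {z. \<rho> {z} = 1}"
    then show "\<rho> {x} = 1" using pt by (auto simp: cls_def)
  next
    fix x y assume "x \<in> pt ` {z. \<rho> {z} = 1}" "y \<in> pt ` {z. \<rho> {z} = 1}" "x \<noteq> y"
    then obtain a b where ab: "\<rho> {a} = 1" "\<rho> {b} = 1" "x = pt a" "y = pt b" by auto
    then have xy: "x \<in> cls a" "y \<in> cls b" using pt by auto
    have "\<not> spanned {x} y"
    proof
      assume s: "spanned {x} y"
      then have "spanned {y} x" using xy by (auto simp: cls_def spanned_def insert_commute)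
      then have 1: "cls x = cls y" using cls_eq s by blast
      have 2: "cls x = cls a" "cls y = cls b" using cls_eq xy unfolding cls_def by blast+
      have "cls a = cls b" using 1 2 by simp
      then have "pt a = pt b" unfolding pt_def by simp
      then show False using ab(3,4) \<open>x \<noteq> y\<close> by simp
    qed
    then show "\<rho> {x, y} = 2" using not_spanned[of "{x}" y] xy by (auto simp: cls_def insert_commute)
  next
    fix z assume z: "\<rho> {z} = 1"
    then show "\<exists>x\<in>pt ` {z. \<rho> {z} = 1}. spanned {x} z \<and> spanned {z} x"
      using pt[OF z] by (intro bexI[of _ "pt z"]) (auto simp: cls_def)
  qed
  then show ?thesis by blast
qed

section \<open>Lines with a third point\<close>

context modular_points
begin

definition linked :: "'p \<Rightarrow> 'p \<Rightarrow> bool" where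
  "linked x y \<longleftrightarrow> x = y \<or> (\<exists>z\<in>P. z \<noteq> x \<and> z \<noteq> y \<and> col x y z)"

lemma linked_sym: "linked x y \<Longrightarrow> linked y x"
  unfolding linked_def using col_perm by blast

text \<open>If \<open>x\<close>, \<open>y\<close>, \<open>w\<close> are collinear, \<open>y\<close>
  is the third point. Otherwise take third points \<open>a\<close> on \<open>x y\<close> and
  \<open>b\<close> on \<open>y w\<close>: the lines \<open>a b\<close> and \<open>x w\<close> lie in
  one plane and meet in a point \<open>c\<close>, and \<open>c\<close> equal to \<open>x\<close> or
  \<open>w\<close> would make the triangle degenerate.\<close>

lemma linked_trans:
  assumes P: "x \<in> P" "y \<in> P" "w \<in> P" and l: "linked x y" "linked y w"
  shows "linked x w"
proof (cases "x = y \<or> y = w \<or> x = w \<or> col x y w")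
  case True
  show ?thesis
  proof (cases "x = y \<or> y = w \<or> x = w")
    case True
    then show ?thesis using l by (auto simp: linked_def)
  next
    case False
    then have "col x w y" using True col_perm(2) by blast
    then show ?thesis using False P(2) unfolding linked_def by metis
  qed
next
  case False
  then have n: "x \<noteq> y" "y \<noteq> w" "x \<noteq> w" "\<not> col x y w" by auto
  obtain a where a: "a \<in> P" "a \<noteq> x" "a \<noteq> y" "col x y a" using l n by (auto simp: linked_def)
  obtain b where b: "b \<in> P" "b \<noteq> y" "b \<noteq> w" "col y w b" using l n by (auto simp: linked_def)
  have bxy: "\<not> col x y b"
  proof
    assume "col x y b"
    then have "col y b x" using col_perm by blast
    moreover have "col y b w" using b(4) col_perm by blast
    ultimately have "col y x w" using col_trans(1)[OF P(2) b(1) b(2)[symmetric]] by blast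
    then show False using n col_perm by blast
  qed
  have awy: "\<not> col y w a"
  proof
    assume "col y w a"
    then have "col y a w" using col_perm by blast
    moreover have "col y a x" using a(4) col_perm by blast
    ultimately have "col y x w" using col_trans(1)[OF P(2) a(1) a(3)[symmetric]] by blast
    then show False using n col_perm by blast
  qed
  have ab: "a \<noteq> b" using a(4) bxy by auto
  have s: "spanned {x, y} a" "spanned {y, w} b"
    using col_spanned[OF P(1,2) n(1)] col_spanned[OF P(2,3) n(2)] a b by auto
  have s': "spanned {x, y, w} a" "spanned {x, y, w} b"
    using spanned_mono[OF _ _ _ _ s(1), of "{x, y, w}"] spanned_mono[OF _ _ _ _ s(2), of "{x, y, w}"] by auto
  have "\<rho> ({x, y, w} \<union> {a, b}) = \<rho> {x, y, w}" by (rule rank_union_spanned) (use s' in auto)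
  moreover have "\<rho> ({a, b} \<union> {x, w}) \<le> \<rho> ({x, y, w} \<union> {a, b})" by (rule mono) auto
  moreover have "\<rho> {x, y, w} \<le> 3" using le_card[of "{x, y, w}"] n by auto
  ultimately have "\<rho> ({a, b} \<union> {x, w}) < \<rho> {a, b} + \<rho> {x, w}" using P2[OF a(1) b(1) ab] P2[OF P(1,3) n(3)] by simp
  then obtain c where c: "c \<in> P" "spanned {a, b} c" "spanned {x, w} c" using meet_point[of "{a, b}" "{x, w}"] by auto
  have cc: "col a b c" "col x w c" using col_spanned[OF a(1) b(1) ab] col_spanned[OF P(1,3) n(3)] c by auto
  have "c \<noteq> x"
  proof
    assume "c = x"
    then have "col a x b" using cc col_perm by blast
    moreover have "col a x y" using a(4) col_perm by blast
    ultimately have "col x y b" using col_trans(2)[OF a(1) P(1) a(2)] by blast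
    then show False using bxy by simp
  qed
  moreover have "c \<noteq> w"
  proof
    assume "c = w"
    then have "col b w a" using cc col_perm by blast
    moreover have "col b w y" using b(4) col_perm by blast
    ultimately have "col w y a" using col_trans(2)[OF b(1) P(3) b(3)] by blast
    then show False using awy col_perm by blast
  qed
  ultimately show ?thesis using c cc by (auto simp: linked_def)
qed

definition rep :: "'p \<Rightarrow> 'p" where
  "rep z = (SOME x. x \<in> P \<and> spanned {x} z \<and> spanned {z} x)"

lemma rep: "\<rho> {z} = 1 \<Longrightarrow> rep z \<in> P" "\<rho> {z} = 1 \<Longrightarrow> spanned {rep z} z" "\<rho> {z} = 1 \<Longrightarrow> spanned {z} (rep z)"
  using someI_ex[of "\<lambda>x. x \<in> P \<and> spanned {x} z \<and> spanned {z} x"] P_rep[of z] unfolding rep_def by blast+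

lemma rep_point: "p \<in> P \<Longrightarrow> rep p = p"
  using rep(1)[of p] rep(2)[of p] P1[of p] P1[of "rep p"] P2[of p "rep p"] by (force simp: spanned_def)

text \<open>Two elements of a circuit are linked by the point where their line meets the flat of the others.\<close>

lemma linked_circuit:
  assumes i: "\<rho> {i} = 1" and j: "\<rho> {j} = 1" and D: "finite D"
    and r: "\<rho> ({i, j} \<union> D) < 2 + \<rho> D" "\<not> spanned D i" "\<not> spanned D j"
  shows "linked (rep i) (rep j)"
proof (cases "rep i = rep j")
  case True then show ?thesis by (simp add: linked_def)
next
  case False
  have ij: "spanned {i, j} (rep i)" "spanned {i, j} (rep j)"
    using spanned_mono[OF _ _ _ _ rep(3)[OF i], of "{i, j}"] spanned_mono[OF _ _ _ _ rep(3)[OF j], of "{i, j}"] by auto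
  have ij': "spanned {rep i, rep j} i" "spanned {rep i, rep j} j"
    using spanned_mono[OF _ _ _ _ rep(2)[OF i], of "{rep i, rep j}"] spanned_mono[OF _ _ _ _ rep(2)[OF j], of "{rep i, rep j}"] by auto
  have "\<rho> ({i, j} \<union> {rep i, rep j}) = \<rho> {i, j}" by (rule rank_union_spanned) (use ij in auto)
  moreover have "\<rho> {rep i, rep j} \<le> \<rho> ({i, j} \<union> {rep i, rep j})" by (rule mono) auto
  moreover have "\<rho> {rep i, rep j} = 2" by (rule P2[OF rep(1)[OF i] rep(1)[OF j] False])
  ultimately have "\<rho> ({i, j} \<union> D) < \<rho> {i, j} + \<rho> D" using r by simp
  then obtain z where z: "z \<in> P" "spanned {i, j} z" "spanned D z" using meet_point[of "{i, j}" D] D by auto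
  have "spanned {rep i, rep j} z" by (rule spanned_trans[OF _ _ _ _ _ _ z(2)]) (use ij' in auto)
  then have "col (rep i) (rep j) z" using col_spanned[OF rep(1)[OF i] rep(1)[OF j] False] by simp
  moreover have "z \<noteq> rep i"
  proof
    assume "z = rep i"
    then have "spanned D i" by (intro spanned_trans[of D "{rep i}" i]) (use D z rep(2)[OF i] in auto)
    then show False using r by simp
  qed
  moreover have "z \<noteq> rep j"
  proof
    assume "z = rep j"
    then have "spanned D j" by (intro spanned_trans[of D "{rep j}" j]) (use D z rep(2)[OF j] in auto)
    then show False using r by simp
  qed
  ultimately show ?thesis using z by (auto simp: linked_def)
qed

text \<open>A minimal subset of \<open>B\<close> that spans \<open>p\<close> forms a circuit
  together with \<open>p\<close>; any of its elements is linked to \<open>p\<close>. Thus links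
  between all points reduce to links between elements of \<open>B\<close>.\<close>

lemma linked_basis:
  assumes B: "finite B" "\<rho> B = n" "\<rho> B = card B" and p: "p \<in> P"
  shows "\<exists>x\<in>B. \<rho> {x} = 1 \<and> linked p (rep x)"
proof -
  let ?A = "{X. X \<subseteq> B \<and> spanned X p}"
  have "\<rho> (insert p B) = \<rho> B" using bounded[of "insert p B"] mono[of "insert p B" B, OF _ subset_insertI] B by simp
  then have ne: "?A \<noteq> {}" by (auto simp: spanned_def)
  have "finite ?A" using B by auto
  from finite_has_minimal[OF this ne]
  obtain X where X: "X \<in> ?A" "\<forall>Y\<in>?A. Y \<subseteq> X \<longrightarrow> X = Y" by (rule bexE)
  have "X \<noteq> {}" using X(1) P1[OF p] rank_empty by (auto simp: spanned_def)
  then obtain x where x: "x \<in> X" by blast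
  define D where "D = X - {x}"
  have fX: "finite X" "X \<subseteq> B" using X(1) B finite_subset by auto
  have D: "finite D" "x \<notin> D" "insert x D = X" using fX x by (auto simp: D_def)
  have ind: "\<rho> Y = card Y" if "Y \<subseteq> B" for Y using indep_subset[OF B(1) _ B(3) that] by simp
  have x1: "\<rho> {x} = 1" using ind[of "{x}"] x fX by auto
  have nD: "\<not> spanned D p" using X(2) x fX unfolding D_def by blast
  have nx: "\<not> spanned D x" using ind[of X] ind[of D] fX D by (auto simp: spanned_def)
  have rD: "\<rho> D = card D" by (rule ind) (use fX in \<open>auto simp: D_def\<close>)
  have "{p, x} \<union> D = insert p X" using D by auto
  then have "\<rho> ({p, x} \<union> D) = \<rho> X" using X(1) by (simp add: spanned_def)
  also have "\<dots> = card X" using ind fX by simp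
  also have "\<dots> < 2 + \<rho> D" using card_insert_disjoint[OF D(1,2)] D(3) rD by simp
  finally have "linked (rep p) (rep x)" using linked_circuit[OF P1[OF p] x1 D(1)] nD nx by simp
  then show ?thesis using rep_point[OF p] x fX x1 by auto
qed

end

section \<open>From the extended geometry back to the matroid\<close>

lemma extendable_imp_skew_representable:
  fixes S :: "'a::infinite set"
  assumes S: "rank_matroid S r" and con: "matroid_connected S r" and r4: "r S \<ge> 4"
    and ext: "fully_modular_extendable S r"
  shows "skew_representable TYPE('f::infinite) TYPE('v::infinite) S r"
proof -
  have fS: "finite S" using S rank_matroid.finite_ground by blast
  define m where "m = card S"
  obtain h where h: "bij_betw h {..<m} S" using ex_bij_betw_nat_finite[OF fS] by (auto simp: m_def atLeast0LessThan)
  have hS: "h ` {..<m} = S" "inj_on h {..<m}" using h by (auto simp: bij_betw_def)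
  have "0 < r S" using r4 by simp
  from modular_limit[OF S this ext hS(1)] obtain \<rho> :: "nat set \<Rightarrow> nat" where
    \<rho>: "rank_fun UNIV \<rho>" "\<And>X. finite X \<Longrightarrow> \<rho> X \<le> r S" "\<And>X. X \<subseteq> {..<m} \<Longrightarrow> \<rho> X = r (h ` X)"
    "\<And>A B. finite A \<Longrightarrow> finite B \<Longrightarrow> \<exists>Z. finite Z \<and> meets \<rho> A B Z" by blast
  interpret R: rank_fun UNIV \<rho> by fact
  interpret M: modular_rank \<rho> "r S" by unfold_locales (use \<rho> in auto)
  obtain P where "modular_points \<rho> (r S) P" using M.modular_points_ex by blast
  then interpret Q: modular_points \<rho> "r S" P .
  have lS: "Q.linked (Q.rep i) (Q.rep j)" if ij: "i < m" "j < m" "\<rho> {i} = 1" "\<rho> {j} = 1" for i j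
  proof (cases "i = j")
    case True then show ?thesis by (simp add: Q.linked_def)
  next
    case False
    have "h i \<in> S" "h j \<in> S" "h i \<noteq> h j" using hS ij False by (auto simp: inj_on_def)
    then obtain C where C: "matroid_circuit S r C" "h i \<in> C" "h j \<in> C" using con unfolding matroid_connected_def by blast
    define C' where "C' = {k. k < m \<and> h k \<in> C}"
    have C': "C' \<subseteq> {..<m}" "finite C'" "i \<in> C'" "j \<in> C'" "h ` C' = C"
      using C ij hS by (auto simp: C'_def matroid_circuit_def)
    have card: "card (h ` X) = card X" if "X \<subseteq> C'" for X
      using that C' hS by (intro card_image) (meson inj_on_subset order.trans)
    have dep: "\<rho> C' \<noteq> card C'"
      using C(1) \<rho>(3)[OF C'(1)] card[of C'] C'(5) by (auto simp: matroid_circuit_def matroid_indep_def)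
    have ind: "\<rho> X = card X" if X: "X \<subset> C'" for X
    proof -
      obtain k where k: "k \<in> C'" "k \<notin> X" using X by blast
      have "h k \<notin> h ` X" using k X C'(1) hS(2) unfolding inj_on_def by blast
      then have "h ` X \<subset> C" using X C'(5) k by blast
      then have "r (h ` X) = card (h ` X)" using C(1) by (auto simp: matroid_circuit_def matroid_indep_def)
      then show ?thesis using \<rho>(3)[of X] X C' card[of X] by auto
    qed
    \<comment> \<open>Removing one element from the circuit leaves an independent set, so
      \<open>D\<close> spans neither \<open>i\<close> nor \<open>j\<close>, while the whole circuit
      has rank below \<open>card D + 2\<close>.\<close>
    define D where "D = C' - {i, j}"
    have fD: "finite D" "i \<notin> D" "j \<notin> D" using C'(2) unfolding D_def by auto
    have sub: "D \<subset> C'" "insert i D \<subset> C'" "insert j D \<subset> C'"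

    proof -
      show "D \<subset> C'" using C'(3) unfolding D_def by blast
      have "insert i D \<subseteq> C'" "insert j D \<subseteq> C'" using C'(3,4) unfolding D_def by blast+
      moreover have "j \<notin> insert i D" "i \<notin> insert j D" using fD False by simp_all
      ultimately show "insert i D \<subset> C'" "insert j D \<subset> C'" using C'(3,4) by blast+
    qed
    have "{i, j} \<union> D = C'" using C'(3,4) unfolding D_def by blast
    moreover have "card C' = card D + 2"
    proof -
      have "C' = insert i (insert j D)" using C'(3,4) unfolding D_def by blast
      then show ?thesis using fD False by simp
    qed
    moreover have "\<rho> C' \<le> card C'" using R.le_card C' by simp
    ultimately have "\<rho> ({i, j} \<union> D) < 2 + \<rho> D" using dep ind[OF sub(1)] by simp
    moreover have "\<not> R.spanned D i" "\<not> R.spanned D j"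
      using ind[OF sub(1)] ind[OF sub(2)] ind[OF sub(3)] fD by (auto simp: R.spanned_def)
    ultimately show ?thesis using Q.linked_circuit ij fD by blast
  qed
  have fr: "\<rho> {..<m} = r S" using \<rho>(3)[of "{..<m}"] hS by simp
  obtain B where B: "B \<subseteq> {..<m}" "\<rho> B = card B" "\<rho> B = r S" using R.basis_ex[of "{..<m}"] fr by auto
  have fB: "finite B" using B finite_subset by blast
  \<comment> \<open>The basis \<open>B\<close> consists of labels of the original matroid: new
    points are linked to it, and connectedness links its elements to each other.\<close>
  have all: "Q.linked p q" if pq: "p \<in> P" "q \<in> P" for p q
  proof -
    obtain x where x: "x \<in> B" "\<rho> {x} = 1" "Q.linked p (Q.rep x)" using Q.linked_basis[OF fB B(3,2) pq(1)] by blast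
    obtain y where y: "y \<in> B" "\<rho> {y} = 1" "Q.linked q (Q.rep y)" using Q.linked_basis[OF fB B(3,2) pq(2)] by blast
    have "Q.linked (Q.rep x) (Q.rep y)" using lS x y B by auto
    then show ?thesis using Q.linked_trans Q.linked_sym Q.rep(1) pq x y by meson
  qed
  interpret N: modular_space \<rho> "r S" P
  proof unfold_locales
    fix x y assume xy: "x \<in> P" "y \<in> P" "x \<noteq> y"
    then obtain z where z: "z \<in> P" "z \<noteq> x" "z \<noteq> y" "Q.col x y z" using all[of x y] by (auto simp: Q.linked_def)
    have "\<rho> {x, y} \<le> \<rho> {x, y, z}" by (rule R.mono) auto
    then have "\<rho> {x, y, z} = 2" using z Q.P2[OF xy] by (simp add: Q.col_def)
    then show "\<exists>z\<in>P. z \<noteq> x \<and> z \<noteq> y \<and> \<rho> {x, y, z} = 2" using z by blast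
  next
    show "\<exists>B. finite B \<and> \<rho> B = r S" using fr by blast
    show "4 \<le> r S" by (rule r4)
  qed
  obtain F0 :: "nat ring" and V0 :: "(nat, nat \<times> nat) module" and \<phi>0 where c0: "N.coordinatized F0 V0 \<phi>0"
    using N.coordinatized_ex by blast
  \<comment> \<open>Scalars are natural numbers and vectors are pairs of them, so both can be
    embedded into any infinite type.\<close>
  obtain i :: "nat \<Rightarrow> 'f" where i: "inj i" using infinite_countable_subset[OF infinite_UNIV] by blast
  obtain j0 :: "nat \<Rightarrow> 'v" where j0: "inj j0" using infinite_countable_subset[OF infinite_UNIV] by blast
  define j where "j = (\<lambda>p. j0 (prod_encode p))"
  have j: "inj j" using inj_compose[OF j0, of prod_encode] inj_prod_encode by (simp add: j_def comp_def)
  define F where "F = ring_copy i F0"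
  define V where "V = module_copy i j V0"
  have c: "N.coordinatized F V (\<lambda>p. j (\<phi>0 p))" using N.coordinatized_copy[OF c0 i j] by (simp add: F_def V_def)
  define w where "w = N.vec \<zero>\<^bsub>V\<^esub> (\<lambda>p. j (\<phi>0 p))"
  define g where "g = inv_into {..<m} h"
  have g: "inj_on g S" "\<And>s. s \<in> S \<Longrightarrow> g s < m \<and> h (g s) = s"
    using h inv_into_into[of _ h "{..<m}"] f_inv_into_f[of _ h "{..<m}"] bij_betw_inv_into[OF h]
    by (auto simp: g_def bij_betw_def)
  have rv: "right_vector_space F V" using c by (simp add: N.coordinatized_def)
  have wV: "w k \<in> carrier V" for k using N.indep_iff(1)[OF c finite.emptyI] by (simp add: w_def)
  have "matroid_representation F V S r (\<lambda>s. w (g s))"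
    unfolding matroid_representation_def
  proof (intro conjI allI impI)
    fix X assume X: "X \<subseteq> S"
    have fX: "finite X" using X fS finite_subset by blast
    have cg: "card (g ` X) = card X" using g(1) X by (meson card_image inj_on_subset)
    have "h ` (g ` X) = X" using g(2) X by (auto simp: image_image subset_eq)
    moreover have "g ` X \<subseteq> {..<m}" using g(2) X by auto
    ultimately have "\<rho> (g ` X) = r X" using \<rho>(3) by simp
    moreover have "lin_indep_family F V w (g ` X) \<longleftrightarrow> \<rho> (g ` X) = card (g ` X)"
      unfolding w_def by (rule N.indep_iff(2)[OF c]) (use fX in simp)
    \<comment> \<open>Both families have the same set of vectors, and \<open>g\<close> is injective
      on \<open>X\<close>, so the rank criterion is the same for both.\<close>
    moreover have "lin_indep_family F V (\<lambda>s. w (g s)) X \<longleftrightarrow> lin_indep_family F V w (g ` X)"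
      using lin_indep_iff_rk[OF rv fX, of "\<lambda>s. w (g s)"] lin_indep_iff_rk[OF rv, of "g ` X" w] wV fX cg
      by (simp add: image_image)
    ultimately show "lin_indep_family F V (\<lambda>s. w (g s)) X = matroid_indep S r X"
      using cg X by (simp add: matroid_indep_def)
  qed (use rv wV in auto)
  then show ?thesis unfolding skew_representable_def by blast
qed

theorem corollary3p5:
  fixes S :: "'a::infinite set" and r :: "'a set \<Rightarrow> nat"
  assumes "rank_matroid S r"
    and "matroid_connected S r"
    and "r S \<ge> 4"
  shows "skew_representable TYPE('f::infinite) TYPE('v::infinite) S r \<longleftrightarrow>
         fully_modular_extendable S r"
  using skew_representable_imp_extendable[OF assms(1)] extendable_imp_skew_representable[OF assms] by blast

end
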